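(* There is an algorithm which takes as input an $n$-vertex graph $G=(V,E)$ and a positive integer $k$, runs in time $\mathcal{O}(\tau^{\tau^{\mathcal{O}(\tau)}}+2^{\tau}\cdot n)$ where $\tau=\tau(G)$ is the vertex cover number of $G$, and decides whether $\mathrm{bt}(G)\le k$. If the answer is positive, it can also output a $k$-page book embedding of $G$.
   Context: $[k]=\{1,\dots,k\}$. A $k$-page book embedding of a graph $G=(V,E)$ is a pair $\langle \prec,\sigma\rangle$ where $\prec$ is a linear order of $V$ and $\sigma\colon E\to[k]$, such that there are no two edges $uv,wx\in E$ with $\sigma(uv)=\sigma(wx)$ and $u\prec w\prec v\prec x$. The book thickness $\mathrm{bt}(G)$ is the minimum $k$ such that $G$ admits a $k$-page book embedding (over all vertex orders). The vertex cover number $\tau(G)$ is the minimum size of a set $C\subseteq V$ such that every edge has an endpoint in $C$. *)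

theory Defs
  imports Main
begin

section \<open>Book embeddings and vertex covers\<close>

definition simple_graph :: "'a set \<Rightarrow> 'a set set \<Rightarrow> bool" where
  "simple_graph V E \<longleftrightarrow>
     finite V \<and> (\<forall>e\<in>E. \<exists>u\<in>V. \<exists>v\<in>V. u \<noteq> v \<and> e = {u, v})"

text \<open>
  The order of the vertices is a reflexive linear order \<open>r\<close>; the strict order
  used in the crossing condition is \<open>r - Id\<close>.
\<close>

definition book_embedding ::
  "nat \<Rightarrow> 'a set \<Rightarrow> 'a set set \<Rightarrow> 'a rel \<Rightarrow> ('a set \<Rightarrow> nat) \<Rightarrow> bool" where
  "book_embedding k V E r \<sigma> \<longleftrightarrow>
     linear_order_on V r \<and> \<sigma> ` E \<subseteq> {1..k} \<and>
     \<not> (\<exists>u v w x. {u, v} \<in> E \<and> {w, x} \<in> E \<and> \<sigma> {u, v} = \<sigma> {w, x} \<and>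
           (u, w) \<in> r - Id \<and> (w, v) \<in> r - Id \<and> (v, x) \<in> r - Id)"

definition book_thickness :: "'a set \<Rightarrow> 'a set set \<Rightarrow> nat" where
  "book_thickness V E = (LEAST k. \<exists>r \<sigma>. book_embedding k V E r \<sigma>)"

definition vertex_cover :: "'a set \<Rightarrow> 'a set set \<Rightarrow> 'a set \<Rightarrow> bool" where
  "vertex_cover V E C \<longleftrightarrow> C \<subseteq> V \<and> (\<forall>e\<in>E. e \<inter> C \<noteq> {})"

definition vertex_cover_number :: "'a set \<Rightarrow> 'a set set \<Rightarrow> nat" where
  "vertex_cover_number V E = (LEAST t. \<exists>C. vertex_cover V E C \<and> card C = t)"


section \<open>Programs and their running time\<close>

text \<open>
  The machine model is the uniform-cost RAM with addition and (truncated)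
  subtraction, presented as a structured language. A state consists of scalar
  registers and of arrays, both named by natural numbers; a program mentions
  only finitely many of them. Indirect addressing is array access with a computed
  index. There is no unit-cost multiplication or division.
\<close>

type_synonym state = "(nat \<Rightarrow> nat) \<times> (nat \<Rightarrow> nat \<Rightarrow> nat)"

datatype exp =
    Const nat
  | Var nat
  | Read nat exp
  | Add exp exp
  | Sub exp exp

datatype bexp =
    Less exp exp
  | Equal exp exp
  | Neg bexp
  | Conj bexp bexp

datatype com =
    Skip
  | Assign nat exp
  | Write nat exp exp
  | Seq com com
  | Cond bexp com com
  | While bexp com

fun eval :: "exp \<Rightarrow> state \<Rightarrow> nat" where
  "eval (Const c) s = c"
| "eval (Var x) s = fst s x"
| "eval (Read a i) s = snd s a (eval i s)"
| "eval (Add e f) s = eval e s + eval f s"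
| "eval (Sub e f) s = eval e s - eval f s"

fun beval :: "bexp \<Rightarrow> state \<Rightarrow> bool" where
  "beval (Less e f) s \<longleftrightarrow> eval e s < eval f s"
| "beval (Equal e f) s \<longleftrightarrow> eval e s = eval f s"
| "beval (Neg b) s \<longleftrightarrow> \<not> beval b s"
| "beval (Conj b b') s \<longleftrightarrow> beval b s \<and> beval b' s"

fun cost :: "exp \<Rightarrow> nat" where
  "cost (Const c) = 1"
| "cost (Var x) = 1"
| "cost (Read a i) = 1 + cost i"
| "cost (Add e f) = 1 + cost e + cost f"
| "cost (Sub e f) = 1 + cost e + cost f"

fun bcost :: "bexp \<Rightarrow> nat" where
  "bcost (Less e f) = 1 + cost e + cost f"
| "bcost (Equal e f) = 1 + cost e + cost f"
| "bcost (Neg b) = 1 + bcost b"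
| "bcost (Conj b b') = 1 + bcost b + bcost b'"

definition set_reg :: "nat \<Rightarrow> nat \<Rightarrow> state \<Rightarrow> state" where
  "set_reg x v s = ((fst s)(x := v), snd s)"

definition set_cell :: "nat \<Rightarrow> nat \<Rightarrow> nat \<Rightarrow> state \<Rightarrow> state" where
  "set_cell a i v s = (fst s, (snd s)(a := (snd s a)(i := v)))"

text \<open>
  \<open>exec P s t s'\<close>: started in state \<open>s\<close>, the program \<open>P\<close> halts after exactly \<open>t\<close>
  elementary steps in state \<open>s'\<close>.
\<close>

inductive exec :: "com \<Rightarrow> state \<Rightarrow> nat \<Rightarrow> state \<Rightarrow> bool" where
  Skip: "exec Skip s 1 s"
| Assign: "exec (Assign x e) s (1 + cost e) (set_reg x (eval e s) s)"
| Write: "exec (Write a i e) s (1 + cost i + cost e) (set_cell a (eval i s) (eval e s) s)"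
| Seq: "exec P s t s' \<Longrightarrow> exec Q s' t' s'' \<Longrightarrow> exec (Seq P Q) s (t + t') s''"
| CondTrue: "beval b s \<Longrightarrow> exec P s t s' \<Longrightarrow> exec (Cond b P Q) s (1 + bcost b + t) s'"
| CondFalse: "\<not> beval b s \<Longrightarrow> exec Q s t s' \<Longrightarrow> exec (Cond b P Q) s (1 + bcost b + t) s'"
| WhileFalse: "\<not> beval b s \<Longrightarrow> exec (While b P) s (1 + bcost b) s"
| WhileTrue: "beval b s \<Longrightarrow> exec P s t s' \<Longrightarrow> exec (While b P) s' t' s'' \<Longrightarrow>
    exec (While b P) s (1 + bcost b + t + t') s''"

inductive_cases SkipE: "exec Skip s t s'"
  and AssignE: "exec (Assign x e) s t s'"
  and WriteE: "exec (Write a i e) s t s'"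
  and SeqE: "exec (Seq P Q) s t s'"
  and CondE: "exec (Cond b P Q) s t s'"
  and WhileE: "exec (While b P) s t s'"

lemma exec_deterministic:
  "exec P s t s' \<Longrightarrow> exec P s u s'' \<Longrightarrow> u = t \<and> s'' = s'"
proof (induction arbitrary: u s'' rule: exec.induct)
  case (Seq P s t s1 Q t' s2)
  from Seq.prems obtain v v' r where "exec P s v r" "exec Q r v' s''" "u = v + v'"
    by (rule SeqE)
  with Seq.IH show ?case by metis
next
  case (CondTrue b s P t s1 Q)
  from CondTrue.prems obtain v where "exec P s v s''" "u = 1 + bcost b + v"
    by (rule CondE) (use CondTrue.hyps in simp_all)
  with CondTrue.IH show ?case by metis
next
  case (CondFalse b s Q t s1 P)
  from CondFalse.prems obtain v where "exec Q s v s''" "u = 1 + bcost b + v"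
    by (rule CondE) (use CondFalse.hyps in simp_all)
  with CondFalse.IH show ?case by metis
next
  case (WhileFalse b s P)
  from WhileFalse.prems show ?case
    by (rule WhileE) (use WhileFalse.hyps in simp_all)
next
  case (WhileTrue b s P t s1 t' s2)
  from WhileTrue.prems obtain v v' r
    where "exec P s v r" "exec (While b P) r v' s''" "u = 1 + bcost b + v + v'"
    by (rule WhileE) (use WhileTrue.hyps in simp_all)
  with WhileTrue.IH show ?case by metis
qed (auto elim: SkipE AssignE WriteE)


section \<open>Encoding of inputs and outputs\<close>

text \<open>
  The vertices of an \<open>n\<close>-vertex graph are numbered \<open>0, \<dots>, n - 1\<close>. The graph is given
  by a list that contains every edge exactly once, in any order and with the two
  endpoints in any order.
\<close>

definition edge_list :: "(nat \<times> nat) list \<Rightarrow> nat set set \<Rightarrow> bool" where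
  "edge_list es E \<longleftrightarrow>
     distinct (map (\<lambda>(u, v). {u, v}) es) \<and> set (map (\<lambda>(u, v). {u, v}) es) = E"

text \<open>
  Input: registers \<open>0, 1, 2\<close> hold \<open>n\<close>, \<open>k\<close> and the number of edges; cell \<open>j\<close> of the
  arrays \<open>0\<close> and \<open>1\<close> holds the two endpoints of the \<open>j\<close>-th edge. All other
  memory is zero.
\<close>

definition input_state :: "nat \<Rightarrow> nat \<Rightarrow> (nat \<times> nat) list \<Rightarrow> state" where
  "input_state n k es =
     ((\<lambda>_. 0)(0 := n, 1 := k, 2 := length es),
      (\<lambda>_ _. 0)(0 := (\<lambda>j. if j < length es then fst (es ! j) else 0),
                1 := (\<lambda>j. if j < length es then snd (es ! j) else 0)))"

text \<open>
  Output: register \<open>0\<close> holds \<open>1\<close> for yes and \<open>0\<close> for no. In the positive case the first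
  \<open>n\<close> cells of array \<open>2\<close> list the vertices in the order of the book, and cell \<open>j\<close> of
  array \<open>3\<close> holds the page of the \<open>j\<close>-th edge of the input.
\<close>

definition list_order :: "'a list \<Rightarrow> 'a rel" where
  "list_order xs = {(xs ! i, xs ! j) | i j. i \<le> j \<and> j < length xs}"

definition outputs_book_embedding ::
  "nat \<Rightarrow> nat \<Rightarrow> nat set set \<Rightarrow> (nat \<times> nat) list \<Rightarrow> state \<Rightarrow> bool" where
  "outputs_book_embedding k n E es s \<longleftrightarrow>
     (\<exists>\<sigma>. (\<forall>j<length es. \<sigma> {fst (es ! j), snd (es ! j)} = snd s 3 j) \<and>
          book_embedding k {..<n} E (list_order (map (snd s 2) [0..<n])) \<sigma>)"

end

theory Submission
  imports Defs "HOL-Library.Nat_Bijection" "HOL-Library.FuncSet"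
begin

text \<open>
  A maximal matching yields in linear time a vertex cover \<open>C\<close> with \<open>c \<le> 2\<tau>\<close> vertices. Pages beyond the
  \<open>c\<close>-th are useless, because \<open>c\<close> pages always suffice (one per vertex of \<open>C\<close>); so let \<open>k \<le> c\<close>.
  Group the vertices outside \<open>C\<close> by their neighbourhoods. If in a \<open>k\<close>-page book embedding three vertices
  with the same neighbourhood have their edges coloured alike, then these colours are pairwise
  distinct, since a monochromatic \<open>K\<^sub>2\<^sub>,\<^sub>3\<close> has a crossing; and a vertex outside \<open>C\<close> whose
  edges lie on distinct pages can be duplicated in place. Hence it suffices to keep
  \<open>2 c\<^sup>c + 1\<close> vertices of each group: the embeddings of this kernel, found by exhaustive search, extend to
  the whole graph. The kernel has \<open>\<tau>\<^bsup>O(\<tau>)\<^esup>\<close> vertices and edges, so that the search takes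
  \<open>\<tau>\<close> to the power \<open>\<tau>\<^bsup>O(\<tau>)\<^esup>\<close> steps, and everything else takes \<open>O(\<tau> n)\<close> steps plus a polynomial in
  the size of the kernel.
\<close>

section \<open>Reasoning about programs\<close>

text \<open>What makes the search affordable is that nothing in a code depends on \<open>n\<close>
  or on the original \<open>k\<close>: positions matter only up to order, so \<open>N\<close> values
  suffice for them, and a page below \<open>k\<close> \<le> \<open>c\<close> \<le> \<open>N\<close>
  is again a digit in base \<open>N\<close>. A kernel embedding is therefore one number below
  \<open>N^L\<close>, and all these numbers are simply tried. The embedding found need not be the
  restriction of one of the whole graph: the pigeonhole argument applies to every valid code. The
  constant \<open>2 c^c + 1\<close> is that pigeonhole: a neighbourhood has at most \<open>c\<close>
  vertices, so at most \<open>c^c\<close> page patterns occur in a group, and a pattern that repeats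
  a page occurs at most twice. The other constraint is the machine. Without multiplication or
  division, powers come from repeated addition, digits from repeated subtraction, and tests for
  equal neighbourhoods from sums of powers of two used as addresses; a counting sort keeps the
  ordering of the vertices linear in \<open>n\<close>. Large sparse arrays cost nothing, as memory
  starts at zero and only the accesses made are paid for.\<close>

definition runs :: "com \<Rightarrow> state \<Rightarrow> nat \<Rightarrow> (state \<Rightarrow> bool) \<Rightarrow> bool" where
  "runs P s T Q \<longleftrightarrow> (\<exists>t s'. exec P s t s' \<and> t \<le> T \<and> Q s')"

fun regs :: "com \<Rightarrow> nat set" where
  "regs Skip = {}"
| "regs (Assign x e) = {x}"
| "regs (Write a i e) = {}"
| "regs (Seq P Q) = regs P \<union> regs Q"
| "regs (Cond b P Q) = regs P \<union> regs Q"
| "regs (While b P) = regs P"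

fun arrs :: "com \<Rightarrow> nat set" where
  "arrs Skip = {}"
| "arrs (Assign x e) = {}"
| "arrs (Write a i e) = {a}"
| "arrs (Seq P Q) = arrs P \<union> arrs Q"
| "arrs (Cond b P Q) = arrs P \<union> arrs Q"
| "arrs (While b P) = arrs P"

lemma fst_set_reg [simp]: "fst (set_reg x v s) = (fst s)(x := v)"
  and snd_set_reg [simp]: "snd (set_reg x v s) = snd s"
  and fst_set_cell [simp]: "fst (set_cell a i v s) = fst s"
  and snd_set_cell [simp]: "snd (set_cell a i v s) = (snd s)(a := (snd s a)(i := v))"
  by (simp_all add: set_reg_def set_cell_def)

text \<open>The frame condition is read off the syntax: registers and arrays that a program never
  writes are preserved. Loop invariants can then be confined to what the loop changes.\<close>

definition unchanged :: "com \<Rightarrow> state \<Rightarrow> state \<Rightarrow> bool" where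
  "unchanged P s s' \<longleftrightarrow> (\<forall>x. x \<notin> regs P \<longrightarrow> fst s' x = fst s x) \<and>
     (\<forall>a. a \<notin> arrs P \<longrightarrow> snd s' a = snd s a)"

lemma exec_unchanged: "exec P s t s' \<Longrightarrow> unchanged P s s'"
  by (induction rule: exec.induct) (auto simp: unchanged_def)

lemma runs_unchanged: "runs P s T Q \<Longrightarrow> runs P s T (\<lambda>s'. Q s' \<and> unchanged P s s')"
  unfolding runs_def using exec_unchanged by blast

lemma runsE:
  assumes "runs P s T Q"
  obtains t s' where "exec P s t s'" "t \<le> T" "Q s'" "unchanged P s s'"
  using assms exec_unchanged unfolding runs_def by blast

lemma runs_mono: "runs P s T Q \<Longrightarrow> T \<le> T' \<Longrightarrow> (\<And>s'. Q s' \<Longrightarrow> Q' s') \<Longrightarrow> runs P s T' Q'"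
  unfolding runs_def by (meson order_trans)

lemma runs_mono_frame:
  assumes "runs P s T Q" "T \<le> T'" "\<And>s'. Q s' \<Longrightarrow> unchanged P s s' \<Longrightarrow> Q' s'"
  shows "runs P s T' Q'"
  using runs_mono[OF runs_unchanged[OF assms(1)] assms(2)] assms(3) by blast

lemma runs_Seq: "runs P s T1 (\<lambda>s'. runs Q s' T2 R) \<Longrightarrow> T1 + T2 \<le> T \<Longrightarrow> runs (Seq P Q) s T R"
  unfolding runs_def by (meson exec.Seq add_mono order_trans)

lemma runs_Seq_frame:
  assumes "runs P s T1 Q1" "\<And>s'. Q1 s' \<Longrightarrow> unchanged P s s' \<Longrightarrow> runs Q s' T2 R"
  shows "runs (Seq P Q) s (T1 + T2) R"
  by (rule runs_Seq[OF runs_mono_frame[OF assms(1) order_refl assms(2)]]) auto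

lemma runs_Assign: "Q (set_reg x (eval e s) s) \<Longrightarrow> 1 + cost e \<le> T \<Longrightarrow> runs (Assign x e) s T Q"
  unfolding runs_def using exec.Assign by blast

lemma runs_Write:
  "Q (set_cell a (eval i s) (eval e s) s) \<Longrightarrow> 1 + cost i + cost e \<le> T \<Longrightarrow> runs (Write a i e) s T Q"
  unfolding runs_def using exec.Write by blast

lemma runs_Skip: "Q s \<Longrightarrow> 1 \<le> T \<Longrightarrow> runs Skip s T Q"
  unfolding runs_def using exec.Skip by blast

lemma runs_Cond:
  assumes "beval b s \<Longrightarrow> runs P s T0 R" "\<not> beval b s \<Longrightarrow> runs Q s T0 R" "1 + bcost b + T0 \<le> T"
  shows "runs (Cond b P Q) s T R"
proof (cases "beval b s")
  case True
  then show ?thesis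
    using assms(1,3) unfolding runs_def
    by (meson exec.CondTrue add_le_mono le_refl order_trans)
next
  case False
  then show ?thesis
    using assms(2,3) unfolding runs_def
    by (meson exec.CondFalse add_le_mono le_refl order_trans)
qed

text \<open>The invariant is indexed by the number of iterations still to come, so termination and
  the iteration count come together with correctness. The last summands pay for the failing test of
  the guard.\<close>

lemma runs_While:
  assumes "I b s"
    and step: "\<And>i s'. I (Suc i) s' \<Longrightarrow> beval g s' \<and> runs P s' T (I i)"
    and stop: "\<And>s'. I 0 s' \<Longrightarrow> \<not> beval g s'"
  shows "runs (While g P) s (b * (T + 1 + bcost g) + 1 + bcost g) (I 0)"
  using assms(1)
proof (induction b arbitrary: s)
  case 0
  then show ?case
    unfolding runs_def using stop exec.WhileFalse by fastforce
next
  case (Suc b)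
  from step[OF Suc.prems] obtain t s' where
    g: "beval g s" and t: "exec P s t s'" "t \<le> T" "I b s'"
    unfolding runs_def by blast
  from Suc.IH[OF t(3)] obtain t' s'' where
    t': "exec (While g P) s' t' s''" "t' \<le> b * (T + 1 + bcost g) + 1 + bcost g" "I 0 s''"
    unfolding runs_def by blast
  have "exec (While g P) s (1 + bcost g + t + t') s''"
    using exec.WhileTrue[OF g t(1) t'(1)] .
  moreover have "1 + bcost g + t + t' \<le> Suc b * (T + 1 + bcost g) + 1 + bcost g"
    using t(2) t'(2) by simp
  ultimately show ?case
    unfolding runs_def using t'(3) by blast
qed

definition For :: "nat \<Rightarrow> nat \<Rightarrow> com \<Rightarrow> com" where
  "For x y P = Seq (Assign x (Const 0))
     (While (Less (Var x) (Var y)) (Seq P (Assign x (Add (Var x) (Const 1)))))"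

lemma regs_For [simp]: "regs (For x y P) = insert x (regs P)"
  and arrs_For [simp]: "arrs (For x y P) = arrs P"
  by (auto simp: For_def)

text \<open>Each round costs \<open>T\<close> for the body, 4 for the guard and 4 for the increment;
  the extra round in \<open>b + 1\<close> covers the initialisation and the last test. The invariant
  at \<open>Suc i\<close> is required of the state after the increment, hence the
  \<open>set_reg\<close> in it.\<close>

lemma runs_For:
  assumes y: "fst s y = b" and nin: "x \<notin> regs P" "y \<notin> regs P" "x \<noteq> y"
    and init: "I 0 (set_reg x 0 s)"
    and step: "\<And>i s'. i < b \<Longrightarrow> fst s' x = i \<Longrightarrow> unchanged (For x y P) s s' \<Longrightarrow> I i s' \<Longrightarrow>
      runs P s' T (\<lambda>s''. I (Suc i) (set_reg x (Suc i) s''))"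
    and post: "\<And>s'. fst s' x = b \<Longrightarrow> unchanged (For x y P) s s' \<Longrightarrow> I b s' \<Longrightarrow> Q s'"
    and T: "(b + 1) * (T + 8) \<le> T'"
  shows "runs (For x y P) s T' Q"
proof -
  let ?u = "unchanged (For x y P) s"
  define J where "J r s' \<longleftrightarrow> r \<le> b \<and> fst s' x = b - r \<and> ?u s' \<and> I (b - r) s'" for r s'
  have yb: "fst s' y = b" if "?u s'" for s'
    using that y nin by (simp add: unchanged_def)
  let ?body = "Seq P (Assign x (Add (Var x) (Const 1)))"
  have "runs (While (Less (Var x) (Var y)) ?body) (set_reg x 0 s)
    (b * ((T + 4) + 1 + bcost (Less (Var x) (Var y))) + 1 + bcost (Less (Var x) (Var y))) (J 0)"
  proof (rule runs_While)
    show "J b (set_reg x 0 s)"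
      using init by (simp add: J_def unchanged_def)
  next
    fix r s' assume J: "J (Suc r) s'"
    then have r: "Suc r \<le> b" "fst s' x = b - Suc r" "?u s'" "I (b - Suc r) s'"
      by (auto simp: J_def)
    have Suc: "Suc (b - Suc r) = b - r" using r by simp
    have "runs P s' T (\<lambda>s''. I (b - r) (set_reg x (b - r) s''))"
      using step[of "b - Suc r" s'] r by (simp add: Suc)
    from runs_unchanged[OF this]
    have "runs P s' T (\<lambda>s''. runs (Assign x (Add (Var x) (Const 1))) s'' 4 (J r))"
    proof (rule runs_mono[OF _ order_refl], elim conjE)
      fix s'' assume I: "I (b - r) (set_reg x (b - r) s'')" and u: "unchanged P s' s''"
      have x: "fst s'' x = b - Suc r" using u nin r by (simp add: unchanged_def)
      have "?u (set_reg x (b - r) s'')" using u r(3) by (auto simp: unchanged_def)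
      with x I Suc show "runs (Assign x (Add (Var x) (Const 1))) s'' 4 (J r)"
        using r(1) by (intro runs_Assign) (auto simp: J_def)
    qed
    then have "runs ?body s' (T + 4) (J r)"
      by (rule runs_Seq) simp
    then show "beval (Less (Var x) (Var y)) s' \<and> runs ?body s' (T + 4) (J r)"
      using r yb by simp
  next
    fix s' assume "J 0 s'"
    then show "\<not> beval (Less (Var x) (Var y)) s'" using yb by (simp add: J_def)
  qed
  then have "runs (For x y P) s T' (J 0)"
    unfolding For_def
    by (intro runs_Seq[where ?T1.0 = 2] runs_Assign) (use T in \<open>auto simp: algebra_simps\<close>)
  then show ?thesis
    by (rule runs_mono) (auto simp: J_def intro: post)
qed

section \<open>Loop-free programs, executed by simplification\<close>

fun straight :: "com \<Rightarrow> bool" where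
  "straight (Seq P Q) \<longleftrightarrow> straight P \<and> straight Q"
| "straight (Cond b P Q) \<longleftrightarrow> straight P \<and> straight Q"
| "straight (While b P) \<longleftrightarrow> False"
| "straight _ \<longleftrightarrow> True"

fun den :: "com \<Rightarrow> state \<Rightarrow> state" where
  "den Skip s = s"
| "den (Assign x e) s = set_reg x (eval e s) s"
| "den (Write a i e) s = set_cell a (eval i s) (eval e s) s"
| "den (Seq P Q) s = den Q (den P s)"
| "den (Cond b P Q) s = (if beval b s then den P s else den Q s)"
| "den (While b P) s = s"

text \<open>The branches of a conditional are added instead of maximised: still an upper bound, and
  evaluated by plain addition.\<close>

fun tim :: "com \<Rightarrow> nat" where
  "tim Skip = 1"
| "tim (Assign x e) = 1 + cost e"
| "tim (Write a i e) = 1 + cost i + cost e"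
| "tim (Seq P Q) = tim P + tim Q"
| "tim (Cond b P Q) = 1 + bcost b + (tim P + tim Q)"
| "tim (While b P) = 0"

lemma runs_straight:
  assumes "straight P" "Q (den P s)" "tim P \<le> T"
  shows "runs P s T Q"
proof -
  have "straight P \<Longrightarrow> runs P s (tim P) (\<lambda>s'. s' = den P s)" for s
  proof (induction P arbitrary: s)
    case (Seq P Q)
    have "runs P s (tim P) (\<lambda>s'. runs Q s' (tim Q) (\<lambda>s''. s'' = den (Seq P Q) s))"
      by (rule runs_mono[OF Seq.IH(1)]) (use Seq in \<open>auto simp del: split_paired_All\<close>)
    then show ?case
      by (rule runs_Seq) simp
  next
    case (Cond b P Q)
    then show ?case
      by (auto intro!: runs_Cond[where ?T0.0 = "tim P + tim Q"] runs_mono[OF Cond.IH(1)] runs_mono[OF Cond.IH(2)])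
  qed (auto intro: runs_Skip runs_Assign runs_Write)
  from this[OF assms(1)] show ?thesis
    by (rule runs_mono) (use assms in auto)
qed

section \<open>Book embeddings given by vertex positions\<close>

text \<open>Positions as natural numbers are a common format for the digits of a code, the
  restriction of an order to the kernel, and the ranks in the final list.\<close>

definition noncrossing :: "'a set set \<Rightarrow> ('a \<Rightarrow> nat) \<Rightarrow> ('a set \<Rightarrow> nat) \<Rightarrow> bool" where
  "noncrossing F pos \<sigma> \<longleftrightarrow> (\<forall>u v w x. {u, v} \<in> F \<longrightarrow> {w, x} \<in> F \<longrightarrow> \<sigma> {u, v} = \<sigma> {w, x} \<longrightarrow>
     \<not> (pos u < pos w \<and> pos w < pos v \<and> pos v < pos x))"

definition nbr :: "'a set set \<Rightarrow> 'a \<Rightarrow> 'a set" where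
  "nbr E v = {u. {u, v} \<in> E}"

lemma simple_graph_edge:
  assumes "simple_graph V E" "{u, v} \<in> E"
  shows "u \<in> V" "v \<in> V" "u \<noteq> v"
proof -
  obtain a b where "a \<in> V" "b \<in> V" "a \<noteq> b" "{u, v} = {a, b}"
    using assms unfolding simple_graph_def by blast
  then show "u \<in> V" "v \<in> V" "u \<noteq> v" by (auto simp: doubleton_eq_iff)
qed

text \<open>The position of \<open>v\<close> is the number of elements of \<open>K\<close> strictly
  below it. This keeps the order within \<open>K\<close> and stays below \<open>card K\<close>, so
  that positions fit the digits of a code.\<close>

lemma linear_order_positions:
  assumes r: "linear_order_on V r" and K: "K \<subseteq> V" "finite K"
  obtains pos where "inj_on pos K" "\<And>v. v \<in> K \<Longrightarrow> pos v < card K"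
    "\<And>u v. u \<in> K \<Longrightarrow> v \<in> K \<Longrightarrow> pos u < pos v \<Longrightarrow> (u, v) \<in> r - Id"
proof -
  define below where "below v = {w \<in> K. (w, v) \<in> r - Id}" for v
  define pos where "pos v = card (below v)" for v
  have tr: "trans r" and as: "antisym r" and tot: "total_on V r"
    using r by (auto simp: linear_order_on_def partial_order_on_def preorder_on_def)
  have fin: "finite (below v)" for v
    using K by (simp add: below_def)
  have less: "pos u < pos v" if "u \<in> K" "v \<in> K" "(u, v) \<in> r - Id" for u v
  proof -
    have "below u \<subseteq> below v"
      using that tr as unfolding below_def trans_def antisym_def by blast
    moreover have "u \<in> below v - below u"
      using that by (auto simp: below_def)
    ultimately show ?thesis
      unfolding pos_def by (intro psubset_card_mono fin) auto
  qed
  have cmp: "(u, v) \<in> r - Id \<or> (v, u) \<in> r - Id" if "u \<in> K" "v \<in> K" "u \<noteq> v" for u v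
    using that K tot by (auto simp: total_on_def)
  show thesis
  proof
    show "inj_on pos K"
      by (rule inj_onI) (metis cmp less less_irrefl)
    show "pos v < card K" if "v \<in> K" for v
      unfolding pos_def using that K by (intro psubset_card_mono) (auto simp: below_def)
    show "(u, v) \<in> r - Id" if "u \<in> K" "v \<in> K" "pos u < pos v" for u v
      using that cmp less by (metis less_asym less_irrefl)
  qed
qed

lemma book_embedding_positions:
  assumes "book_embedding k V E r \<sigma>" "simple_graph V E" "K \<subseteq> V"
  obtains pos where "inj_on pos K" "\<And>v. v \<in> K \<Longrightarrow> pos v < card K"
    "noncrossing {e \<in> E. e \<subseteq> K} pos \<sigma>"
proof -
  have "finite K" using assms by (auto simp: simple_graph_def intro: finite_subset)
  moreover have "linear_order_on V r" using assms by (simp add: book_embedding_def)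
  ultimately obtain pos where pos: "inj_on pos K" "\<And>v. v \<in> K \<Longrightarrow> pos v < card K"
    "\<And>u v. u \<in> K \<Longrightarrow> v \<in> K \<Longrightarrow> pos u < pos v \<Longrightarrow> (u, v) \<in> r - Id"
    using linear_order_positions assms(3) by metis
  have "noncrossing {e \<in> E. e \<subseteq> K} pos \<sigma>"
    unfolding noncrossing_def
  proof (intro allI impI notI)
    fix u v w x
    assume "{u, v} \<in> {e \<in> E. e \<subseteq> K}" "{w, x} \<in> {e \<in> E. e \<subseteq> K}" "\<sigma> {u, v} = \<sigma> {w, x}"
      "pos u < pos w \<and> pos w < pos v \<and> pos v < pos x"
    moreover from this have "(u, w) \<in> r - Id" "(w, v) \<in> r - Id" "(v, x) \<in> r - Id"
      by (auto dest: pos(3))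
    ultimately show False
      using assms(1) unfolding book_embedding_def by blast
  qed
  with pos that show thesis by blast
qed

text \<open>An injection of \<open>{..<n}\<close> into itself is a permutation, so every index of
  the list is a rank and \<open>f\<close> inverts \<open>rank\<close>; comparing indices is
  comparing ranks.\<close>

lemma list_order_positions:
  assumes inj: "inj_on rank {..<n}" and lt: "\<And>v. v < n \<Longrightarrow> rank v < n"
    and out: "\<And>v. v < n \<Longrightarrow> f (rank v) = v"
  shows "list_order (map f [0..<n]) = {(u, v). u < n \<and> v < n \<and> rank u \<le> rank v}"
proof -
  have "rank ` {..<n} = {..<n}"
    using inj lt by (intro card_subset_eq) (auto simp: card_image)
  then have surj: "\<exists>v<n. i = rank v" if "i < n" for i
    using that by (auto simp: set_eq_iff image_iff)
  show ?thesis
  proof (rule subset_antisym; rule subrelI)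
    fix u v assume "(u, v) \<in> list_order (map f [0..<n])"
    then obtain i j where "i \<le> j" "j < n" "u = f i" "v = f j"
      by (auto simp: list_order_def)
    moreover from this surj obtain i' j' where "i' < n" "j' < n" "i = rank i'" "j = rank j'"
      by (metis order_le_less_trans)
    ultimately show "(u, v) \<in> {(u, v). u < n \<and> v < n \<and> rank u \<le> rank v}"
      using out by auto
  next
    fix u v assume "(u, v) \<in> {(u, v). u < n \<and> v < n \<and> rank u \<le> rank v}"
    then show "(u, v) \<in> list_order (map f [0..<n])"
      using lt[of v] lt[of u] out[of u] out[of v] unfolding list_order_def
      by (intro CollectI exI[of _ "rank u"] exI[of _ "rank v"]) auto
  qed
qed

lemma book_embedding_list_order:
  assumes rank: "inj_on rank {..<n}" "\<And>v. v < n \<Longrightarrow> rank v < n"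
      "\<And>v. v < n \<Longrightarrow> f (rank v) = v"
    and E: "simple_graph {..<n} E" "\<sigma> ` E \<subseteq> {1..k}" "noncrossing E rank \<sigma>"
  shows "book_embedding k {..<n} E (list_order (map f [0..<n])) \<sigma>"
proof -
  let ?r = "{(u, v). u < n \<and> v < n \<and> rank u \<le> rank v}"
  have inj: "u = v" if "u < n" "v < n" "rank u = rank v" for u v
    using rank(1) that by (auto simp: inj_on_def)
  have "linear_order_on {..<n} ?r"
    unfolding linear_order_on_def partial_order_on_def preorder_on_def
  proof (intro conjI)
    show "antisym ?r" by (rule antisymI) (simp add: inj)
  qed (auto simp: refl_on_def trans_def total_on_def)
  moreover have lt: "rank u < rank v" if "(u, v) \<in> ?r - Id" for u v
    using that inj[of u v] by (cases "rank u = rank v") auto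
  have "\<not> (\<exists>u v w x. {u, v} \<in> E \<and> {w, x} \<in> E \<and> \<sigma> {u, v} = \<sigma> {w, x} \<and>
           (u, w) \<in> ?r - Id \<and> (w, v) \<in> ?r - Id \<and> (v, x) \<in> ?r - Id)"
  proof (rule notI, elim exE conjE)
    fix u v w x
    assume "{u, v} \<in> E" "{w, x} \<in> E" "\<sigma> {u, v} = \<sigma> {w, x}"
      and r: "(u, w) \<in> ?r - Id" "(w, v) \<in> ?r - Id" "(v, x) \<in> ?r - Id"
    with E(3) show False
      using lt[OF r(1)] lt[OF r(2)] lt[OF r(3)] by (simp add: noncrossing_def)
  qed
  ultimately show ?thesis
    using E(2) list_order_positions[of rank n f] rank unfolding book_embedding_def by simp
qed

lemma book_embedding_mono: "book_embedding k V E r \<sigma> \<Longrightarrow> k \<le> k' \<Longrightarrow> book_embedding k' V E r \<sigma>"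
  unfolding book_embedding_def by (meson atLeastatMost_subset_iff order_refl order_trans)

text \<open>Each edge goes to the page of one of its endpoints in \<open>C\<close>. The edges of a
  page then form a star, and edges sharing a vertex never cross, whatever the order of the vertices;
  the natural order is taken.\<close>

lemma book_embedding_vertex_cover:
  fixes n :: nat
  assumes E: "simple_graph {..<n} E" and C: "vertex_cover {..<n} E C"
  shows "\<exists>r \<sigma>. book_embedding (card C) {..<n} E r \<sigma>"
proof -
  have fin: "finite C" using C finite_subset[of C "{..<n}"] by (simp add: vertex_cover_def)
  then obtain g where g: "bij_betw g C {1..card C}"
    using finite_same_card_bij[of C "{1..card C}"] by auto
  define p where "p e = (SOME v. v \<in> e \<inter> C)" for e
  have p: "p e \<in> e \<inter> C" if "e \<in> E" for e
  proof -
    have "\<exists>v. v \<in> e \<inter> C" using C that unfolding vertex_cover_def by blast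
    then show ?thesis unfolding p_def by (rule someI_ex)
  qed
  have "noncrossing E id (\<lambda>e. g (p e))"
    unfolding noncrossing_def
  proof (intro allI impI notI)
    fix u v w x
    assume e: "{u, v} \<in> E" "{w, x} \<in> E" "g (p {u, v}) = g (p {w, x})"
      and "id u < id w \<and> id w < id v \<and> id v < id x"
    then have "u < w" "w < v" "v < x" by auto
    moreover have "p {u, v} = p {w, x}"
      using e p g by (meson IntD2 bij_betw_def inj_onD)
    ultimately show False using p[OF e(1)] p[OF e(2)] by auto
  qed
  moreover have "(\<lambda>e. g (p e)) ` E \<subseteq> {1..card C}"
    using p g by (auto dest: bij_betwE)
  ultimately have "book_embedding (card C) {..<n} E (list_order (map id [0..<n])) (\<lambda>e. g (p e))"
    using E by (intro book_embedding_list_order[where rank = id]) auto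
  then show ?thesis by blast
qed

text \<open>The cover supplies a witness for the \<open>LEAST\<close> in
  \<open>book_thickness\<close> and bounds it, so the page limit can be capped at
  \<open>card C\<close>. Without the cap, the number of pages to be tried would not be bounded in
  terms of the cover.\<close>

lemma book_thickness_le_iff:
  fixes n :: nat
  assumes E: "simple_graph {..<n} E" and C: "vertex_cover {..<n} E C"
  shows "book_thickness {..<n} E \<le> k \<longleftrightarrow>
    (\<exists>r \<sigma>. book_embedding (min k (card C)) {..<n} E r \<sigma>)"
proof
  let ?P = "\<lambda>k. \<exists>r \<sigma>. book_embedding k {..<n} E r \<sigma>"
  have c: "?P (card C)" using book_embedding_vertex_cover[OF E C] .
  {
    assume le: "book_thickness {..<n} E \<le> k"
    have "?P (book_thickness {..<n} E)"
      unfolding book_thickness_def using LeastI[of ?P, OF c] .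
    moreover have "book_thickness {..<n} E \<le> card C"
      unfolding book_thickness_def using Least_le[of ?P, OF c] .
    ultimately show "?P (min k (card C))" using le by (meson book_embedding_mono min.boundedI)
  }
  assume "?P (min k (card C))"
  from Least_le[of ?P, OF this] show "book_thickness {..<n} E \<le> k"
    unfolding book_thickness_def by simp
qed

section \<open>Vertices with equal neighbourhoods\<close>

text \<open>\<open>K\<^sub>2\<^sub>,\<^sub>3\<close> is not outerplanar: two of \<open>a, b, d\<close> lie on the same side of \<open>x, y\<close>.\<close>

lemma noncrossing_K23:
  assumes nc: "noncrossing F pos \<sigma>" and inj: "inj_on pos {x, y, a, b, d}"
    and dist: "x \<noteq> y" "a \<noteq> b" "a \<noteq> d" "b \<noteq> d" "{a, b, d} \<inter> {x, y} = {}"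
    and e: "\<And>v. v \<in> {a, b, d} \<Longrightarrow> {v, x} \<in> F \<and> {v, y} \<in> F \<and> \<sigma> {v, x} = p \<and> \<sigma> {v, y} = p"
  shows False
proof -
  have nc': "\<not> (pos u < pos w \<and> pos w < pos v \<and> pos v < pos z)"
    if "{u, v} \<in> F" "{w, z} \<in> F" "\<sigma> {u, v} = \<sigma> {w, z}" for u v w z
    using nc that unfolding noncrossing_def by blast
  \<comment> \<open>The assumption \<open>s\<close> says that \<open>v\<close> and \<open>v'\<close>
    are on the same side of \<open>x\<close> and \<open>y\<close>: both between them or both
    outside.\<close>
  have same: False
    if v: "v \<in> {a, b, d}" "v' \<in> {a, b, d}" "v \<noteq> v'"
      and s: "(pos v < pos x \<longleftrightarrow> pos v < pos y) = (pos v' < pos x \<longleftrightarrow> pos v' < pos y)" for v v'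
  proof -
    note ev = e[OF v(1)] e[OF v(2)]
    have ex: "{x, v} \<in> F" "{y, v} \<in> F" "{x, v'} \<in> F" "{y, v'} \<in> F"
      "\<sigma> {x, v} = p" "\<sigma> {y, v} = p" "\<sigma> {x, v'} = p" "\<sigma> {y, v'} = p"
      using ev by (simp_all add: insert_commute)
    have ne: "pos v \<noteq> pos v'" "pos v \<noteq> pos x" "pos v \<noteq> pos y" "pos v' \<noteq> pos x"
      "pos v' \<noteq> pos y" "pos x \<noteq> pos y"
      using v inj dist unfolding inj_on_def by blast+
    have cross: "\<not> (pos u < pos w \<and> pos w < pos t \<and> pos t < pos z)"
      if "u \<in> {x, y} \<and> t \<in> {v, v'} \<or> u \<in> {v, v'} \<and> t \<in> {x, y}"
        "w \<in> {x, y} \<and> z \<in> {v, v'} \<or> w \<in> {v, v'} \<and> z \<in> {x, y}" for u t w z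
      using that ex ev by (intro nc') auto
    \<comment> \<open>Of the 24 orders of \<open>v\<close>, \<open>v'\<close>, \<open>x\<close>,
      \<open>y\<close>, exactly 16 put \<open>v\<close> and \<open>v'\<close> on the same side. In
      each of them the first and third point, and likewise the second and fourth, are joined by an
      edge of page \<open>p\<close>, so these two edges cross.\<close>
    have c: "\<not> (pos v < pos v' \<and> pos v' < pos x \<and> pos x < pos y)" "\<not> (pos v < pos v' \<and> pos v' < pos y \<and> pos y < pos x)"
      "\<not> (pos v' < pos v \<and> pos v < pos x \<and> pos x < pos y)" "\<not> (pos v' < pos v \<and> pos v < pos y \<and> pos y < pos x)"
      "\<not> (pos x < pos y \<and> pos y < pos v \<and> pos v < pos v')" "\<not> (pos x < pos y \<and> pos y < pos v' \<and> pos v' < pos v)"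
      "\<not> (pos y < pos x \<and> pos x < pos v \<and> pos v < pos v')" "\<not> (pos y < pos x \<and> pos x < pos v' \<and> pos v' < pos v)"
      "\<not> (pos x < pos v \<and> pos v < pos v' \<and> pos v' < pos y)" "\<not> (pos x < pos v' \<and> pos v' < pos v \<and> pos v < pos y)"
      "\<not> (pos y < pos v' \<and> pos v' < pos v \<and> pos v < pos x)" "\<not> (pos y < pos v \<and> pos v < pos v' \<and> pos v' < pos x)"
      "\<not> (pos v < pos y \<and> pos y < pos x \<and> pos x < pos v')" "\<not> (pos v < pos x \<and> pos x < pos y \<and> pos y < pos v')"
      "\<not> (pos v' < pos y \<and> pos y < pos x \<and> pos x < pos v)" "\<not> (pos v' < pos x \<and> pos x < pos y \<and> pos y < pos v)"
      by (rule cross; simp)+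
    have "pos v < pos v' \<or> pos v' < pos v" "pos x < pos y \<or> pos y < pos x"
      "pos v < pos x \<longleftrightarrow> \<not> pos x < pos v" "pos v < pos y \<longleftrightarrow> \<not> pos y < pos v"
      "pos v' < pos x \<longleftrightarrow> \<not> pos x < pos v'" "pos v' < pos y \<longleftrightarrow> \<not> pos y < pos v'"
      using ne by auto
    with s c show False by argo
  qed
  \<comment> \<open>Three vertices and two sides: some two of them share a side.\<close>
  show False
    using same[of a b] same[of a d] same[of b d] dist by auto
qed

text \<open>A page pattern that takes the same value at \<open>x\<close> and \<open>y\<close> is
  shared by at most two vertices, as three would give a monochromatic
  \<open>K\<^sub>2\<^sub>,\<^sub>3\<close>. If every vertex of \<open>X\<close> had such a pattern,
  \<open>X\<close> would have at most \<open>2 * k ^ card U\<close> elements.\<close>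

lemma exists_vertex_with_distinct_pages:
  assumes nc: "noncrossing F pos \<sigma>" and inj: "inj_on pos K" and K: "finite K" "X \<subseteq> K" "U \<subseteq> K"
    and U: "X \<inter> U = {}" "\<And>w x. w \<in> X \<Longrightarrow> x \<in> U \<Longrightarrow> {w, x} \<in> F"
    and \<sigma>: "\<And>w x. w \<in> X \<Longrightarrow> x \<in> U \<Longrightarrow> \<sigma> {w, x} < k"
    and big: "card X > 2 * k ^ card U"
  shows "\<exists>w\<in>X. inj_on (\<lambda>x. \<sigma> {w, x}) U"
proof (rule ccontr)
  assume "\<not> ?thesis"
  then have no: "\<And>w. w \<in> X \<Longrightarrow> \<not> inj_on (\<lambda>x. \<sigma> {w, x}) U" by blast
  \<comment> \<open>Restricting the pattern to \<open>U\<close> puts it into an extensional function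
    space, which is finite with \<open>k ^ card U\<close> elements.\<close>
  define g where "g w = (\<lambda>x\<in>U. \<sigma> {w, x})" for w
  have fin: "finite X" "finite U" using finite_subset[OF K(2,1)] finite_subset[OF K(3,1)] by auto
  have two: "card {w \<in> X. g w = h} \<le> 2" for h
  proof (rule ccontr)
    assume "\<not> ?thesis"
    then have "3 \<le> card {w \<in> X. g w = h}" by simp
    then obtain Y where Y: "Y \<subseteq> {w \<in> X. g w = h}" "card Y = 3"
      by (meson obtain_subset_with_card_n)
    then obtain a b d where abd: "Y = {a, b, d}" "a \<noteq> b" "a \<noteq> d" "b \<noteq> d"
      unfolding card_3_iff by blast
    then have X: "a \<in> X" "b \<in> X" "d \<in> X" and g: "g b = g a" "g d = g a" using Y by auto
    from no[OF X(1)] obtain x y where xy: "x \<in> U" "y \<in> U" "x \<noteq> y" "\<sigma> {a, x} = \<sigma> {a, y}"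
      by (auto simp: inj_on_def)
    have eq: "\<sigma> {b, z} = \<sigma> {a, z}" "\<sigma> {d, z} = \<sigma> {a, z}" if "z \<in> U" for z
      using fun_cong[OF g(1), of z] fun_cong[OF g(2), of z] that by (simp_all add: g_def)
    show False
    proof (rule noncrossing_K23[OF nc _ xy(3) abd(2-4)])
      show "inj_on pos {x, y, a, b, d}"
        by (rule inj_on_subset[OF inj]) (use X xy K in auto)
      show "{a, b, d} \<inter> {x, y} = {}" using X xy U by auto
      show "{v, x} \<in> F \<and> {v, y} \<in> F \<and> \<sigma> {v, x} = \<sigma> {a, x} \<and> \<sigma> {v, y} = \<sigma> {a, x}"
        if "v \<in> {a, b, d}" for v
        using that X xy U(2) eq by auto
    qed
  qed
  have "g ` X \<subseteq> U \<rightarrow>\<^sub>E {..<k}"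
    using \<sigma> by (auto simp: g_def)
  then have "card (g ` X) \<le> card (U \<rightarrow>\<^sub>E {..<k})"
    by (intro card_mono finite_PiE fin) simp_all
  also have "\<dots> = k ^ card U"
    by (simp add: card_PiE fin)
  finally have img: "card (g ` X) \<le> k ^ card U" .
  have sum: "card X = (\<Sum>h\<in>g ` X. card {w \<in> X. g w = h})"
  proof -
    have "X = (\<Union>h\<in>g ` X. {w \<in> X. g w = h})" by auto
    then have "card X = card (\<Union>h\<in>g ` X. {w \<in> X. g w = h})" by simp
    also have "\<dots> = (\<Sum>h\<in>g ` X. card {w \<in> X. g w = h})"
      using fin by (intro card_UN_disjoint) auto
    finally show ?thesis .
  qed
  have "card X \<le> (\<Sum>h\<in>g ` X. 2)"
    unfolding sum by (rule sum_mono) (rule two)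
  with img big show False by simp
qed

text \<open>One endpoint lies in \<open>C\<close> and is fixed by \<open>\<rho>\<close>; the other
  moves to a vertex with the same neighbourhood and so stays adjacent to it.\<close>

lemma representative_edge:
  assumes E: "simple_graph V E" and C: "vertex_cover V E C" "C \<subseteq> K"
    and \<rho>: "\<And>v. v \<in> V \<Longrightarrow> \<rho> v \<in> K" "\<And>v. v \<in> K \<Longrightarrow> \<rho> v = v"
    and new: "\<And>v. v \<in> V - K \<Longrightarrow> nbr E (\<rho> v) = nbr E v"
    and e: "{u, v} \<in> E"
  shows "{\<rho> u, \<rho> v} \<in> {e \<in> E. e \<subseteq> K}"
proof -
  have \<rho>V: "nbr E (\<rho> v) = nbr E v" if "v \<in> V" for v
    using that new \<rho> by (cases "v \<in> K") auto
  have uv: "u \<in> V" "v \<in> V" using simple_graph_edge[OF E e] by auto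
  have "u \<in> C \<or> v \<in> C" using C(1) e by (auto simp: vertex_cover_def)
  then have "{\<rho> u, \<rho> v} \<in> E"
  proof
    assume "u \<in> C"
    then have "\<rho> u = u" using \<rho> C by auto
    moreover have "u \<in> nbr E v" using e by (simp add: nbr_def)
    ultimately show ?thesis using \<rho>V[OF uv(2)] by (auto simp: nbr_def)
  next
    assume "v \<in> C"
    then have "\<rho> v = v" using \<rho> C by auto
    moreover have "v \<in> nbr E u" using e by (simp add: nbr_def insert_commute)
    ultimately show ?thesis using \<rho>V[OF uv(1)] by (auto simp: nbr_def insert_commute)
  qed
  then show ?thesis using uv \<rho> by auto
qed

text \<open>
  A vertex outside the cover all of whose edges lie on different pages may be replaced by
  any number of consecutive copies of itself.
\<close>

lemma noncrossing_extend:
  assumes E: "simple_graph V E" and C: "vertex_cover V E C" "C \<subseteq> K"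
    and nc: "noncrossing {e \<in> E. e \<subseteq> K} pos \<sigma>" and inj: "inj_on pos K"
    and \<rho>: "\<And>v. v \<in> V \<Longrightarrow> \<rho> v \<in> K" "\<And>v. v \<in> K \<Longrightarrow> \<rho> v = v"
    and new: "\<And>v. v \<in> V - K \<Longrightarrow> \<rho> v \<notin> C \<and> nbr E (\<rho> v) = nbr E v \<and>
      inj_on (\<lambda>x. \<sigma> {\<rho> v, x}) (nbr E v)"
    and mono: "\<And>u v. u \<in> V \<Longrightarrow> v \<in> V \<Longrightarrow> rank u < rank v \<Longrightarrow> pos (\<rho> u) \<le> pos (\<rho> v)"
  shows "noncrossing E rank (\<lambda>e. \<sigma> (\<rho> ` e))"
proof -
  have nbr_in: "nbr E v \<subseteq> C" if "v \<notin> C" for v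
    using C(1) that by (auto simp: nbr_def vertex_cover_def)
  have \<rho>V: "nbr E (\<rho> v) = nbr E v" if "v \<in> V" for v
    using that new \<rho> by (cases "v \<in> K") auto
  have kernel: "{\<rho> u, \<rho> v} \<in> {e \<in> E. e \<subseteq> K}" if "{u, v} \<in> E" for u v
    by (rule representative_edge[OF E C \<rho> _ that]) (use new in auto)
  \<comment> \<open>Two edges on one page that leave different vertices with the same representative
    end in the same vertex. One of the two vertices lies outside \<open>K\<close>, so the
    representative has its edges on distinct pages; the far endpoints lie in \<open>C\<close>, where
    \<open>\<rho>\<close> is the identity.\<close>
  have copies: "v = x"
    if e: "{u, v} \<in> E" "{w, x} \<in> E" and eq: "\<rho> u = \<rho> w" "u \<noteq> w"
      and pg: "\<sigma> {\<rho> u, \<rho> v} = \<sigma> {\<rho> w, \<rho> x}" for u v w x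
  proof -
    have V: "u \<in> V" "w \<in> V" "v \<in> V" "x \<in> V"
      using simple_graph_edge[OF E e(1)] simple_graph_edge[OF E e(2)] by auto
    have "u \<notin> K \<or> w \<notin> K" using eq \<rho> by auto
    then have z: "\<rho> u \<notin> C" "inj_on (\<lambda>x. \<sigma> {\<rho> u, x}) (nbr E (\<rho> u))"
      using new[of u] new[of w] V eq \<rho>V by auto
    have "v \<in> nbr E (\<rho> u)" "x \<in> nbr E (\<rho> u)"
      using e \<rho>V[OF V(1)] \<rho>V[OF V(2)] eq by (auto simp: nbr_def insert_commute)
    moreover from this have "\<rho> v = v" "\<rho> x = x"
      using nbr_in[OF z(1)] C \<rho> by auto
    ultimately show ?thesis
      using z(2) pg eq by (auto simp: inj_on_def)
  qed
  show ?thesis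
    unfolding noncrossing_def
  proof (intro allI impI notI)
    fix u v w x
    assume e: "{u, v} \<in> E" "{w, x} \<in> E" "\<sigma> (\<rho> ` {u, v}) = \<sigma> (\<rho> ` {w, x})"
      and lt: "rank u < rank w \<and> rank w < rank v \<and> rank v < rank x"
    have pg: "\<sigma> {\<rho> u, \<rho> v} = \<sigma> {\<rho> w, \<rho> x}" using e(3) by simp
    have V: "u \<in> V" "w \<in> V" "v \<in> V" "x \<in> V"
      using simple_graph_edge[OF E e(1)] simple_graph_edge[OF E e(2)] by auto
    have le: "pos (\<rho> u) \<le> pos (\<rho> w)" "pos (\<rho> w) \<le> pos (\<rho> v)" "pos (\<rho> v) \<le> pos (\<rho> x)"
      using mono V lt by auto
    have "\<not> (pos (\<rho> u) < pos (\<rho> w) \<and> pos (\<rho> w) < pos (\<rho> v) \<and> pos (\<rho> v) < pos (\<rho> x))"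
      using nc kernel[OF e(1)] kernel[OF e(2)] pg unfolding noncrossing_def by blast
    \<comment> \<open>Weak monotonicity turns a crossing into a weakly increasing chain of
      representatives. A strict chain would be a crossing in the kernel, so two neighbours in the
      chain share a representative; then \<open>copies\<close> identifies the other two of the four
      vertices, which \<open>rank\<close> separates.\<close>
    with le have "pos (\<rho> u) = pos (\<rho> w) \<or> pos (\<rho> w) = pos (\<rho> v) \<or> pos (\<rho> v) = pos (\<rho> x)"
      by auto
    then have "\<rho> u = \<rho> w \<or> \<rho> w = \<rho> v \<or> \<rho> v = \<rho> x"
      using inj \<rho>(1) V by (auto simp: inj_on_def)
    moreover have "u \<noteq> w" "w \<noteq> v" "v \<noteq> x" "v \<noteq> x" "u \<noteq> x" using lt by auto
    ultimately show False
      using copies[of u v w x] copies[of v u w x] copies[of v u x w] e pg lt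
      by (auto simp: insert_commute)
  qed
qed

section \<open>The kernel\<close>

text \<open>
  Memory layout. Registers: 3 size \<open>c\<close> of the cover, 4 next weight (a power of two), 5 number of
  vertices kept per neighbourhood, 6 and 7 numbers \<open>N\<close> and \<open>M\<close> of kernel vertices and edges,
  8 code length \<open>L = N + M\<close>, 9 number of codes \<open>N\<^sup>L\<close>, 10 success flag, 11 validity flag,
  12 to 17 counters and temporaries.
  Arrays: 4 membership in the cover, 5 weights of the cover vertices, 6 neighbourhood of a vertex as
  the sum of the weights, 7 number of vertices kept with a given neighbourhood, 8 kernel vertices,
  9 their indices, 10 membership in the kernel, 11 kernel edges, 12 the current code, 13 vertices with two edges on
  the same page, 14 representative of a neighbourhood, 15 representative of a vertex, 16 sorting keys,
  17 multiples of \<open>n\<close> (as there is no multiplication), 18 page of the edge \<open>uv\<close> at index \<open>u n + v\<close>,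
  20 and 21 counts and offsets of the counting sort.
\<close>

abbreviation seq :: "com \<Rightarrow> com \<Rightarrow> com"  (infixr \<open>;;\<close> 60) where
  "P ;; Q \<equiv> Seq P Q"

locale graph_input =
  fixes n :: nat and E :: "nat set set" and es :: "(nat \<times> nat) list"
  assumes simple: "simple_graph {..<n} E" and edge_list: "edge_list es E"
begin

abbreviation m :: nat where "m \<equiv> length es"

definition src :: "nat \<Rightarrow> nat" where "src j = fst (es ! j)"

definition tgt :: "nat \<Rightarrow> nat" where "tgt j = snd (es ! j)"

lemma edge_nth: "map (\<lambda>(u, v). {u, v}) es ! j = {src j, tgt j}" if "j < m"
  using that by (simp add: src_def tgt_def split: prod.split)

lemma edge_in: "j < m \<Longrightarrow> {src j, tgt j} \<in> E"
  using edge_list edge_nth[of j] nth_mem[of j "map (\<lambda>(u, v). {u, v}) es"]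
  unfolding edge_list_def by simp

lemma edge_ex:
  assumes "e \<in> E"
  shows "\<exists>j<m. e = {src j, tgt j}"
proof -
  have "e \<in> set (map (\<lambda>(u, v). {u, v}) es)" using assms edge_list by (simp add: edge_list_def)
  then obtain j where "j < m" "map (\<lambda>(u, v). {u, v}) es ! j = e"
    unfolding in_set_conv_nth length_map by blast
  then show ?thesis using edge_nth[of j] by auto
qed

lemma edge_inj:
  assumes "i < m" "j < m" "{src i, tgt i} = {src j, tgt j}"
  shows "i = j"
proof -
  have "distinct (map (\<lambda>(u, v). {u, v}) es)" using edge_list by (simp add: edge_list_def)
  from nth_eq_iff_index_eq[OF this, of i j] show ?thesis
    using assms edge_nth[of i] edge_nth[of j] by simp
qed

lemma edge_lt: "j < m \<Longrightarrow> src j < n" "j < m \<Longrightarrow> tgt j < n" "j < m \<Longrightarrow> src j \<noteq> tgt j"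
  using simple_graph_edge[OF simple edge_in] by auto

definition graph_state :: "state \<Rightarrow> bool" where
  "graph_state s \<longleftrightarrow> fst s 0 = n \<and> fst s 2 = m \<and>
     (\<forall>j<m. snd s 0 j = src j \<and> snd s 1 j = tgt j)"

lemma graph_state_unchanged:
  assumes "graph_state s" "unchanged P s s'" "regs P \<inter> {0, 2} = {}" "arrs P \<inter> {0, 1} = {}"
  shows "graph_state s'"
  using assms by (auto simp: graph_state_def unchanged_def)

text \<open>With weight \<open>2 ^ i\<close> for the cover vertex of index \<open>i\<close> and
  weight 0 elsewhere, adding up the weights of all neighbours yields the binary code of the
  neighbours in the cover.\<close>

definition cover_state :: "nat list \<Rightarrow> state \<Rightarrow> bool" where
  "cover_state xs s \<longleftrightarrow> distinct xs \<and> set xs \<subseteq> {..<n} \<and> fst s 3 = length xs \<and>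
     (\<forall>v. snd s 4 v = (if v \<in> set xs then 1 else 0)) \<and>
     (\<forall>i<length xs. snd s 5 (xs ! i) = 2 ^ i) \<and> (\<forall>v. v \<notin> set xs \<longrightarrow> snd s 5 v = 0)"

end

section \<open>A vertex cover from a greedy maximal matching\<close>

definition cover_step :: com where
  "cover_step =
     Cond (Conj (Equal (Read 4 (Read 0 (Var 12))) (Const 0)) (Equal (Read 4 (Read 1 (Var 12))) (Const 0)))
       (Write 4 (Read 0 (Var 12)) (Const 1);; Write 5 (Read 0 (Var 12)) (Var 4);;
        Assign 4 (Add (Var 4) (Var 4));;
        Write 4 (Read 1 (Var 12)) (Const 1);; Write 5 (Read 1 (Var 12)) (Var 4);;
        Assign 4 (Add (Var 4) (Var 4));;
        Assign 3 (Add (Var 3) (Const 2)))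
       Skip"

definition cover_prog :: com where
  "cover_prog = Assign 4 (Const 1);; For 12 2 cover_step"

context graph_input
begin

text \<open>The invariant compares the list with an arbitrary vertex cover \<open>X\<close>: each
  chosen edge contributes two new vertices, at least one of them in \<open>X\<close>. Applied to a
  minimum \<open>X\<close> this gives the factor 2, and no matching has to be mentioned.\<close>

lemma runs_cover_prog:
  assumes g: "graph_state s" and z: "fst s 3 = 0" "\<And>v. snd s 4 v = 0" "\<And>v. snd s 5 v = 0"
  shows "runs cover_prog s (100 * (m + 1)) (\<lambda>s'. \<exists>xs. cover_state xs s' \<and>
    vertex_cover {..<n} E (set xs) \<and> length xs \<le> 2 * vertex_cover_number {..<n} E)"
proof -
  define I where "I j s' \<longleftrightarrow> (\<exists>xs. cover_state xs s' \<and> fst s' 4 = 2 ^ length xs \<and>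
    (\<forall>i<j. src i \<in> set xs \<or> tgt i \<in> set xs) \<and>
    (\<forall>X. vertex_cover {..<n} E X \<longrightarrow> length xs \<le> 2 * card (X \<inter> set xs)))" for j s'
  have "runs (For 12 2 cover_step) (set_reg 4 1 s) (90 * (m + 1)) (I m)"
  proof (rule runs_For[where I = I and b = m and T = 80])
    show "I 0 (set_reg 12 0 (set_reg 4 1 s))"
      unfolding I_def by (rule exI[of _ "[]"]) (simp add: cover_state_def z)
  next
    fix j s' assume j: "j < m" "fst s' 12 = j"
      and u: "unchanged (For 12 2 cover_step) (set_reg 4 1 s) s'" and I: "I j s'"
    have e: "snd s' 0 j = src j" "snd s' 1 j = tgt j"
      using g u j by (auto simp: graph_state_def unchanged_def cover_step_def)
    from I obtain xs where xs: "cover_state xs s'" "fst s' 4 = 2 ^ length xs"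
      "\<And>i. i < j \<Longrightarrow> src i \<in> set xs \<or> tgt i \<in> set xs"
      "\<And>X. vertex_cover {..<n} E X \<Longrightarrow> length xs \<le> 2 * card (X \<inter> set xs)"
      unfolding I_def by blast
    show "runs cover_step s' 80 (\<lambda>s''. I (Suc j) (set_reg 12 (Suc j) s''))"
    proof (cases "src j \<in> set xs \<or> tgt j \<in> set xs")
      case True
      then have "I (Suc j) (set_reg 12 (Suc j) s')"
        unfolding I_def using xs by (intro exI[of _ xs]) (auto simp: cover_state_def less_Suc_eq)
      with True show ?thesis
        using xs(1) j e
        by (intro runs_straight) (auto simp: cover_step_def cover_state_def)
    next
      case False
      let ?ys = "xs @ [src j, tgt j]"
      have "I (Suc j) (set_reg 12 (Suc j) (den cover_step s'))"
        unfolding I_def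
      proof (intro exI[of _ ?ys] conjI allI impI)
        show "cover_state ?ys (set_reg 12 (Suc j) (den cover_step s'))"
          using False xs(1,2) j e edge_lt[OF j(1)]
          by (auto simp: cover_state_def cover_step_def nth_append less_Suc_eq nth_Cons'
              simp del: One_nat_def)
        show "fst (set_reg 12 (Suc j) (den cover_step s')) 4 = 2 ^ length ?ys"
          using False xs(1,2) j e by (auto simp: cover_state_def cover_step_def)
        show "src i \<in> set ?ys \<or> tgt i \<in> set ?ys" if "i < Suc j" for i
          using that xs(3) by (auto simp: less_Suc_eq)
        show "length ?ys \<le> 2 * card (X \<inter> set ?ys)" if X: "vertex_cover {..<n} E X" for X
        proof -
          have "{src j, tgt j} \<inter> X \<noteq> {}"
            using X edge_in[OF j(1)] by (auto simp: vertex_cover_def)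
          then obtain w where w: "w \<in> X" "w \<in> {src j, tgt j}" by auto
          have "Suc (card (X \<inter> set xs)) = card (insert w (X \<inter> set xs))"
            using w False by auto
          also have "\<dots> \<le> card (X \<inter> set ?ys)"
            using w by (intro card_mono) auto
          finally show ?thesis using xs(4)[OF X] by simp
        qed
      qed
      then show ?thesis
        by (intro runs_straight) (auto simp: cover_step_def)
    qed
  qed (use g in \<open>auto simp: graph_state_def cover_step_def\<close>)
  then have "runs cover_prog s (100 * (m + 1)) (I m)"
    unfolding cover_prog_def by (intro runs_Seq[where ?T1.0 = 2] runs_Assign) auto
  then show ?thesis
  proof (rule runs_mono)
    fix s' assume "I m s'"
    then obtain xs where xs: "cover_state xs s'" "\<And>i. i < m \<Longrightarrow> src i \<in> set xs \<or> tgt i \<in> set xs"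
      "\<And>X. vertex_cover {..<n} E X \<Longrightarrow> length xs \<le> 2 * card (X \<inter> set xs)"
      unfolding I_def by blast
    have vc: "vertex_cover {..<n} E (set xs)"
      unfolding vertex_cover_def
    proof (intro conjI ballI)
      fix e assume "e \<in> E"
      then obtain j where "j < m" "e = {src j, tgt j}" using edge_ex by blast
      then show "e \<inter> set xs \<noteq> {}" using xs(2)[of j] by auto
    qed (use xs(1) in \<open>simp add: cover_state_def\<close>)
    then have "\<exists>X. vertex_cover {..<n} E X \<and> card X = vertex_cover_number {..<n} E"
      unfolding vertex_cover_number_def by (rule_tac LeastI) blast
    then obtain X where X: "vertex_cover {..<n} E X" "card X = vertex_cover_number {..<n} E"
      by blast
    have "finite X" using X finite_subset[of X "{..<n}"] by (auto simp: vertex_cover_def)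
    then have "card (X \<inter> set xs) \<le> card X" by (intro card_mono) auto
    with xs(3)[OF X(1)] X(2) have "length xs \<le> 2 * vertex_cover_number {..<n} E" by simp
    with xs(1) vc show "\<exists>xs. cover_state xs s' \<and> vertex_cover {..<n} E (set xs) \<and>
      length xs \<le> 2 * vertex_cover_number {..<n} E" by blast
  qed simp
qed

end

section \<open>Neighbourhood codes and the choice of the kernel\<close>

definition mask_step :: com where
  "mask_step =
     Write 6 (Read 1 (Var 12)) (Add (Read 6 (Read 1 (Var 12))) (Read 5 (Read 0 (Var 12))));;
     Write 6 (Read 0 (Var 12)) (Add (Read 6 (Read 0 (Var 12))) (Read 5 (Read 1 (Var 12))))"

definition kernel_step :: com where
  "kernel_step =
     Cond (Conj (Equal (Read 4 (Var 12)) (Const 0)) (Neg (Less (Read 7 (Read 6 (Var 12))) (Var 5))))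
       Skip
       (Cond (Equal (Read 4 (Var 12)) (Const 0))
          (Write 7 (Read 6 (Var 12)) (Add (Read 7 (Read 6 (Var 12))) (Const 1))) Skip;;
        Write 8 (Var 6) (Var 12);; Write 9 (Var 12) (Var 6);; Write 10 (Var 12) (Const 1);;
        Assign 6 (Add (Var 6) (Const 1)))"

definition kernel_edge_step :: com where
  "kernel_edge_step =
     Cond (Conj (Equal (Read 10 (Read 0 (Var 12))) (Const 1)) (Equal (Read 10 (Read 1 (Var 12))) (Const 1)))
       (Write 11 (Var 7) (Var 12);; Assign 7 (Add (Var 7) (Const 1)))
       Skip"

definition power_prog :: "nat \<Rightarrow> nat \<Rightarrow> nat \<Rightarrow> com" where
  "power_prog r x y = Assign r (Const 1);;
     For 12 y (Assign 14 (Const 0);; For 13 x (Assign 14 (Add (Var 14) (Var r)));; Assign r (Var 14))"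

lemma regs_power_prog [simp]: "regs (power_prog r x y) = {r, 12, 13, 14}"
  and arrs_power_prog [simp]: "arrs (power_prog r x y) = {}"
  by (auto simp: power_prog_def)

text \<open>An addition has constant cost whatever the size of the numbers, so \<open>b ^ e\<close>
  takes only about \<open>b * e\<close> steps.\<close>

lemma runs_power_prog:
  assumes xy: "fst s x = b" "fst s y = e" and r: "r \<notin> {x, y, 12, 13, 14}"
    and nin: "{x, y} \<inter> {12, 13, 14} = {}"
  shows "runs (power_prog r x y) s (30 * ((b + 1) * (e + 1))) (\<lambda>s'. fst s' r = b ^ e)"
proof -
  let ?mul = "Assign 14 (Const 0);; For 13 x (Assign 14 (Add (Var 14) (Var r)));; Assign r (Var 14)"
  have "runs (For 12 y ?mul) (set_reg r 1 s) ((e + 1) * ((12 * (b + 1) + 4) + 8))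
    (\<lambda>s'. fst s' r = b ^ e)"
  proof (rule runs_For[where I = "\<lambda>i s'. fst s' r = b ^ i" and b = e and T = "12 * (b + 1) + 4"])
    fix i s' assume u: "unchanged (For 12 y ?mul) (set_reg r 1 s) s'" and I: "fst s' r = b ^ i"
    have x: "fst s' x = b" using u xy r nin by (auto simp: unchanged_def)
    have "runs (For 13 x (Assign 14 (Add (Var 14) (Var r)))) (set_reg 14 0 s') (12 * (b + 1))
      (\<lambda>s''. fst s'' 14 = b * b ^ i)"
    proof (rule runs_For[where I = "\<lambda>j s''. fst s'' 14 = j * b ^ i" and b = b and T = 4])
      fix j s''
      assume "unchanged (For 13 x (Assign 14 (Add (Var 14) (Var r)))) (set_reg 14 0 s') s''"
        "fst s'' 14 = j * b ^ i"
      then show "runs (Assign 14 (Add (Var 14) (Var r))) s'' 4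
          (\<lambda>s''. fst (set_reg 13 (Suc j) s'') 14 = Suc j * b ^ i)"
        using I r by (intro runs_straight) (auto simp: unchanged_def)
    qed (use r nin x in auto)
    then show "runs ?mul s' (12 * (b + 1) + 4) (\<lambda>s''. fst (set_reg 12 (Suc i) s'') r = b ^ Suc i)"
      using r
      by (intro runs_Seq[where ?T1.0 = 2 and ?T2.0 = "12 * (b + 1) + 2"] runs_Assign
          runs_Seq[where ?T1.0 = "12 * (b + 1)" and ?T2.0 = 2])
        (auto intro!: runs_Assign elim!: runs_mono)
  qed (use r nin xy in auto)
  then show ?thesis
    unfolding power_prog_def
    by (intro runs_Seq[where ?T1.0 = 2 and ?T2.0 = "(e + 1) * ((12 * (b + 1) + 4) + 8)"] runs_Assign)
      (auto simp: algebra_simps)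
qed

context graph_input
begin

lemma finite_nbr: "finite (nbr E v)"
  by (rule finite_subset[of _ "{..<n}"]) (use simple_graph_edge[OF simple] in \<open>auto simp: nbr_def\<close>)

text \<open>An edge adds to each endpoint the weight of the other. Every edge is listed once, so no
  weight is counted twice, and the accumulated value is a sum over a set.\<close>

lemma runs_mask:
  assumes g: "graph_state s" and z: "\<And>v. snd s 6 v = 0"
  shows "runs (For 12 2 mask_step) s (40 * (m + 1)) (\<lambda>s'. \<forall>v. snd s' 6 v = sum (snd s 5) (nbr E v))"
proof -
  define N where "N j v = {u. \<exists>i<j. {u, v} = {src i, tgt i}}" for j v
  show ?thesis
  proof (rule runs_For[where b = m and T = 32 and
      I = "\<lambda>j s'. \<forall>v. snd s' 6 v = sum (snd s 5) (N j v)"])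
    fix j s'
    assume j: "j < m" "fst s' 12 = j" and u: "unchanged (For 12 2 mask_step) s s'"
      and I: "\<forall>v. snd s' 6 v = sum (snd s 5) (N j v)"
    have e: "snd s' 0 j = src j" "snd s' 1 j = tgt j" "snd s' 5 = snd s 5"
      using g u j by (auto simp: graph_state_def unchanged_def mask_step_def)
    note ne = edge_lt(3)[OF j(1)]
    have fin: "finite (N j v)" for v
      by (rule finite_subset[OF _ finite_nbr[of v]]) (use j edge_in in \<open>auto simp: nbr_def N_def\<close>)
    have step: "N (Suc j) v = N j v \<union> {u. {u, v} = {src j, tgt j}}" for v
      unfolding N_def less_Suc_eq by blast
    have *: "N (Suc j) (src j) = insert (tgt j) (N j (src j))"
      "N (Suc j) (tgt j) = insert (src j) (N j (tgt j))"
      unfolding step by (auto simp: doubleton_eq_iff)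
    have **: "N (Suc j) v = N j v" if "v \<noteq> src j" "v \<noteq> tgt j" for v
      unfolding step using that by (auto simp: doubleton_eq_iff)
    have "{tgt j, src j} \<noteq> {src i, tgt i}" "{src j, tgt j} \<noteq> {src i, tgt i}" if "i < j" for i
      using edge_inj[of i j] that j by (auto simp: doubleton_eq_iff)
    then have new: "tgt j \<notin> N j (src j)" "src j \<notin> N j (tgt j)"
      unfolding N_def by blast+
    have "snd (den mask_step s') 6 v = sum (snd s 5) (N (Suc j) v)" for v
    proof -
      consider "v = src j" | "v = tgt j" | "v \<noteq> src j" "v \<noteq> tgt j" by blast
      then show ?thesis
        by cases (use I j(2) e ne new fin in \<open>simp_all add: mask_step_def * **\<close>)
    qed
    then show "runs mask_step s' 32
        (\<lambda>s''. \<forall>v. snd (set_reg 12 (Suc j) s'') 6 v = sum (snd s 5) (N (Suc j) v))"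
      by (intro runs_straight) (auto simp: mask_step_def)
  next
    fix s' assume I: "\<forall>v. snd s' 6 v = sum (snd s 5) (N m v)"
    have "N m v = nbr E v" for v
      using edge_ex edge_in by (auto simp: nbr_def N_def)
    with I show "\<forall>v. snd s' 6 v = sum (snd s 5) (nbr E v)" by simp
  qed (use g z in \<open>auto simp: graph_state_def mask_step_def N_def\<close>)
qed

text \<open>Identifies the sum of weights with a binary representation; uniqueness of the latter is
  what makes equal codes mean equal neighbourhoods.\<close>

lemma mask_eq_set_encode:
  assumes c: "cover_state xs s" and U: "U \<subseteq> set xs"
  shows "sum (snd s 5) U = set_encode {i. i < length xs \<and> xs ! i \<in> U}"
proof -
  let ?A = "{i. i < length xs \<and> xs ! i \<in> U}"
  have "inj_on ((!) xs) ?A"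
    using c by (auto simp: cover_state_def inj_on_def nth_eq_iff_index_eq)
  moreover have "(!) xs ` ?A = U"
  proof
    show "U \<subseteq> (!) xs ` ?A"
    proof
      fix u assume "u \<in> U"
      with U obtain i where "i < length xs" "xs ! i = u" by (metis in_set_conv_nth subsetD)
      with \<open>u \<in> U\<close> show "u \<in> (!) xs ` ?A" by blast
    qed
  qed auto
  ultimately have "sum (snd s 5) U = (\<Sum>i\<in>?A. snd s 5 (xs ! i))"
    by (metis (mono_tags, lifting) sum.reindex_cong)
  also have "\<dots> = (\<Sum>i\<in>?A. 2 ^ i)"
    using c by (intro sum.cong) (auto simp: cover_state_def)
  finally show ?thesis by (simp add: set_encode_def)
qed

lemma mask_inj:
  assumes c: "cover_state xs s" and U: "U \<subseteq> set xs" "W \<subseteq> set xs"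
    and eq: "sum (snd s 5) U = sum (snd s 5) W"
  shows "U = W"
proof -
  have "{i. i < length xs \<and> xs ! i \<in> U} = {i. i < length xs \<and> xs ! i \<in> W}"
    using eq unfolding mask_eq_set_encode[OF c U(1)] mask_eq_set_encode[OF c U(2)]
    by (simp add: set_encode_eq)
  then have "xs ! i \<in> U \<longleftrightarrow> xs ! i \<in> W" if "i < length xs" for i
    using that by blast
  then show ?thesis
    using U by (metis in_set_conv_nth subset_antisym subset_iff)
qed

definition kernel_state :: "nat list \<Rightarrow> state \<Rightarrow> bool" where
  "kernel_state ks s \<longleftrightarrow> distinct ks \<and> set ks \<subseteq> {..<n} \<and> fst s 6 = length ks \<and>
     (\<forall>i<length ks. snd s 8 i = ks ! i \<and> snd s 9 (ks ! i) = i) \<and>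
     (\<forall>v. snd s 10 v = (if v \<in> set ks then 1 else 0))"

text \<open>A class consists of the kept vertices outside the cover with one neighbourhood code. The
  upper bound \<open>h\<close> on every class keeps the kernel small; the lower bound on the class
  of an omitted vertex feeds the pigeonhole argument.\<close>

definition kernel_classes :: "nat set \<Rightarrow> (nat \<Rightarrow> nat) \<Rightarrow> nat \<Rightarrow> nat list \<Rightarrow> bool" where
  "kernel_classes C \<mu> h ks \<longleftrightarrow> C \<subseteq> set ks \<and>
     (\<forall>q. card {w \<in> set ks - C. \<mu> w = q} \<le> h) \<and>
     (\<forall>v<n. v \<notin> set ks \<longrightarrow> h \<le> card {w \<in> set ks - C. \<mu> w = \<mu> v})"

lemma runs_kernel:
  assumes g: "graph_state s" and c: "cover_state xs s"
    and z: "fst s 6 = 0" "\<And>v. snd s 7 v = 0" "\<And>v. snd s 10 v = 0"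
  shows "runs (For 12 0 kernel_step) s (60 * (n + 1))
    (\<lambda>s'. \<exists>ks. kernel_state ks s' \<and> kernel_classes (set xs) (snd s 6) (fst s 5) ks)"
proof -
  let ?C = "set xs" and ?\<mu> = "snd s 6" and ?h = "fst s 5"
  let ?cl = "\<lambda>ks q. {w \<in> set ks - ?C. ?\<mu> w = q}"
  \<comment> \<open>Array 7 counts, for each code, the vertices kept so far outside the cover; a
    vertex is skipped only when its counter has reached the limit.\<close>
  define I where "I v s' \<longleftrightarrow> (\<exists>ks. kernel_state ks s' \<and> set ks \<subseteq> {..<v} \<and> ?C \<inter> {..<v} \<subseteq> set ks \<and>
    (\<forall>q. snd s' 7 q = card (?cl ks q) \<and> card (?cl ks q) \<le> ?h) \<and>
    (\<forall>w<v. w \<notin> set ks \<longrightarrow> ?h \<le> card (?cl ks (?\<mu> w))))" for v s'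
  show ?thesis
  proof (rule runs_For[where b = n and T = 52 and I = I])
    show "I 0 (set_reg 12 0 s)"
      unfolding I_def by (rule exI[of _ "[]"]) (simp add: kernel_state_def z)
  next
    fix v s' assume v: "v < n" "fst s' 12 = v" and u: "unchanged (For 12 0 kernel_step) s s'"
      and I: "I v s'"
    have e: "snd s' 6 = ?\<mu>" "fst s' 5 = ?h" "snd s' 4 v = (if v \<in> ?C then 1 else 0)"
      using c u by (auto simp: cover_state_def unchanged_def kernel_step_def)
    from I obtain ks where ks: "kernel_state ks s'" "set ks \<subseteq> {..<v}" "?C \<inter> {..<v} \<subseteq> set ks"
      "\<And>q. snd s' 7 q = card (?cl ks q)" "\<And>q. card (?cl ks q) \<le> ?h"
      "\<And>w. w < v \<Longrightarrow> w \<notin> set ks \<Longrightarrow> ?h \<le> card (?cl ks (?\<mu> w))"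
      unfolding I_def by blast
    have "I (Suc v) (set_reg 12 (Suc v) (den kernel_step s'))"
    proof (cases "v \<notin> ?C \<and> ?h \<le> card (?cl ks (?\<mu> v))")
      case True
      then have "den kernel_step s' = s'"
        using v e ks(4) by (simp add: kernel_step_def)
      moreover have "I (Suc v) (set_reg 12 (Suc v) s')"
        unfolding I_def using ks True
        by (intro exI[of _ ks]) (auto simp: kernel_state_def less_Suc_eq)
      ultimately show ?thesis by simp
    next
      case False
      let ?ks = "ks @ [v]"
      have vn: "v \<notin> set ks" using ks(2) by auto
      have cl: "?cl ?ks q = (if v \<notin> ?C \<and> ?\<mu> v = q then insert v (?cl ks q) else ?cl ks q)" for q
        by auto
      have card: "card (?cl ?ks q) = (if v \<notin> ?C \<and> ?\<mu> v = q then Suc (card (?cl ks q)) else card (?cl ks q))" for q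
        unfolding cl using vn by simp
      show ?thesis
        unfolding I_def
      proof (intro exI[of _ ?ks] conjI allI impI)
        show "kernel_state ?ks (set_reg 12 (Suc v) (den kernel_step s'))"
          using False v e ks(1,4) vn
          by (auto simp: kernel_state_def kernel_step_def nth_append less_Suc_eq in_set_conv_nth)
        show "set ?ks \<subseteq> {..<Suc v}" using ks(2) by auto
        show "?C \<inter> {..<Suc v} \<subseteq> set ?ks" using ks(3) by (auto simp: less_Suc_eq)
        show "snd (set_reg 12 (Suc v) (den kernel_step s')) 7 q = card (?cl ?ks q)" for q
          unfolding card using False v e ks(4) by (auto simp: kernel_step_def)
        show "card (?cl ?ks q) \<le> ?h" for q
          unfolding card using False ks(5)[of q] by auto
        show "?h \<le> card (?cl ?ks (?\<mu> w))" if "w < Suc v" "w \<notin> set ?ks" for w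
          unfolding card using ks(6)[of w] that by auto
      qed
    qed
    then show "runs kernel_step s' 52 (\<lambda>s''. I (Suc v) (set_reg 12 (Suc v) s''))"
      by (intro runs_straight) (auto simp: kernel_step_def)
  next
    fix s' assume "I n s'"
    then obtain ks where ks: "kernel_state ks s'" "?C \<inter> {..<n} \<subseteq> set ks"
      "\<And>q. card (?cl ks q) \<le> ?h" "\<And>w. w < n \<Longrightarrow> w \<notin> set ks \<Longrightarrow> ?h \<le> card (?cl ks (?\<mu> w))"
      unfolding I_def by blast
    moreover have "?C \<subseteq> {..<n}" using c by (simp add: cover_state_def)
    ultimately show "\<exists>ks. kernel_state ks s' \<and> kernel_classes ?C ?\<mu> ?h ks"
      by (intro exI[of _ ks]) (auto simp: kernel_classes_def)
  qed (use g in \<open>auto simp: graph_state_def kernel_step_def\<close>)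
qed

definition kernel_edges :: "nat set \<Rightarrow> nat list" where
  "kernel_edges K = filter (\<lambda>j. src j \<in> K \<and> tgt j \<in> K) [0..<m]"

definition kernel_edge_state :: "nat set \<Rightarrow> state \<Rightarrow> bool" where
  "kernel_edge_state K s \<longleftrightarrow> fst s 7 = length (kernel_edges K) \<and>
     (\<forall>i<length (kernel_edges K). snd s 11 i = kernel_edges K ! i)"

lemma runs_kernel_edges:
  assumes g: "graph_state s" and k: "kernel_state ks s" and z: "fst s 7 = 0"
  shows "runs (For 12 2 kernel_edge_step) s (40 * (m + 1)) (kernel_edge_state (set ks))"
proof -
  let ?f = "\<lambda>j. filter (\<lambda>j. src j \<in> set ks \<and> tgt j \<in> set ks) [0..<j]"
  show ?thesis
  proof (rule runs_For[where b = m and T = 32 and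
      I = "\<lambda>j s'. fst s' 7 = length (?f j) \<and> (\<forall>i<length (?f j). snd s' 11 i = ?f j ! i)"])
    fix j s' assume j: "j < m" "fst s' 12 = j" and u: "unchanged (For 12 2 kernel_edge_step) s s'"
      and I: "fst s' 7 = length (?f j) \<and> (\<forall>i<length (?f j). snd s' 11 i = ?f j ! i)"
    have e: "snd s' 0 j = src j" "snd s' 1 j = tgt j"
      "\<And>v. snd s' 10 v = (if v \<in> set ks then 1 else 0)"
      using g k u j by (auto simp: graph_state_def kernel_state_def unchanged_def kernel_edge_step_def)
    show "runs kernel_edge_step s' 32 (\<lambda>s''. fst (set_reg 12 (Suc j) s'') 7 = length (?f (Suc j)) \<and>
      (\<forall>i<length (?f (Suc j)). snd (set_reg 12 (Suc j) s'') 11 i = ?f (Suc j) ! i))"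
      using I j e
      by (intro runs_straight) (auto simp: kernel_edge_step_def nth_append less_Suc_eq)
  qed (use g z in \<open>auto simp: graph_state_def kernel_edge_step_def kernel_edge_state_def kernel_edges_def\<close>)
qed

text \<open>A vertex outside the cover has its neighbourhood inside it, so at most
  \<open>2 ^ length xs\<close> codes occur, each for at most \<open>h\<close> kept vertices.\<close>

lemma card_kernel_le:
  assumes c: "cover_state xs s" and vc: "vertex_cover {..<n} E (set xs)"
    and \<mu>: "\<And>v. \<mu> v = sum (snd s 5) (nbr E v)" and k: "kernel_classes (set xs) \<mu> h ks"
  shows "card (set ks) \<le> length xs + 2 ^ length xs * h"
proof -
  let ?C = "set xs"
  have nb: "nbr E v \<subseteq> ?C" if "v \<notin> ?C" for v
    using vc that by (auto simp: nbr_def vertex_cover_def)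
  have len: "card ?C = length xs" using c by (simp add: cover_state_def distinct_card)
  have "set ks - ?C \<subseteq> (\<Union>U\<in>Pow ?C. {w \<in> set ks - ?C. \<mu> w = sum (snd s 5) U})"
    using nb \<mu> by auto
  then have "card (set ks - ?C) \<le> card (\<Union>U\<in>Pow ?C. {w \<in> set ks - ?C. \<mu> w = sum (snd s 5) U})"
    by (intro card_mono) auto
  also have "\<dots> \<le> (\<Sum>U\<in>Pow ?C. card {w \<in> set ks - ?C. \<mu> w = sum (snd s 5) U})"
    by (intro card_UN_le) auto
  also have "\<dots> \<le> (\<Sum>U\<in>Pow ?C. h)"
    using k by (intro sum_mono) (simp add: kernel_classes_def)
  also have "\<dots> = 2 ^ length xs * h" by (simp add: card_Pow len)
  finally have "card (set ks - ?C) \<le> 2 ^ length xs * h" .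
  moreover have "card (set ks) \<le> card ?C + card (set ks - ?C)"
    by (metis Un_Diff_cancel card_Un_le card_mono finite_UnI finite_set finite_Diff order_trans sup_ge2)
  ultimately show ?thesis using len by simp
qed

lemma card_kernel_edges_le: "length (kernel_edges (set ks)) \<le> card (set ks) * card (set ks)"
proof -
  have "inj_on (\<lambda>j. (src j, tgt j)) (set (kernel_edges (set ks)))"
    using edge_inj by (auto simp: inj_on_def kernel_edges_def)
  moreover have "(\<lambda>j. (src j, tgt j)) ` set (kernel_edges (set ks)) \<subseteq> set ks \<times> set ks"
    by (auto simp: kernel_edges_def)
  ultimately have "card (set (kernel_edges (set ks))) \<le> card (set ks \<times> set ks)"
    by (intro card_inj_on_le) auto
  moreover have "card (set (kernel_edges (set ks))) = length (kernel_edges (set ks))"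
    by (rule distinct_card) (simp add: kernel_edges_def)
  ultimately show ?thesis by (simp add: card_cartesian_product)
qed

text \<open>An edge is sent injectively to the pair of a cover endpoint and the other endpoint. This
  bound turns the loops over the edges into \<open>O(\<tau> n)\<close> steps.\<close>

lemma edges_le:
  assumes "vertex_cover {..<n} E C"
  shows "m \<le> card C * n"
proof -
  have fin: "finite C" using assms finite_subset[of C "{..<n}"] by (auto simp: vertex_cover_def)
  define f where "f j = (if src j \<in> C then (src j, tgt j) else (tgt j, src j))" for j
  have "inj_on f {..<m}"
  proof (rule inj_onI)
    fix i j assume ij: "i \<in> {..<m}" "j \<in> {..<m}" "f i = f j"
    then have "{src i, tgt i} = {src j, tgt j}"
      by (auto simp: f_def split: if_splits)
    then show "i = j" using edge_inj ij by blast
  qed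
  moreover have "f ` {..<m} \<subseteq> C \<times> {..<n}"
  proof
    fix x assume "x \<in> f ` {..<m}"
    then obtain j where j: "j < m" "x = f j" by auto
    have "{src j, tgt j} \<inter> C \<noteq> {}"
      using assms edge_in[OF j(1)] by (auto simp: vertex_cover_def)
    then show "x \<in> C \<times> {..<n}" using j edge_lt(1,2)[OF j(1)] by (auto simp: f_def)
  qed
  ultimately have "card {..<m} \<le> card (C \<times> {..<n})"
    using fin by (intro card_inj_on_le) auto
  then show ?thesis by (simp add: card_cartesian_product)
qed

end

section \<open>Exhaustive search on the kernel\<close>

definition digit_step :: com where
  "digit_step = Assign 14 (Const 0);;
     While (Neg (Less (Var 15) (Var 6)))
       (Assign 15 (Sub (Var 15) (Var 6));; Assign 14 (Add (Var 14) (Const 1)));;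
     Write 12 (Var 13) (Var 15);; Assign 15 (Var 14)"

definition decode_prog :: com where
  "decode_prog = Assign 15 (Var 12);; For 13 8 digit_step"

text \<open>Division with remainder by repeated subtraction; \<open>I r\<close> has \<open>r\<close>
  subtractions outstanding. Bounding their number by \<open>x\<close> itself is enough, since in the
  search \<open>x\<close> is below the number of codes.\<close>

lemma runs_digit_step:
  assumes B: "fst s 6 = B" "0 < B" and x: "fst s 15 = x"
  shows "runs digit_step s (20 * (x + 1))
    (\<lambda>s'. snd s' 12 = (snd s 12)(fst s 13 := x mod B) \<and> fst s' 15 = x div B)"
proof -
  let ?g = "Neg (Less (Var 15) (Var 6))"
  let ?b = "Assign 15 (Sub (Var 15) (Var 6));; Assign 14 (Add (Var 14) (Const 1))"
  define I where "I r s' \<longleftrightarrow> r \<le> x div B \<and> fst s' 15 = x mod B + r * B \<and> fst s' 14 = x div B - r \<and>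
    fst s' 6 = B \<and> fst s' 13 = fst s 13 \<and> snd s' = snd s" for r and s' :: state
  have "runs (While ?g ?b) (set_reg 14 0 s) ((x div B) * (8 + 1 + bcost ?g) + 1 + bcost ?g) (I 0)"
  proof (rule runs_While)
    show "I (x div B) (set_reg 14 0 s)"
      using B x by (simp add: I_def)
    show "beval ?g s' \<and> runs ?b s' 8 (I r)" if "I (Suc r) s'" for r s'
      using that by (auto simp: I_def intro!: runs_straight)
    show "\<not> beval ?g s'" if "I 0 s'" for s'
      using that B by (simp add: I_def)
  qed
  then have loop: "runs (While ?g ?b) (set_reg 14 0 s) (13 * x + 5) (I 0)"
  proof (rule runs_mono)
    have "x div B * 13 \<le> x * 13" by (intro mult_le_mono1 div_le_dividend)
    then show "x div B * (8 + 1 + bcost ?g) + 1 + bcost ?g \<le> 13 * x + 5" by simp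
  qed
  have "runs (While ?g ?b;; Write 12 (Var 13) (Var 15);; Assign 15 (Var 14)) (set_reg 14 0 s)
    (13 * x + 5 + 5) (\<lambda>s'. snd s' 12 = (snd s 12)(fst s 13 := x mod B) \<and> fst s' 15 = x div B)"
    by (rule runs_Seq[OF runs_mono[OF loop order_refl] order_refl])
      (rule runs_straight, auto simp: I_def)
  then have "runs (Assign 14 (Const 0)) s 2 (\<lambda>s1. runs
    (While ?g ?b;; Write 12 (Var 13) (Var 15);; Assign 15 (Var 14)) s1 (13 * x + 5 + 5)
    (\<lambda>s'. snd s' 12 = (snd s 12)(fst s 13 := x mod B) \<and> fst s' 15 = x div B))"
    by (intro runs_Assign) auto
  then show ?thesis
    unfolding digit_step_def by (rule runs_Seq) simp
qed

lemma runs_decode: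
  assumes s: "fst s 6 = B" "fst s 8 = L" "fst s 12 = t" and B: "0 < L \<Longrightarrow> 0 < B"
  shows "runs decode_prog s (30 * ((L + 1) * (t + 1))) (\<lambda>s'. \<forall>i<L. snd s' 12 i = t div B ^ i mod B)"
proof -
  have "runs (For 13 8 digit_step) (set_reg 15 t s) ((L + 1) * (20 * (t + 1) + 8))
    (\<lambda>s'. \<forall>i<L. snd s' 12 i = t div B ^ i mod B)"
  proof (rule runs_For[where b = L and T = "20 * (t + 1)" and
      I = "\<lambda>i s'. fst s' 15 = t div B ^ i \<and> (\<forall>j<i. snd s' 12 j = t div B ^ j mod B)"])
    fix i s' assume i: "i < L" "fst s' 13 = i" and u: "unchanged (For 13 8 digit_step) (set_reg 15 t s) s'"
      and I: "fst s' 15 = t div B ^ i \<and> (\<forall>j<i. snd s' 12 j = t div B ^ j mod B)"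
    have "fst s' 6 = B" using u s by (auto simp: unchanged_def digit_step_def)
    then have "runs digit_step s' (20 * (t div B ^ i + 1)) (\<lambda>s''.
      snd s'' 12 = (snd s' 12)(fst s' 13 := t div B ^ i mod B) \<and> fst s'' 15 = t div B ^ i div B)"
      using I i B by (intro runs_digit_step) auto
    then show "runs digit_step s' (20 * (t + 1)) (\<lambda>s''. fst (set_reg 13 (Suc i) s'') 15 = t div B ^ Suc i \<and>
      (\<forall>j<Suc i. snd (set_reg 13 (Suc i) s'') 12 j = t div B ^ j mod B))"
    proof (rule runs_mono)
      show "20 * (t div B ^ i + 1) \<le> 20 * (t + 1)" by simp
    qed (use I i in \<open>auto simp: less_Suc_eq div_mult2_eq[symmetric] mult.commute\<close>)
  qed (use s in \<open>auto simp: digit_step_def\<close>)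
  then show ?thesis
    unfolding decode_prog_def
    by (intro runs_Seq[where ?T1.0 = 2 and ?T2.0 = "(L + 1) * (20 * (t + 1) + 8)"] runs_Assign)
      (use s in \<open>auto simp: algebra_simps\<close>)
qed

text \<open>Decoding reaches every digit sequence, which makes the search exhaustive. The lowest
  digit is split off, and the shifted sequence is coded by induction.\<close>

lemma digits_exist:
  assumes "\<And>i. i < L \<Longrightarrow> d i < (B :: nat)"
  shows "\<exists>t<B ^ L. \<forall>i<L. t div B ^ i mod B = d i"
  using assms
proof (induction L arbitrary: d)
  case (Suc L)
  obtain t where t: "t < B ^ L" "\<And>i. i < L \<Longrightarrow> t div B ^ i mod B = d (Suc i)"
    using Suc.IH[of "\<lambda>i. d (Suc i)"] Suc.prems by auto
  have d0: "d 0 < B" using Suc.prems by simp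
  let ?t = "d 0 + B * t"
  have "?t < B * Suc t" using d0 by simp
  also have "\<dots> \<le> B ^ Suc L" using t(1) by (simp del: mult_Suc_right)
  finally have "?t < B ^ Suc L" .
  moreover have "?t div B ^ i mod B = d i" if "i < Suc L" for i
  proof (cases i)
    case (Suc j)
    have "?t div B ^ i = ?t div B div B ^ j" by (simp add: Suc div_mult2_eq)
    also have "?t div B = t" using d0 by simp
    finally show ?thesis using t(2)[of j] that Suc by simp
  qed (use d0 in simp)
  ultimately show ?case by blast
qed simp

text \<open>Rule for the checking loops: an iteration either leaves the flag in register 11 alone or
  clears it, so the flag survives exactly if all iterations pass.\<close>

lemma runs_For_flag:
  assumes s: "fst s y = b" and nin: "x \<notin> regs P" "y \<notin> regs P" "x \<noteq> y" "x \<noteq> 11"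
    and step: "\<And>i s'. i < b \<Longrightarrow> fst s' x = i \<Longrightarrow> unchanged (For x y P) s s' \<Longrightarrow>
      runs P s' T (\<lambda>s''. fst s'' 11 = (if R i then fst s' 11 else 0))"
    and T: "(b + 1) * (T + 8) \<le> T'"
  shows "runs (For x y P) s T' (\<lambda>s'. fst s' 11 = (if \<forall>i<b. R i then fst s 11 else 0))"
proof (rule runs_For[where b = b and T = T and
    I = "\<lambda>i s'. fst s' 11 = (if \<forall>j<i. R j then fst s 11 else 0)"])
  fix i s' assume i: "i < b" "fst s' x = i" and u: "unchanged (For x y P) s s'"
    and I: "fst s' 11 = (if \<forall>j<i. R j then fst s 11 else 0)"
  show "runs P s' T (\<lambda>s''. fst (set_reg x (Suc i) s'') 11 = (if \<forall>j<Suc i. R j then fst s 11 else 0))"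
    by (rule runs_mono[OF step[OF i u]]) (use I nin in \<open>auto simp: less_Suc_eq\<close>)
qed (use s nin T in auto)

text \<open>Chain of lookups: number of the kernel edge, edge of the input, its endpoint in array
  \<open>a\<close>, the kernel index of that endpoint, its digit.\<close>

definition position_exp :: "nat \<Rightarrow> nat \<Rightarrow> exp" where
  "position_exp a x = Read 12 (Read 9 (Read a (Read 11 (Var x))))"

text \<open>The edge with ends at \<open>p\<close>, \<open>q\<close> crosses the edge at
  \<open>r\<close>, \<open>t\<close> and starts first; the four cases are the orientations of the
  two edges. Crossings in which \<open>r\<close>, \<open>t\<close> starts first are found when the
  two edges change roles.\<close>

definition interlaced :: "nat \<Rightarrow> nat \<Rightarrow> nat \<Rightarrow> nat \<Rightarrow> bool" where
  "interlaced p q r t \<longleftrightarrow> p < r \<and> r < q \<and> q < t \<or> p < t \<and> t < q \<and> q < r \<or>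
     q < r \<and> r < p \<and> p < t \<or> q < t \<and> t < p \<and> p < r"

definition increasing_bexp :: "exp \<Rightarrow> exp \<Rightarrow> exp \<Rightarrow> exp \<Rightarrow> bexp" where
  "increasing_bexp p r q t = Conj (Less p r) (Conj (Less r q) (Less q t))"

definition interlaced_bexp :: "exp \<Rightarrow> exp \<Rightarrow> exp \<Rightarrow> exp \<Rightarrow> bexp" where
  "interlaced_bexp p q r t = Neg (Conj (Neg (increasing_bexp p r q t))
     (Conj (Neg (increasing_bexp p t q r)) (Conj (Neg (increasing_bexp q r p t))
       (Neg (increasing_bexp q t p r)))))"

lemma beval_interlaced [simp]:
  "beval (interlaced_bexp p q r t) s \<longleftrightarrow> interlaced (eval p s) (eval q s) (eval r s) (eval t s)"
  by (auto simp: interlaced_bexp_def interlaced_def increasing_bexp_def)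

definition distinct_step :: com where
  "distinct_step = Cond (Equal (Read 12 (Var 13)) (Read 12 (Var 14))) (Assign 11 (Const 0)) Skip"

definition page_step :: com where
  "page_step = Cond (Less (Read 12 (Add (Var 6) (Var 13))) (Var 1)) Skip (Assign 11 (Const 0))"

definition crossing_step :: com where
  "crossing_step =
     Cond (Conj (Equal (Read 12 (Add (Var 6) (Var 13))) (Read 12 (Add (Var 6) (Var 14))))
        (interlaced_bexp (position_exp 0 13) (position_exp 1 13) (position_exp 0 14) (position_exp 1 14)))
       (Assign 11 (Const 0)) Skip"

definition check_prog :: com where
  "check_prog = Assign 11 (Const 1);; For 13 6 (For 14 13 distinct_step);; For 13 7 page_step;;
     For 13 7 (For 14 7 crossing_step)"

text \<open>Once a code has passed, register 10 switches decoding off, so that array 12 still holds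
  this code when the loop ends.\<close>

definition search_step :: com where
  "search_step = Cond (Equal (Var 10) (Const 0)) (decode_prog;; check_prog;; Assign 10 (Var 11)) Skip"

context graph_input
begin

text \<open>
  A code is a sequence of digits: the positions of the kernel vertices followed by the pages
  of the kernel edges.
\<close>

definition valid_code :: "nat \<Rightarrow> nat list \<Rightarrow> (nat \<Rightarrow> nat) \<Rightarrow> (nat \<Rightarrow> nat) \<Rightarrow> bool" where
  "valid_code k ks idx d \<longleftrightarrow>
     (let js = kernel_edges (set ks); N = length ks; M = length js; pos = (\<lambda>v. d (idx v)) in
      (\<forall>i<N. \<forall>j<i. d i \<noteq> d j) \<and> (\<forall>e<M. d (N + e) < k) \<and>
      (\<forall>e<M. \<forall>f<M. d (N + e) = d (N + f) \<longrightarrow>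
         \<not> interlaced (pos (src (js ! e))) (pos (tgt (js ! e))) (pos (src (js ! f))) (pos (tgt (js ! f)))))"

lemma kernel_edges_nth:
  assumes "e < length (kernel_edges K)"
  shows "kernel_edges K ! e < m" "src (kernel_edges K ! e) \<in> K" "tgt (kernel_edges K ! e) \<in> K"
  using nth_mem[OF assms] by (auto simp: kernel_edges_def)

lemma runs_check:
  assumes g: "graph_state s" and s: "fst s 6 = length ks" "fst s 1 = k"
    and ke: "kernel_edge_state (set ks) s"
  shows "runs check_prog s (600 * (length ks + length (kernel_edges (set ks)) + 1) ^ 2)
    (\<lambda>s'. fst s' 11 = (if valid_code k ks (snd s 9) (snd s 12) then 1 else 0))"
proof -
  let ?js = "kernel_edges (set ks)" and ?N = "length ks"
  let ?M = "length ?js" and ?d = "snd s 12"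
  let ?pos = "\<lambda>v. ?d (snd s 9 v)"
  let ?R1 = "\<forall>i<?N. \<forall>j<i. ?d i \<noteq> ?d j" and ?R2 = "\<forall>e<?M. ?d (?N + e) < k"
  let ?R3 = "\<forall>e<?M. \<forall>f<?M. \<not> (?d (?N + e) = ?d (?N + f) \<and>
     interlaced (?pos (src (?js ! e))) (?pos (tgt (?js ! e))) (?pos (src (?js ! f))) (?pos (tgt (?js ! f))))"
  define same where "same s' \<longleftrightarrow> snd s' = snd s \<and> fst s' 6 = ?N \<and> fst s' 7 = ?M \<and> fst s' 1 = k" for s' :: state
  have M: "fst s 7 = ?M" using ke by (simp add: kernel_edge_state_def)
  have same0: "same s" using s M by (simp add: same_def)
  have same: "same s''" if "same s'" "unchanged P s' s''" "regs P \<inter> {1, 6, 7} = {}" "arrs P = {}" for P s' s''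
    using that by (auto simp: same_def unchanged_def fun_eq_iff)
  have arr: "arrs (For 13 6 (For 14 13 distinct_step)) = {}" "arrs (For 13 7 page_step) = {}"
    "arrs (For 13 7 (For 14 7 crossing_step)) = {}" "arrs (For 14 13 distinct_step) = {}"
    "arrs (For 14 7 crossing_step) = {}"
    by (auto simp: distinct_step_def page_step_def crossing_step_def)
  have reg: "regs (For 13 6 (For 14 13 distinct_step)) \<inter> {1, 6, 7} = {}"
    "regs (For 13 7 page_step) \<inter> {1, 6, 7} = {}"
    "regs (For 13 7 (For 14 7 crossing_step)) \<inter> {1, 6, 7} = {}"
    "regs (For 14 13 distinct_step) \<inter> {1, 6, 7} = {}" "regs (For 14 7 crossing_step) \<inter> {1, 6, 7} = {}"
    by (auto simp: distinct_step_def page_step_def crossing_step_def)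
  have P1: "runs (For 13 6 (For 14 13 distinct_step)) s1 ((?N + 1) * ((?N + 1) * 26 + 8))
      (\<lambda>s'. fst s' 11 = (if ?R1 then fst s1 11 else 0))" if s1: "same s1" for s1
  proof (rule runs_For_flag[where b = ?N and T = "(?N + 1) * 26"])
    fix i s2 assume i: "i < ?N" "fst s2 13 = i" and u: "unchanged (For 13 6 (For 14 13 distinct_step)) s1 s2"
    note s2 = same[OF s1 u reg(1) arr(1)]
    show "runs (For 14 13 distinct_step) s2 ((?N + 1) * 26)
      (\<lambda>s''. fst s'' 11 = (if \<forall>j<i. ?d i \<noteq> ?d j then fst s2 11 else 0))"
    proof (rule runs_For_flag[where b = i and T = 18])
      fix j s3 assume j: "fst s3 14 = j" and u: "unchanged (For 14 13 distinct_step) s2 s3"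
      have "fst s3 13 = i" using u i by (auto simp: unchanged_def distinct_step_def)
      with same[OF s2 u reg(4) arr(4)] j
      show "runs distinct_step s3 18 (\<lambda>s''. fst s'' 11 = (if ?d i \<noteq> ?d j then fst s3 11 else 0))"
        by (intro runs_straight) (auto simp: distinct_step_def same_def)
    next
      show "(i + 1) * (18 + 8) \<le> (?N + 1) * 26" using i by simp
    qed (use i in \<open>auto simp: distinct_step_def\<close>)
  qed (use s1 in \<open>auto simp: distinct_step_def same_def\<close>)
  have P2: "runs (For 13 7 page_step) s1 ((?M + 1) * 26)
      (\<lambda>s'. fst s' 11 = (if ?R2 then fst s1 11 else 0))" if s1: "same s1" for s1
  proof (rule runs_For_flag[where b = ?M and T = 18])
    fix i s2 assume i: "fst s2 13 = i" and u: "unchanged (For 13 7 page_step) s1 s2"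
    show "runs page_step s2 18 (\<lambda>s''. fst s'' 11 = (if ?d (?N + i) < k then fst s2 11 else 0))"
      using same[OF s1 u reg(2) arr(2)] i
      by (intro runs_straight) (auto simp: page_step_def same_def)
  qed (use s1 in \<open>auto simp: page_step_def same_def\<close>)
  have P3: "runs (For 13 7 (For 14 7 crossing_step)) s1 ((?M + 1) * ((?M + 1) * 300 + 8))
      (\<lambda>s'. fst s' 11 = (if ?R3 then fst s1 11 else 0))" if s1: "same s1" for s1
  proof (rule runs_For_flag[where b = ?M and T = "(?M + 1) * 300"])
    fix e s2 assume e: "e < ?M" "fst s2 13 = e"
      and u: "unchanged (For 13 7 (For 14 7 crossing_step)) s1 s2"
    note s2 = same[OF s1 u reg(3) arr(3)]
    let ?Q = "\<lambda>f. \<not> (?d (?N + e) = ?d (?N + f) \<and>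
      interlaced (?pos (src (?js ! e))) (?pos (tgt (?js ! e))) (?pos (src (?js ! f))) (?pos (tgt (?js ! f))))"
    show "runs (For 14 7 crossing_step) s2 ((?M + 1) * 300)
      (\<lambda>s''. fst s'' 11 = (if \<forall>f<?M. ?Q f then fst s2 11 else 0))"
    proof (rule runs_For_flag[where b = ?M and T = 292])
      fix f s3 assume f: "f < ?M" "fst s3 14 = f" and u: "unchanged (For 14 7 crossing_step) s2 s3"
      have e3: "fst s3 13 = e" using u e by (auto simp: unchanged_def crossing_step_def)
      have s3: "snd s3 = snd s" "fst s3 6 = ?N" using same[OF s2 u reg(5) arr(5)] by (auto simp: same_def)
      have js: "snd s 11 i = ?js ! i" "snd s 0 (?js ! i) = src (?js ! i)" "snd s 1 (?js ! i) = tgt (?js ! i)"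
        if "i < ?M" for i
        using that ke g kernel_edges_nth(1)[OF that] by (auto simp: kernel_edge_state_def graph_state_def)
      have "fst (den crossing_step s3) 11 = (if ?Q f then fst s3 11 else 0)"
        using e3 f(2) s3 js[OF e(1)] js[OF f(1)]
        by (simp add: crossing_step_def position_exp_def)
      then show "runs crossing_step s3 292 (\<lambda>s''. fst s'' 11 = (if ?Q f then fst s3 11 else 0))"
        by (intro runs_straight)
          (auto simp: crossing_step_def position_exp_def interlaced_bexp_def increasing_bexp_def)
    qed (use s2 in \<open>auto simp: crossing_step_def same_def\<close>)
  qed (use s1 in \<open>auto simp: crossing_step_def same_def\<close>)
  let ?T1 = "(?N + 1) * ((?N + 1) * 26 + 8)" and ?T2 = "(?M + 1) * 26"
  let ?T3 = "(?M + 1) * ((?M + 1) * 300 + 8)"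
  have valid: "valid_code k ks (snd s 9) (snd s 12) \<longleftrightarrow> ?R1 \<and> ?R2 \<and> ?R3"
    unfolding valid_code_def Let_def by blast
  have s1: "same (set_reg 11 1 s)" using same0 by (simp add: same_def)
  have "runs check_prog s (2 + (?T1 + (?T2 + ?T3)))
    (\<lambda>s'. fst s' 11 = (if valid_code k ks (snd s 9) (snd s 12) then 1 else 0))"
    unfolding check_prog_def
  proof (rule runs_Seq_frame)
    show "runs (Assign 11 (Const 1)) s 2 (\<lambda>s'. s' = set_reg 11 1 s)"
      by (rule runs_Assign) auto
  next
    fix s1 assume s1': "s1 = set_reg 11 1 s"
    show "runs (For 13 6 (For 14 13 distinct_step);; For 13 7 page_step;; For 13 7 (For 14 7 crossing_step))
      s1 (?T1 + (?T2 + ?T3)) (\<lambda>s'. fst s' 11 = (if valid_code k ks (snd s 9) (snd s 12) then 1 else 0))"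
    proof (rule runs_Seq_frame[OF P1])
      show "same s1" using s1 s1' by simp
    next
      fix s2 assume f2: "fst s2 11 = (if ?R1 then fst s1 11 else 0)"
        and u2: "unchanged (For 13 6 (For 14 13 distinct_step)) s1 s2"
      have s2: "same s2" using same[OF s1 _ reg(1) arr(1)] u2 s1' by simp
      show "runs (For 13 7 page_step;; For 13 7 (For 14 7 crossing_step)) s2 (?T2 + ?T3)
        (\<lambda>s'. fst s' 11 = (if valid_code k ks (snd s 9) (snd s 12) then 1 else 0))"
      proof (rule runs_Seq_frame[OF P2[OF s2]])
        fix s3 assume f3: "fst s3 11 = (if ?R2 then fst s2 11 else 0)"
          and u3: "unchanged (For 13 7 page_step) s2 s3"
        have s3: "same s3" using same[OF s2 u3 reg(2) arr(2)] .
        show "runs (For 13 7 (For 14 7 crossing_step)) s3 ?T3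
          (\<lambda>s'. fst s' 11 = (if valid_code k ks (snd s 9) (snd s 12) then 1 else 0))"
        proof (rule runs_mono[OF P3[OF s3] order_refl])
          fix s4 assume "fst s4 11 = (if ?R3 then fst s3 11 else 0)"
          then show "fst s4 11 = (if valid_code k ks (snd s 9) (snd s 12) then 1 else 0)"
            unfolding valid f3 f2 s1' by simp
        qed
      qed
    qed
  qed
  then show ?thesis
  proof (rule runs_mono)
    show "2 + (?T1 + (?T2 + ?T3)) \<le> 600 * (?N + ?M + 1) ^ 2"
      by (simp add: power2_eq_square algebra_simps)
  qed
qed

text \<open>Only the first \<open>L\<close> cells of a code are ever read. The contents of array 12
  are known only there, whereas the digits \<open>t div B ^ i mod B\<close> are defined for all
  \<open>i\<close>; this lemma lets the two be compared.\<close>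

lemma valid_code_cong:
  assumes k: "kernel_state ks s" and d: "\<And>i. i < length ks + length (kernel_edges (set ks)) \<Longrightarrow> d i = d' i"
  shows "valid_code k ks (snd s 9) d = valid_code k ks (snd s 9) d'"
proof -
  have "snd s 9 v < length ks" if "v \<in> set ks" for v
    using that k by (auto simp: in_set_conv_nth kernel_state_def)
  then have pos: "d (snd s 9 v) = d' (snd s 9 v)" if "v \<in> set ks" for v
    using that d[of "snd s 9 v"] by (simp add: trans_less_add1)
  show ?thesis
    unfolding valid_code_def Let_def using d pos kernel_edges_nth(2,3)[of _ "set ks"] by auto
qed

text \<open>Before round \<open>t\<close>, either a valid code is stored or no smaller code is
  valid. With \<open>S = Z + L + 1\<close>, decoding takes about \<open>L * t\<close> steps and
  checking about \<open>L^2\<close>, so each of the \<open>Z\<close> rounds costs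
  \<open>O(S^2)\<close>.\<close>

lemma runs_search:
  assumes g: "graph_state s" and k: "kernel_state ks s" and ke: "kernel_edge_state (set ks) s"
    and s: "fst s 8 = L" "fst s 9 = Z" "fst s 10 = 0" "fst s 1 = k"
    and L: "L = length ks + length (kernel_edges (set ks))" and Z: "Z = length ks ^ L"
  shows "runs (For 12 9 search_step) s (1000 * (Z + L + 1) ^ 3) (\<lambda>s'.
    fst s' 10 = 1 \<and> (\<forall>i<L. snd s' 12 i < length ks) \<and> valid_code k ks (snd s 9) (snd s' 12) \<or>
    fst s' 10 = 0 \<and> (\<forall>d. (\<forall>i<L. d i < length ks) \<longrightarrow> \<not> valid_code k ks (snd s 9) d))"
proof -
  let ?N = "length ks"
  let ?v = "valid_code k ks (snd s 9)"
  define S where "S = Z + L + 1"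
  \<comment> \<open>Base 0 is possible only for the empty kernel, which has no edges, and then there
    are no digits to extract.\<close>
  have pos: "0 < ?N" if "0 < L"
  proof (rule ccontr)
    assume "\<not> 0 < ?N"
    then have "kernel_edges (set ks) = []" by (simp add: kernel_edges_def)
    with L \<open>\<not> 0 < ?N\<close> that show False by simp
  qed
  define D where "D t i = t div ?N ^ i mod ?N" for t i
  define I where "I t s' \<longleftrightarrow>
    fst s' 10 = 1 \<and> (\<forall>i<L. snd s' 12 i < ?N) \<and> ?v (snd s' 12) \<or>
    fst s' 10 = 0 \<and> (\<forall>t'<t. \<not> ?v (D t'))" for t and s' :: state
  show ?thesis
  proof (rule runs_For[where b = Z and T = "30 * S ^ 2 + 600 * S ^ 2 + 2 + 6" and I = I])
    fix t s' assume t: "t < Z" "fst s' 12 = t" and u: "unchanged (For 12 9 search_step) s s'" and I: "I t s'"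
    have s': "graph_state s'" "kernel_edge_state (set ks) s'" "fst s' 6 = ?N" "fst s' 8 = L" "fst s' 1 = k"
      "snd s' 9 = snd s 9"
      using u g ke k s
      by (auto simp: unchanged_def search_step_def decode_prog_def digit_step_def check_prog_def
          distinct_step_def page_step_def crossing_step_def graph_state_def kernel_edge_state_def
          kernel_state_def)
    show "runs search_step s' (30 * S ^ 2 + 600 * S ^ 2 + 2 + 6) (\<lambda>s''. I (Suc t) (set_reg 12 (Suc t) s''))"
      unfolding search_step_def
    proof (rule runs_Cond[where ?T0.0 = "30 * S ^ 2 + (600 * S ^ 2 + 2)"])
      assume "\<not> beval (Equal (Var 10) (Const 0)) s'"
      with I show "runs Skip s' (30 * S ^ 2 + (600 * S ^ 2 + 2)) (\<lambda>s''. I (Suc t) (set_reg 12 (Suc t) s''))"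
        by (intro runs_Skip) (auto simp: I_def)
    next
      assume "beval (Equal (Var 10) (Const 0)) s'"
      with I have no: "\<forall>t'<t. \<not> ?v (D t')" by (simp add: I_def)
      have "runs decode_prog s' (30 * ((L + 1) * (t + 1))) (\<lambda>s''. \<forall>i<L. snd s'' 12 i = D t i)"
        unfolding D_def using s' t pos by (intro runs_decode) auto
      then have "runs decode_prog s' (30 * S ^ 2) (\<lambda>s''. runs (check_prog;; Assign 10 (Var 11)) s''
        (600 * S ^ 2 + 2) (\<lambda>s''. I (Suc t) (set_reg 12 (Suc t) s'')))"
      proof (rule runs_mono_frame)
        have "(L + 1) * (t + 1) \<le> S * S" unfolding S_def using t by (intro mult_le_mono) auto
        then show "30 * ((L + 1) * (t + 1)) \<le> 30 * S ^ 2" by (simp add: power2_eq_square)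
      next
        fix s1 assume d: "\<forall>i<L. snd s1 12 i = D t i" and u1: "unchanged decode_prog s' s1"
        have s1: "graph_state s1" "kernel_edge_state (set ks) s1" "fst s1 6 = ?N" "fst s1 1 = k"
          "snd s1 9 = snd s 9"
          using u1 s' by (auto simp: unchanged_def decode_prog_def digit_step_def graph_state_def
            kernel_edge_state_def)
        have eq: "?v (snd s1 12) = ?v (D t)"
          using valid_code_cong[OF k, of "snd s1 12" "D t"] d L by simp
        have "runs check_prog s1 (600 * (?N + length (kernel_edges (set ks)) + 1) ^ 2)
          (\<lambda>s'. fst s' 11 = (if ?v (snd s1 12) then 1 else 0))"
          using runs_check[OF s1(1,3,4,2)] s1(5) by simp
        then have "runs check_prog s1 (600 * S ^ 2) (\<lambda>s''. runs (Assign 10 (Var 11)) s'' 2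
          (\<lambda>s''. I (Suc t) (set_reg 12 (Suc t) s'')))"
        proof (rule runs_mono_frame)
          show "600 * (?N + length (kernel_edges (set ks)) + 1) ^ 2 \<le> 600 * S ^ 2"
            unfolding S_def L[symmetric] by (simp add: power_mono)
        next
          fix s2 assume f: "fst s2 11 = (if ?v (snd s1 12) then 1 else 0)" and u2: "unchanged check_prog s1 s2"
          have d2: "snd s2 12 = snd s1 12"
            using u2 by (simp add: unchanged_def check_prog_def distinct_step_def page_step_def crossing_step_def)
          have lt: "D t i < ?N" if "i < L" for i
            unfolding D_def using pos that by simp
          show "runs (Assign 10 (Var 11)) s2 2 (\<lambda>s''. I (Suc t) (set_reg 12 (Suc t) s''))"
            by (rule runs_Assign) (use f eq d d2 lt no in \<open>auto simp: I_def less_Suc_eq\<close>)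
        qed
        then show "runs (check_prog;; Assign 10 (Var 11)) s1 (600 * S ^ 2 + 2)
          (\<lambda>s''. I (Suc t) (set_reg 12 (Suc t) s''))"
          by (rule runs_Seq) simp
      qed
      then show "runs (decode_prog;; check_prog;; Assign 10 (Var 11)) s' (30 * S ^ 2 + (600 * S ^ 2 + 2))
        (\<lambda>s''. I (Suc t) (set_reg 12 (Suc t) s''))"
        by (rule runs_Seq) simp
    qed simp
  next
    fix s' assume "I Z s'"
    moreover have "\<not> ?v d" if no: "\<forall>t<Z. \<not> ?v (D t)" and lt: "\<forall>i<L. d i < ?N" for d
    proof -
      obtain t where t: "t < Z" "\<forall>i<L. D t i = d i"
        using digits_exist[of L d ?N] lt unfolding D_def Z by auto
      then show ?thesis
        using no valid_code_cong[OF k, of d "D t"] L by auto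
    qed
    ultimately show "fst s' 10 = 1 \<and> (\<forall>i<L. snd s' 12 i < length ks) \<and> ?v (snd s' 12) \<or>
      fst s' 10 = 0 \<and> (\<forall>d. (\<forall>i<L. d i < length ks) \<longrightarrow> \<not> ?v d)"
      unfolding I_def by blast
  next
    have "1 \<le> S ^ 2" by (simp add: S_def)
    then have "30 * S ^ 2 + 600 * S ^ 2 + 2 + 6 + 8 \<le> 1000 * S ^ 2" by linarith
    moreover have "Z + 1 \<le> S" by (simp add: S_def)
    ultimately have "(Z + 1) * (30 * S ^ 2 + 600 * S ^ 2 + 2 + 6 + 8) \<le> S * (1000 * S ^ 2)"
      by (intro mult_le_mono)
    also have "S * (1000 * S ^ 2) = 1000 * S ^ 3"
      by (simp add: power2_eq_square power3_eq_cube)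
    finally show "(Z + 1) * (30 * S ^ 2 + 600 * S ^ 2 + 2 + 6 + 8) \<le> 1000 * (Z + L + 1) ^ 3"
      unfolding S_def .
  qed (use s in \<open>auto simp: I_def search_step_def decode_prog_def digit_step_def check_prog_def
      distinct_step_def page_step_def crossing_step_def\<close>)
qed


section \<open>Codes versus book embeddings of the kernel\<close>

definition page :: "nat list \<Rightarrow> (nat \<Rightarrow> nat) \<Rightarrow> nat set \<Rightarrow> nat" where
  "page ks d S = d (length ks + (THE e. e < length (kernel_edges (set ks)) \<and>
     S = {src (kernel_edges (set ks) ! e), tgt (kernel_edges (set ks) ! e)}))"

lemma kernel_edges_inj:
  assumes "e < length (kernel_edges K)" "f < length (kernel_edges K)"
    "{src (kernel_edges K ! e), tgt (kernel_edges K ! e)} = {src (kernel_edges K ! f), tgt (kernel_edges K ! f)}"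
  shows "e = f"
proof -
  have "kernel_edges K ! e = kernel_edges K ! f"
    using edge_inj kernel_edges_nth(1) assms by blast
  moreover have "distinct (kernel_edges K)" by (simp add: kernel_edges_def)
  ultimately show ?thesis using assms nth_eq_iff_index_eq by blast
qed

lemma kernel_edges_ex:
  assumes "S \<in> E" "S \<subseteq> K"
  shows "\<exists>e<length (kernel_edges K). S = {src (kernel_edges K ! e), tgt (kernel_edges K ! e)}"
proof -
  obtain j where j: "j < m" "S = {src j, tgt j}" using edge_ex[OF assms(1)] by blast
  then have "j \<in> set (kernel_edges K)" using assms(2) by (auto simp: kernel_edges_def)
  then obtain e where "e < length (kernel_edges K)" "kernel_edges K ! e = j"
    by (auto simp: in_set_conv_nth)
  then show ?thesis using j by blast
qed

lemma kernel_edges_in: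
  assumes "e < length (kernel_edges K)"
  shows "{src (kernel_edges K ! e), tgt (kernel_edges K ! e)} \<in> {S \<in> E. S \<subseteq> K}"
  using kernel_edges_nth[OF assms] edge_in by simp

lemma page_nth:
  assumes e: "e < length (kernel_edges (set ks))"
  shows "page ks d {src (kernel_edges (set ks) ! e), tgt (kernel_edges (set ks) ! e)} = d (length ks + e)"
proof -
  let ?js = "kernel_edges (set ks)"
  have "(THE f. f < length ?js \<and> {src (?js ! e), tgt (?js ! e)} = {src (?js ! f), tgt (?js ! f)}) = e"
    by (rule the_equality) (use e kernel_edges_inj in blast)+
  then show ?thesis unfolding page_def by simp
qed

lemma kernel_index_less:
  assumes "kernel_state ks s" "v \<in> set ks"
  shows "snd s 9 v < length ks" "ks ! snd s 9 v = v"
  using assms by (auto simp: in_set_conv_nth kernel_state_def)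

text \<open>\<open>page\<close> reads the digits after the first \<open>length ks\<close> as a
  function of the edges, well defined because no edge is listed twice. For a crossing
  \<open>u\<close>, \<open>w\<close>, \<open>v\<close>, \<open>x\<close> the edge
  \<open>{u, v}\<close> starts first, so however the endpoints are listed, one of the four cases of
  \<open>interlaced\<close> applies.\<close>

lemma valid_code_sound:
  assumes k: "kernel_state ks s" and v: "valid_code k ks (snd s 9) d"
  shows "inj_on (\<lambda>v. d (snd s 9 v)) (set ks)"
    and "noncrossing {S \<in> E. S \<subseteq> set ks} (\<lambda>v. d (snd s 9 v)) (page ks d)"
    and "\<And>S. S \<in> E \<Longrightarrow> S \<subseteq> set ks \<Longrightarrow> page ks d S < k"
proof -
  let ?js = "kernel_edges (set ks)" and ?N = "length ks"
  let ?pos = "\<lambda>v. d (snd s 9 v)"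
  note v' = v[unfolded valid_code_def Let_def]
  have v1: "d i \<noteq> d j" if "i < ?N" "j < i" for i j
    using conjunct1[OF v'] that by simp
  have v2: "d (?N + e) < k" if "e < length ?js" for e
    using conjunct1[OF conjunct2[OF v']] that by simp
  have v3: "\<not> interlaced (?pos (src (?js ! e))) (?pos (tgt (?js ! e))) (?pos (src (?js ! f))) (?pos (tgt (?js ! f)))"
    if "e < length ?js" "f < length ?js" "d (?N + e) = d (?N + f)" for e f
    using conjunct2[OF conjunct2[OF v']] that by simp
  show "inj_on ?pos (set ks)"
  proof (rule inj_onI)
    fix u w assume uw: "u \<in> set ks" "w \<in> set ks" "?pos u = ?pos w"
    have "snd s 9 u = snd s 9 w"
      using v1[OF kernel_index_less(1)[OF k uw(1)], of "snd s 9 w"]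
        v1[OF kernel_index_less(1)[OF k uw(2)], of "snd s 9 u"] uw(3) by force
    then show "u = w"
      using kernel_index_less(2)[OF k uw(1)] kernel_index_less(2)[OF k uw(2)] by metis
  qed
  show "page ks d S < k" if S: "S \<in> E" "S \<subseteq> set ks" for S
  proof -
    obtain e where "e < length ?js" "S = {src (?js ! e), tgt (?js ! e)}"
      using kernel_edges_ex[OF S] by blast
    then show ?thesis using page_nth v2 by simp
  qed
  show "noncrossing {S \<in> E. S \<subseteq> set ks} ?pos (page ks d)"
    unfolding noncrossing_def
  proof (intro allI impI notI)
    fix u v w x
    assume uv: "{u, v} \<in> {S \<in> E. S \<subseteq> set ks}" and wx: "{w, x} \<in> {S \<in> E. S \<subseteq> set ks}"
      and eq: "page ks d {u, v} = page ks d {w, x}"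
      and lt: "?pos u < ?pos w \<and> ?pos w < ?pos v \<and> ?pos v < ?pos x"
    obtain e where e: "e < length ?js" "{u, v} = {src (?js ! e), tgt (?js ! e)}"
      using kernel_edges_ex[of "{u, v}" "set ks"] uv by auto
    obtain f where f: "f < length ?js" "{w, x} = {src (?js ! f), tgt (?js ! f)}"
      using kernel_edges_ex[of "{w, x}" "set ks"] wx by auto
    have "d (?N + e) = d (?N + f)"
      using eq unfolding e(2) f(2) page_nth[OF e(1)] page_nth[OF f(1)] .
    note no = v3[OF e(1) f(1) this]
    have "u = src (?js ! e) \<and> v = tgt (?js ! e) \<or> u = tgt (?js ! e) \<and> v = src (?js ! e)"
      "w = src (?js ! f) \<and> x = tgt (?js ! f) \<or> w = tgt (?js ! f) \<and> x = src (?js ! f)"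
      using e(2) f(2) by (simp_all add: doubleton_eq_iff)
    then have "interlaced (?pos (src (?js ! e))) (?pos (tgt (?js ! e))) (?pos (src (?js ! f))) (?pos (tgt (?js ! f)))"
      using lt unfolding interlaced_def by fast
    with no show False by contradiction
  qed
qed

text \<open>Positions within the kernel are digits below \<open>length ks\<close>, and so are the
  pages, shifted from \<open>1..k\<close> to \<open>0..k-1\<close>, because
  \<open>k \<le> length ks\<close>. Hence an unsuccessful search refutes an embedding of the whole
  graph.\<close>

lemma valid_code_complete:
  assumes k: "kernel_state ks s" and b: "book_embedding k {..<n} E r \<sigma>" and le: "k \<le> length ks"
  shows "\<exists>d. (\<forall>i<length ks + length (kernel_edges (set ks)). d i < length ks) \<and>
    valid_code k ks (snd s 9) d"
proof -
  let ?js = "kernel_edges (set ks)" and ?N = "length ks"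
  have sub: "set ks \<subseteq> {..<n}" and dist: "distinct ks" using k by (auto simp: kernel_state_def)
  have card: "card (set ks) = ?N" using dist by (rule distinct_card)
  obtain pos where pos: "inj_on pos (set ks)" "\<And>v. v \<in> set ks \<Longrightarrow> pos v < ?N"
    "noncrossing {e \<in> E. e \<subseteq> set ks} pos \<sigma>"
    using book_embedding_positions[OF b simple sub] unfolding card by metis
  define edge where "edge e = {src (?js ! e), tgt (?js ! e)}" for e
  define d where "d i = (if i < ?N then pos (ks ! i) else \<sigma> (edge (i - ?N)) - 1)" for i
  have \<sigma>: "1 \<le> \<sigma> (edge e)" "\<sigma> (edge e) \<le> k" if "e < length ?js" for e
    using kernel_edges_in[OF that] b by (auto simp: book_embedding_def edge_def)
  have dpos: "d (snd s 9 v) = pos v" if "v \<in> set ks" for v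
    using kernel_index_less[OF k that] by (simp add: d_def)
  have dpg: "d (?N + e) = \<sigma> (edge e) - 1" for e by (simp add: d_def)
  have lt: "d i < ?N" if "i < ?N + length ?js" for i
  proof (cases "i < ?N")
    case False
    then have "i - ?N < length ?js" using that by simp
    from \<sigma>[OF this] le False show ?thesis by (simp add: d_def)
  qed (use pos(2) in \<open>simp add: d_def\<close>)
  have "d i \<noteq> d j" if "i < ?N" "j < i" for i j
  proof -
    have "ks ! i \<noteq> ks ! j" using dist that by (simp add: nth_eq_iff_index_eq)
    then show ?thesis using that pos(1) by (auto simp: d_def inj_on_def)
  qed
  moreover have "d (?N + e) < k" if "e < length ?js" for e
    using \<sigma>[OF that] by (simp add: dpg)
  moreover have "\<not> interlaced (d (snd s 9 (src (?js ! e)))) (d (snd s 9 (tgt (?js ! e))))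
      (d (snd s 9 (src (?js ! f)))) (d (snd s 9 (tgt (?js ! f))))"
    if ef: "e < length ?js" "f < length ?js" and eq: "d (?N + e) = d (?N + f)" for e f
  proof -
    \<comment> \<open>Pages are at least 1, so the truncated subtraction in \<open>dpg\<close> is
      injective on them.\<close>
    have "\<sigma> (edge e) = \<sigma> (edge f)" using eq \<sigma>(1)[OF ef(1)] \<sigma>(1)[OF ef(2)] by (simp add: dpg)
    then have nc: "\<not> (pos u < pos w \<and> pos w < pos v \<and> pos v < pos x)"
      if "{u, v} = edge e" "{w, x} = edge f" for u v w x
      using pos(3)[unfolded noncrossing_def, rule_format, of u v w x]
        kernel_edges_in[OF ef(1)] kernel_edges_in[OF ef(2)] that
      by (simp add: edge_def)
    have "\<not> interlaced (pos (src (?js ! e))) (pos (tgt (?js ! e))) (pos (src (?js ! f))) (pos (tgt (?js ! f)))"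
      unfolding interlaced_def
      using nc[of "src (?js ! e)" "tgt (?js ! e)" "src (?js ! f)" "tgt (?js ! f)"]
        nc[of "src (?js ! e)" "tgt (?js ! e)" "tgt (?js ! f)" "src (?js ! f)"]
        nc[of "tgt (?js ! e)" "src (?js ! e)" "src (?js ! f)" "tgt (?js ! f)"]
        nc[of "tgt (?js ! e)" "src (?js ! e)" "tgt (?js ! f)" "src (?js ! f)"]
      by (simp add: edge_def insert_commute)
    then show ?thesis
      using dpos kernel_edges_nth[OF ef(1)] kernel_edges_nth[OF ef(2)] by simp
  qed
  ultimately have "valid_code k ks (snd s 9) d"
    unfolding valid_code_def Let_def by blast
  with lt show ?thesis by blast
qed

end

section \<open>Reinserting the remaining vertices\<close>

text \<open>Two different edges share at most one vertex; if they lie on one page, this vertex is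
  marked as unfit for duplication.\<close>

definition clash_step :: com where
  "clash_step =
     (let a = Read 0 (Read 11 (Var 12)); b = Read 1 (Read 11 (Var 12));
          a' = Read 0 (Read 11 (Var 13)); b' = Read 1 (Read 11 (Var 13))
      in Cond (Equal (Read 12 (Add (Var 6) (Var 12))) (Read 12 (Add (Var 6) (Var 13))))
        (Cond (Conj (Neg (Equal a a')) (Neg (Equal a b'))) Skip (Write 13 a (Const 1));;
         Cond (Conj (Neg (Equal b a')) (Neg (Equal b b'))) Skip (Write 13 b (Const 1)))
        Skip)"

definition representative_step :: com where
  "representative_step =
     Cond (Conj (Equal (Read 4 (Read 8 (Var 12))) (Const 0)) (Equal (Read 13 (Read 8 (Var 12))) (Const 0)))
       (Write 14 (Read 6 (Read 8 (Var 12))) (Read 8 (Var 12))) Skip"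

definition assign_step :: com where
  "assign_step = Cond (Equal (Read 10 (Var 12)) (Const 1)) (Write 15 (Var 12) (Var 12))
     (Write 15 (Var 12) (Read 14 (Read 6 (Var 12))))"

definition row_step :: com where
  "row_step = Write 17 (Var 12) (Var 16);; Assign 16 (Add (Var 16) (Var 0))"

text \<open>Both orders of the endpoints are entered, because the representatives of an input edge
  may come in the opposite order to the kernel edge. The table then yields the page of each input
  edge in constant time.\<close>

definition table_step :: com where
  "table_step =
     (let a = Read 0 (Read 11 (Var 12)); b = Read 1 (Read 11 (Var 12))
      in Write 18 (Add (Read 17 a) b) (Read 12 (Add (Var 6) (Var 12)));;
         Write 18 (Add (Read 17 b) a) (Read 12 (Add (Var 6) (Var 12))))"

text \<open>The added 1 moves the pages from the digits \<open>0..k-1\<close> to the output range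
  \<open>1..k\<close>.\<close>

definition page_output_step :: com where
  "page_output_step = Write 3 (Var 12)
     (Add (Const 1) (Read 18 (Add (Read 17 (Read 15 (Read 0 (Var 12)))) (Read 15 (Read 1 (Var 12))))))"

definition key_step :: com where
  "key_step = Write 16 (Var 12) (Read 12 (Read 9 (Read 15 (Var 12))));;
     Write 20 (Read 16 (Var 12)) (Add (Read 20 (Read 16 (Var 12))) (Const 1))"

definition offset_step :: com where
  "offset_step = Write 21 (Var 12) (Var 17);; Assign 17 (Add (Var 17) (Read 20 (Var 12)))"

definition place_step :: com where
  "place_step = Write 2 (Read 21 (Read 16 (Var 12))) (Var 12);;
     Write 21 (Read 16 (Var 12)) (Add (Read 21 (Read 16 (Var 12))) (Const 1))"

section \<open>Counting sort of the vertices by the position of their representatives\<close>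

lemma runs_offset:
  fixes n :: nat
  assumes s: "fst s 6 = N" "fst s 17 = 0" and cnt: "\<And>p. snd s 20 p = card {w. w < n \<and> \<kappa> w = p}"
  shows "runs (For 12 6 offset_step) s (30 * (N + 1)) (\<lambda>s'. \<forall>p<N. snd s' 21 p = card {w. w < n \<and> \<kappa> w < p})"
proof (rule runs_For[where b = N and T = 22 and
    I = "\<lambda>p s'. fst s' 17 = card {w. w < n \<and> \<kappa> w < p} \<and> (\<forall>q<p. snd s' 21 q = card {w. w < n \<and> \<kappa> w < q})"])
  fix p s' assume p: "p < N" "fst s' 12 = p" and u: "unchanged (For 12 6 offset_step) s s'"
    and I: "fst s' 17 = card {w. w < n \<and> \<kappa> w < p} \<and> (\<forall>q<p. snd s' 21 q = card {w. w < n \<and> \<kappa> w < q})"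
  have e: "snd s' 20 = snd s 20" using u by (simp add: unchanged_def offset_step_def)
  have "{w. w < n \<and> \<kappa> w < Suc p} = {w. w < n \<and> \<kappa> w < p} \<union> {w. w < n \<and> \<kappa> w = p}" by auto
  moreover have "card ({w. w < n \<and> \<kappa> w < p} \<union> {w. w < n \<and> \<kappa> w = p}) =
      card {w. w < n \<and> \<kappa> w < p} + card {w. w < n \<and> \<kappa> w = p}"
    by (rule card_Un_disjoint) auto
  ultimately have card: "card {w. w < n \<and> \<kappa> w < Suc p} = card {w. w < n \<and> \<kappa> w < p} + card {w. w < n \<and> \<kappa> w = p}"
    by simp
  have "snd s' 21 q = card {w. w < n \<and> \<kappa> w < q}" if "q < Suc p" "q \<noteq> p" for q
    using I that by simp
  then show "runs offset_step s' 22 (\<lambda>s''. fst (set_reg 12 (Suc p) s'') 17 = card {w. w < n \<and> \<kappa> w < Suc p} \<and>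
    (\<forall>q<Suc p. snd (set_reg 12 (Suc p) s'') 21 q = card {w. w < n \<and> \<kappa> w < q}))"
    using I p e cnt by (intro runs_straight) (simp_all add: offset_step_def card)
qed (use s in \<open>auto simp: offset_step_def\<close>)

text \<open>Index of \<open>v\<close> in the stable sort of \<open>0, ..., n - 1\<close> by the key
  \<open>\<kappa>\<close>, ties being broken by the vertex number. Equal keys become consecutive,
  which is how copies end up next to each other.\<close>

definition rank :: "nat \<Rightarrow> (nat \<Rightarrow> nat) \<Rightarrow> nat \<Rightarrow> nat" where
  "rank n \<kappa> v = card {w. w < n \<and> (\<kappa> w < \<kappa> v \<or> \<kappa> w = \<kappa> v \<and> w < v)}"

lemma rank_less:
  assumes "u < n" "\<kappa> u < \<kappa> v \<or> \<kappa> u = \<kappa> v \<and> u < v"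
  shows "rank n \<kappa> u < rank n \<kappa> v"
  unfolding rank_def
proof (rule psubset_card_mono)
  let ?S = "\<lambda>v. {w. w < n \<and> (\<kappa> w < \<kappa> v \<or> \<kappa> w = \<kappa> v \<and> w < v)}"
  have "u \<in> ?S v - ?S u" using assms by auto
  moreover have "?S u \<subseteq> ?S v" using assms by auto
  ultimately show "?S u \<subset> ?S v" by blast
qed simp

lemma rank_inj: "inj_on (rank n \<kappa>) {..<n}"
proof (rule inj_onI)
  fix u v assume "u \<in> {..<n}" "v \<in> {..<n}" "rank n \<kappa> u = rank n \<kappa> v"
  then show "u = v"
    using rank_less[of u n \<kappa> v] rank_less[of v n \<kappa> u] by (metis lessThan_iff less_irrefl linorder_neqE_nat)
qed

lemma rank_bound: "v < n \<Longrightarrow> rank n \<kappa> v < n"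
proof -
  assume v: "v < n"
  have "rank n \<kappa> v < card {..<n}"
    unfolding rank_def by (rule psubset_card_mono) (use v in auto)
  then show ?thesis by simp
qed

lemma rank_mono:
  assumes "u < n" "v < n" "rank n \<kappa> u < rank n \<kappa> v"
  shows "\<kappa> u \<le> \<kappa> v"
  using rank_less[of v n \<kappa> u] assms by (meson less_asym not_le)

text \<open>The offset of a key is the number of smaller keys plus the number of vertices with this
  key placed so far; for the next vertex this is exactly its rank. Ranks are distinct, so no cell is
  overwritten.\<close>

lemma runs_place:
  assumes s: "fst s 0 = n" and key: "\<And>v. v < n \<Longrightarrow> snd s 16 v = \<kappa> v \<and> \<kappa> v < N"
    and off: "\<And>p. p < N \<Longrightarrow> snd s 21 p = card {w. w < n \<and> \<kappa> w < p}"
  shows "runs (For 12 0 place_step) s (30 * (n + 1)) (\<lambda>s'. \<forall>v<n. snd s' 2 (rank n \<kappa> v) = v)"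
proof (rule runs_For[where b = n and T = 22 and I = "\<lambda>v s'.
    (\<forall>p<N. snd s' 21 p = card {w. w < n \<and> \<kappa> w < p} + card {w. w < v \<and> \<kappa> w = p}) \<and>
    (\<forall>w<v. snd s' 2 (rank n \<kappa> w) = w)"])
  fix v s' assume v: "v < n" "fst s' 12 = v" and u: "unchanged (For 12 0 place_step) s s'"
    and I: "(\<forall>p<N. snd s' 21 p = card {w. w < n \<and> \<kappa> w < p} + card {w. w < v \<and> \<kappa> w = p}) \<and>
      (\<forall>w<v. snd s' 2 (rank n \<kappa> w) = w)"
  have e: "snd s' 16 v = \<kappa> v" "\<kappa> v < N"
    using u key[OF v(1)] by (auto simp: unchanged_def place_step_def)
  have "{w. w < n \<and> (\<kappa> w < \<kappa> v \<or> \<kappa> w = \<kappa> v \<and> w < v)} =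
    {w. w < n \<and> \<kappa> w < \<kappa> v} \<union> {w. w < v \<and> \<kappa> w = \<kappa> v}"
    using v by auto
  moreover have "card ({w. w < n \<and> \<kappa> w < \<kappa> v} \<union> {w. w < v \<and> \<kappa> w = \<kappa> v}) =
      card {w. w < n \<and> \<kappa> w < \<kappa> v} + card {w. w < v \<and> \<kappa> w = \<kappa> v}"
    by (rule card_Un_disjoint) auto
  ultimately have "rank n \<kappa> v = card {w. w < n \<and> \<kappa> w < \<kappa> v} + card {w. w < v \<and> \<kappa> w = \<kappa> v}"
    unfolding rank_def by simp
  then have r: "snd s' 21 (\<kappa> v) = rank n \<kappa> v" using I e by simp
  have ne: "rank n \<kappa> w \<noteq> rank n \<kappa> v" if "w < v" for w
    using that v rank_inj[of n \<kappa>] by (auto simp: inj_on_def)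
  have cS: "card {w. w < Suc v \<and> \<kappa> w = p} = card {w. w < v \<and> \<kappa> w = p} + (if \<kappa> v = p then 1 else 0)" for p
  proof -
    have "{w. w < Suc v \<and> \<kappa> w = p} = (if \<kappa> v = p then insert v {w. w < v \<and> \<kappa> w = p} else {w. w < v \<and> \<kappa> w = p})"
      by (auto simp: less_Suc_eq)
    then show ?thesis by simp
  qed
  show "runs place_step s' 22 (\<lambda>s''. (\<forall>p<N. snd (set_reg 12 (Suc v) s'') 21 p =
      card {w. w < n \<and> \<kappa> w < p} + card {w. w < Suc v \<and> \<kappa> w = p}) \<and>
    (\<forall>w<Suc v. snd (set_reg 12 (Suc v) s'') 2 (rank n \<kappa> w) = w))"
  proof (rule runs_straight)
    have d: "snd (den place_step s') 21 = (snd s' 21)(\<kappa> v := Suc (rank n \<kappa> v))"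
      "snd (den place_step s') 2 = (snd s' 2)(rank n \<kappa> v := v)"
      using v e r by (simp_all add: place_step_def)
    show "(\<forall>p<N. snd (set_reg 12 (Suc v) (den place_step s')) 21 p =
        card {w. w < n \<and> \<kappa> w < p} + card {w. w < Suc v \<and> \<kappa> w = p}) \<and>
      (\<forall>w<Suc v. snd (set_reg 12 (Suc v) (den place_step s')) 2 (rank n \<kappa> w) = w)"
      unfolding snd_set_reg d cS
    proof (intro conjI allI impI)
      fix p assume "p < N"
      then show "((snd s' 21)(\<kappa> v := Suc (rank n \<kappa> v))) p =
        card {w. w < n \<and> \<kappa> w < p} + (card {w. w < v \<and> \<kappa> w = p} + (if \<kappa> v = p then 1 else 0))"
        using I r[symmetric] e(2) by simp
    next
      fix w assume "w < Suc v"
      then show "((snd s' 2)(rank n \<kappa> v := v)) (rank n \<kappa> w) = w"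
        using I ne[of w] by (cases "w = v") simp_all
    qed
  qed (auto simp: place_step_def)
qed (use s off in \<open>auto simp: place_step_def\<close>)

lemma runs_key:
  assumes s: "fst s 0 = n" and z: "\<And>p. snd s 20 p = 0"
    and \<kappa>: "\<And>v. v < n \<Longrightarrow> snd s 12 (snd s 9 (snd s 15 v)) = \<kappa> v"
  shows "runs (For 12 0 key_step) s (30 * (n + 1))
    (\<lambda>s'. (\<forall>v<n. snd s' 16 v = \<kappa> v) \<and> (\<forall>p. snd s' 20 p = card {w. w < n \<and> \<kappa> w = p}))"
proof (rule runs_For[where b = n and T = 22 and I = "\<lambda>v s'.
    (\<forall>w<v. snd s' 16 w = \<kappa> w) \<and> (\<forall>p. snd s' 20 p = card {w. w < v \<and> \<kappa> w = p})"])
  fix v s' assume v: "v < n" "fst s' 12 = v" and u: "unchanged (For 12 0 key_step) s s'"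
    and I: "(\<forall>w<v. snd s' 16 w = \<kappa> w) \<and> (\<forall>p. snd s' 20 p = card {w. w < v \<and> \<kappa> w = p})"
  have e: "snd s' 12 (snd s' 9 (snd s' 15 v)) = \<kappa> v"
    using u \<kappa>[OF v(1)] by (auto simp: unchanged_def key_step_def)
  have cS: "card {w. w < Suc v \<and> \<kappa> w = p} = card {w. w < v \<and> \<kappa> w = p} + (if \<kappa> v = p then 1 else 0)" for p
  proof -
    have "{w. w < Suc v \<and> \<kappa> w = p} = (if \<kappa> v = p then insert v {w. w < v \<and> \<kappa> w = p} else {w. w < v \<and> \<kappa> w = p})"
      by (auto simp: less_Suc_eq)
    then show ?thesis by simp
  qed
  show "runs key_step s' 22 (\<lambda>s''. (\<forall>w<Suc v. snd (set_reg 12 (Suc v) s'') 16 w = \<kappa> w) \<and>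
    (\<forall>p. snd (set_reg 12 (Suc v) s'') 20 p = card {w. w < Suc v \<and> \<kappa> w = p}))"
    unfolding cS by (rule runs_straight) (use I v e in \<open>auto simp: key_step_def less_Suc_eq\<close>)
qed (use s z in \<open>auto simp: key_step_def\<close>)

lemma runs_row:
  assumes s: "fst s 0 = n" "fst s 16 = 0"
  shows "runs (For 12 0 row_step) s (20 * (n + 1)) (\<lambda>s'. \<forall>v<n. snd s' 17 v = v * n)"
proof (rule runs_For[where b = n and T = 12 and
    I = "\<lambda>v s'. fst s' 16 = v * n \<and> (\<forall>w<v. snd s' 17 w = w * n)"])
  fix v s' assume v: "fst s' 12 = v" and u: "unchanged (For 12 0 row_step) s s'"
    and I: "fst s' 16 = v * n \<and> (\<forall>w<v. snd s' 17 w = w * n)"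
  have "fst s' 0 = n" using u s by (simp add: unchanged_def row_step_def)
  then show "runs row_step s' 12 (\<lambda>s''. fst (set_reg 12 (Suc v) s'') 16 = Suc v * n \<and>
    (\<forall>w<Suc v. snd (set_reg 12 (Suc v) s'') 17 w = w * n))"
    using I v by (intro runs_straight) (auto simp: row_step_def less_Suc_eq)
qed (use s in \<open>auto simp: row_step_def\<close>)

lemma runs_assign:
  assumes s: "fst s 0 = n"
  shows "runs (For 12 0 assign_step) s (30 * (n + 1))
    (\<lambda>s'. \<forall>v<n. snd s' 15 v = (if snd s 10 v = 1 then v else snd s 14 (snd s 6 v)))"
proof (rule runs_For[where b = n and T = 22 and
    I = "\<lambda>v s'. \<forall>w<v. snd s' 15 w = (if snd s 10 w = 1 then w else snd s 14 (snd s 6 w))"])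
  fix v s' assume v: "fst s' 12 = v" and u: "unchanged (For 12 0 assign_step) s s'"
    and I: "\<forall>w<v. snd s' 15 w = (if snd s 10 w = 1 then w else snd s 14 (snd s 6 w))"
  have "snd s' 10 = snd s 10" "snd s' 14 = snd s 14" "snd s' 6 = snd s 6"
    using u by (auto simp: unchanged_def assign_step_def)
  then show "runs assign_step s' 22 (\<lambda>s''. \<forall>w<Suc v. snd (set_reg 12 (Suc v) s'') 15 w =
    (if snd s 10 w = 1 then w else snd s 14 (snd s 6 w)))"
    using I v by (intro runs_straight) (auto simp: assign_step_def less_Suc_eq)
qed (use s in \<open>auto simp: assign_step_def\<close>)

lemma runs_page_output:
  assumes s: "fst s 2 = b"
  shows "runs (For 12 2 page_output_step) s (30 * (b + 1))
    (\<lambda>s'. \<forall>j<b. snd s' 3 j = 1 + snd s 18 (snd s 17 (snd s 15 (snd s 0 j)) + snd s 15 (snd s 1 j)))"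
proof (rule runs_For[where b = b and T = 22 and
    I = "\<lambda>i s'. \<forall>j<i. snd s' 3 j = 1 + snd s 18 (snd s 17 (snd s 15 (snd s 0 j)) + snd s 15 (snd s 1 j))"])
  fix i s' assume i: "fst s' 12 = i" and u: "unchanged (For 12 2 page_output_step) s s'"
    and I: "\<forall>j<i. snd s' 3 j = 1 + snd s 18 (snd s 17 (snd s 15 (snd s 0 j)) + snd s 15 (snd s 1 j))"
  have "snd s' 18 = snd s 18" "snd s' 17 = snd s 17" "snd s' 15 = snd s 15" "snd s' 0 = snd s 0"
    "snd s' 1 = snd s 1"
    using u by (auto simp: unchanged_def page_output_step_def)
  then show "runs page_output_step s' 22 (\<lambda>s''. \<forall>j<Suc i. snd (set_reg 12 (Suc i) s'') 3 j =
    1 + snd s 18 (snd s 17 (snd s 15 (snd s 0 j)) + snd s 15 (snd s 1 j)))"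
    using I i by (intro runs_straight) (auto simp: page_output_step_def less_Suc_eq)
qed (use s in \<open>auto simp: page_output_step_def\<close>)

context graph_input
begin

lemma kernel_edge_state_nth:
  assumes "graph_state s" "kernel_edge_state K s" "e < length (kernel_edges K)"
  shows "snd s 11 e = kernel_edges K ! e" "snd s 0 (kernel_edges K ! e) = src (kernel_edges K ! e)"
    "snd s 1 (kernel_edges K ! e) = tgt (kernel_edges K ! e)"
  using assms kernel_edges_nth(1)[OF assms(3)] by (auto simp: graph_state_def kernel_edge_state_def)

text \<open>The pairs \<open>f < e\<close> meet each unordered pair of different kernel edges once,
  and cells are set but never cleared, so 0 remains exactly at the vertices without two edges on one
  page.\<close>

lemma runs_clash:
  assumes g: "graph_state s" and ke: "kernel_edge_state (set ks) s" and s: "fst s 6 = length ks"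
    and z: "\<And>v. snd s 13 v = 0"
  defines "js \<equiv> kernel_edges (set ks)"
  shows "runs (For 12 7 (For 13 12 clash_step)) s (120 * (length js + 1) ^ 2)
    (\<lambda>s'. \<forall>v. snd s' 13 v = 0 \<longleftrightarrow> (\<forall>e<length js. \<forall>f<e. \<not> (snd s 12 (length ks + e) = snd s 12 (length ks + f) \<and>
       v \<in> {src (js ! e), tgt (js ! e)} \<and> v \<in> {src (js ! f), tgt (js ! f)})))"
proof -
  let ?N = "length ks" and ?M = "length js" and ?d = "snd s 12"
  define R where "R e f v \<longleftrightarrow> \<not> (?d (?N + e) = ?d (?N + f) \<and>
    v \<in> {src (js ! e), tgt (js ! e)} \<and> v \<in> {src (js ! f), tgt (js ! f)})" for e f v
  have nth: "snd s 11 e = js ! e" "snd s 0 (js ! e) = src (js ! e)" "snd s 1 (js ! e) = tgt (js ! e)"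
    if "e < ?M" for e
    using kernel_edge_state_nth[OF g ke] that unfolding js_def by auto
  have "runs (For 12 7 (For 13 12 clash_step)) s (120 * (?M + 1) ^ 2)
    (\<lambda>s'. \<forall>v. snd s' 13 v = 0 \<longleftrightarrow> (\<forall>e<?M. \<forall>f<e. R e f v))"
  proof (rule runs_For[where b = ?M and T = "100 * (?M + 1)" and
      I = "\<lambda>e s'. \<forall>v. snd s' 13 v = 0 \<longleftrightarrow> (\<forall>e'<e. \<forall>f<e'. R e' f v)"])
    fix e s1 assume e: "e < ?M" "fst s1 12 = e" and u: "unchanged (For 12 7 (For 13 12 clash_step)) s s1"
      and I: "\<forall>v. snd s1 13 v = 0 \<longleftrightarrow> (\<forall>e'<e. \<forall>f<e'. R e' f v)"
    have s1: "snd s1 0 = snd s 0" "snd s1 1 = snd s 1" "snd s1 11 = snd s 11" "snd s1 12 = ?d" "fst s1 6 = ?N"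
      using u s by (auto simp: unchanged_def clash_step_def Let_def)
    show "runs (For 13 12 clash_step) s1 (100 * (?M + 1))
      (\<lambda>s2. \<forall>v. snd (set_reg 12 (Suc e) s2) 13 v = 0 \<longleftrightarrow> (\<forall>e'<Suc e. \<forall>f<e'. R e' f v))"
    proof (rule runs_For[where b = e and T = 92 and
        I = "\<lambda>f s2. \<forall>v. snd s2 13 v = 0 \<longleftrightarrow> snd s1 13 v = 0 \<and> (\<forall>f'<f. R e f' v)"])
      fix f s2 assume f: "f < e" "fst s2 13 = f" and u: "unchanged (For 13 12 clash_step) s1 s2"
        and I2: "\<forall>v. snd s2 13 v = 0 \<longleftrightarrow> snd s1 13 v = 0 \<and> (\<forall>f'<f. R e f' v)"
      have s2: "snd s2 0 = snd s 0" "snd s2 1 = snd s 1" "snd s2 11 = snd s 11" "snd s2 12 = ?d" "fst s2 6 = ?N"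
        "fst s2 12 = e"
        using u s1 e by (auto simp: unchanged_def clash_step_def Let_def)
      have "f < ?M" using f e by simp
      note nths = nth[OF e(1)] nth[OF \<open>f < ?M\<close>]
      have d: "snd (den clash_step s2) 13 v = (if R e f v then snd s2 13 v else 1)" for v
        unfolding R_def clash_step_def Let_def using s2 f(2) nths by auto
      show "runs clash_step s2 92 (\<lambda>s3. \<forall>v. snd (set_reg 13 (Suc f) s3) 13 v = 0 \<longleftrightarrow>
        snd s1 13 v = 0 \<and> (\<forall>f'<Suc f. R e f' v))"
      proof (rule runs_straight)
        show "\<forall>v. snd (set_reg 13 (Suc f) (den clash_step s2)) 13 v = 0 \<longleftrightarrow>
          snd s1 13 v = 0 \<and> (\<forall>f'<Suc f. R e f' v)"
          using I2 by (auto simp: d less_Suc_eq)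
      qed (auto simp: clash_step_def Let_def)
    next
      show "(e + 1) * (92 + 8) \<le> 100 * (?M + 1)" using e by simp
    qed (use e I in \<open>auto simp: clash_step_def Let_def less_Suc_eq\<close>)
  next
    have "(?M + 1) * (100 * (?M + 1) + 8) \<le> (?M + 1) * (120 * (?M + 1))" by (intro mult_le_mono) auto
    then show "(?M + 1) * (100 * (?M + 1) + 8) \<le> 120 * (?M + 1) ^ 2"
      by (simp only: power2_eq_square mult.assoc mult.left_commute)
  qed (use ke z in \<open>auto simp: clash_step_def Let_def kernel_edge_state_def js_def\<close>)
  then show ?thesis unfolding R_def .
qed

text \<open>An entry may be overwritten, but only by another fit kernel vertex outside
  \<open>C\<close> with the same code. Nothing is claimed for codes without a fit vertex.\<close>

lemma runs_representative:
  assumes k: "kernel_state ks s" and c: "\<And>v. snd s 4 v = 0 \<longleftrightarrow> v \<notin> C"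
  shows "runs (For 12 6 representative_step) s (40 * (length ks + 1)) (\<lambda>s'. \<forall>v\<in>set ks - C. snd s 13 v = 0 \<longrightarrow>
    (let z = snd s' 14 (snd s 6 v) in z \<in> set ks - C \<and> snd s 13 z = 0 \<and> snd s 6 z = snd s 6 v))"
proof -
  define good where "good v \<longleftrightarrow> v \<notin> C \<and> snd s 13 v = 0" for v
  have "runs (For 12 6 representative_step) s (40 * (length ks + 1)) (\<lambda>s'. \<forall>j<length ks. good (ks ! j) \<longrightarrow>
    (let z = snd s' 14 (snd s 6 (ks ! j)) in z \<in> set ks \<and> good z \<and> snd s 6 z = snd s 6 (ks ! j)))"
  proof (rule runs_For[where b = "length ks" and T = 32 and I = "\<lambda>i s'. \<forall>j<i. good (ks ! j) \<longrightarrow>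
      (let z = snd s' 14 (snd s 6 (ks ! j)) in z \<in> set ks \<and> good z \<and> snd s 6 z = snd s 6 (ks ! j))"])
    fix i s' assume i: "i < length ks" "fst s' 12 = i" and u: "unchanged (For 12 6 representative_step) s s'"
      and I: "\<forall>j<i. good (ks ! j) \<longrightarrow>
      (let z = snd s' 14 (snd s 6 (ks ! j)) in z \<in> set ks \<and> good z \<and> snd s 6 z = snd s 6 (ks ! j))"
    have e: "snd s' 8 i = ks ! i" "snd s' 4 = snd s 4" "snd s' 13 = snd s 13" "snd s' 6 = snd s 6"
      using u k i by (auto simp: unchanged_def representative_step_def kernel_state_def)
    have d: "snd (den representative_step s') 14 =
      (if good (ks ! i) then (snd s' 14)(snd s 6 (ks ! i) := ks ! i) else snd s' 14)"
      using e i c by (simp add: representative_step_def good_def)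
    show "runs representative_step s' 32 (\<lambda>s''. \<forall>j<Suc i. good (ks ! j) \<longrightarrow>
      (let z = snd (set_reg 12 (Suc i) s'') 14 (snd s 6 (ks ! j)) in z \<in> set ks \<and> good z \<and> snd s 6 z = snd s 6 (ks ! j)))"
    proof (rule runs_straight)
      show "\<forall>j<Suc i. good (ks ! j) \<longrightarrow> (let z = snd (set_reg 12 (Suc i) (den representative_step s')) 14 (snd s 6 (ks ! j))
        in z \<in> set ks \<and> good z \<and> snd s 6 z = snd s 6 (ks ! j))"
        using I i unfolding snd_set_reg d by (auto simp: less_Suc_eq Let_def)
    qed (auto simp: representative_step_def)
  qed (use k in \<open>auto simp: representative_step_def kernel_state_def\<close>)
  then show ?thesis
    by (rule runs_mono) (auto simp: good_def Let_def in_set_conv_nth)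
qed

lemma runs_table:
  assumes g: "graph_state s" and ke: "kernel_edge_state (set ks) s" and s: "fst s 6 = length ks"
    and row: "\<And>v. v < n \<Longrightarrow> snd s 17 v = v * n"
  defines "js \<equiv> kernel_edges (set ks)"
  shows "runs (For 12 7 table_step) s (50 * (length js + 1)) (\<lambda>s'. \<forall>e<length js. \<forall>u v.
    {u, v} = {src (js ! e), tgt (js ! e)} \<longrightarrow> snd s' 18 (u * n + v) = snd s 12 (length ks + e))"
proof (rule runs_For[where b = "length js" and T = 42 and I = "\<lambda>i s'. \<forall>e<i. \<forall>u v.
    {u, v} = {src (js ! e), tgt (js ! e)} \<longrightarrow> snd s' 18 (u * n + v) = snd s 12 (length ks + e)"])
  fix i s' assume i: "i < length js" "fst s' 12 = i" and u: "unchanged (For 12 7 table_step) s s'"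
    and I: "\<forall>e<i. \<forall>u v. {u, v} = {src (js ! e), tgt (js ! e)} \<longrightarrow>
      snd s' 18 (u * n + v) = snd s 12 (length ks + e)"
  have e: "snd s' 0 = snd s 0" "snd s' 1 = snd s 1" "snd s' 11 = snd s 11" "snd s' 12 = snd s 12"
    "snd s' 17 = snd s 17" "fst s' 6 = length ks"
    using u s by (auto simp: unchanged_def table_step_def Let_def)
  have nth: "snd s 11 i = js ! i" "snd s 0 (js ! i) = src (js ! i)" "snd s 1 (js ! i) = tgt (js ! i)"
    using kernel_edge_state_nth[OF g ke] i(1) unfolding js_def by auto
  have lt: "src (js ! e) < n" "tgt (js ! e) < n" if "e < length js" for e
    using edge_lt kernel_edges_nth(1) that unfolding js_def by auto
  let ?a = "src (js ! i)" and ?b = "tgt (js ! i)" and ?x = "snd s 12 (length ks + i)"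
  \<comment> \<open>Because of \<open>v < n\<close>, the address \<open>u * n + v\<close> determines
    \<open>u\<close> and \<open>v\<close> by division with remainder, so the entries of different
    edges do not collide.\<close>
  have inj: "u = u' \<and> v = v'" if "u * n + v = u' * n + v'" "v < n" "v' < n" for u v u' v' :: nat
    using arg_cong[OF that(1), of "\<lambda>x. x div n"] arg_cong[OF that(1), of "\<lambda>x. x mod n"] that(2,3) by simp
  have d: "snd (den table_step s') 18 = (snd s' 18)(?a * n + ?b := ?x, ?b * n + ?a := ?x)"
    unfolding table_step_def Let_def using e nth i(2) row lt[OF i(1)] by simp
  have "snd (den table_step s') 18 (u * n + v) = snd s 12 (length ks + f)"
    if f: "f < Suc i" and uv: "{u, v} = {src (js ! f), tgt (js ! f)}" for f u v
  proof (cases "f = i")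
    case True
    then have "u = ?a \<and> v = ?b \<or> u = ?b \<and> v = ?a" using uv by (auto simp: doubleton_eq_iff)
    then show ?thesis unfolding d True by auto
  next
    case False
    then have fi: "f < i" "f < length js" using f i by auto
    have "{u, v} \<noteq> {?a, ?b}"
      using uv False fi(2) i(1) kernel_edges_inj unfolding js_def by metis
    then have ne: "\<not> (u = ?a \<and> v = ?b)" "\<not> (u = ?b \<and> v = ?a)" by auto
    have v: "v < n" using uv lt[OF fi(2)] by (auto simp: doubleton_eq_iff)
    have "u * n + v \<noteq> ?a * n + ?b" "u * n + v \<noteq> ?b * n + ?a"
      using inj[of u v ?a ?b] inj[of u v ?b ?a] ne v lt[OF i(1)] by blast+
    then show ?thesis unfolding d using I fi uv by simp
  qed
  then show "runs table_step s' 42 (\<lambda>s''. \<forall>e<Suc i. \<forall>u v. {u, v} = {src (js ! e), tgt (js ! e)} \<longrightarrow>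
    snd (set_reg 12 (Suc i) s'') 18 (u * n + v) = snd s 12 (length ks + e))"
    by (intro runs_straight) (auto simp: table_step_def Let_def)
qed (use ke in \<open>auto simp: table_step_def Let_def kernel_edge_state_def js_def\<close>)

end

definition output_prog :: com where
  "output_prog = For 12 7 (For 13 12 clash_step);; For 12 6 representative_step;;
     For 12 0 assign_step;; For 12 0 row_step;; For 12 7 table_step;; For 12 2 page_output_step;;
     For 12 0 key_step;; For 12 6 offset_step;; For 12 0 place_step;; Assign 0 (Const 1)"

context graph_input
begin

text \<open>All edges at \<open>v\<close> are kernel edges, because its neighbours lie in
  \<open>C\<close> and hence in the kernel. A repeated page is therefore a pair of different kernel
  edges at \<open>v\<close> with equal digits, which is what the marks record.\<close>

lemma distinct_pages_iff:
  assumes C: "C \<subseteq> set ks" "vertex_cover {..<n} E C" and v: "v \<in> set ks - C"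
  defines "js \<equiv> kernel_edges (set ks)"
  shows "inj_on (\<lambda>x. page ks d {v, x}) (nbr E v) \<longleftrightarrow>
    (\<forall>e<length js. \<forall>f<e. \<not> (d (length ks + e) = d (length ks + f) \<and>
       v \<in> {src (js ! e), tgt (js ! e)} \<and> v \<in> {src (js ! f), tgt (js ! f)}))"
proof -
  have nb: "\<exists>e<length js. {v, x} = {src (js ! e), tgt (js ! e)}" if "x \<in> nbr E v" for x
    unfolding js_def
  proof (rule kernel_edges_ex)
    show "{v, x} \<in> E" using that by (simp add: nbr_def insert_commute)
    then have "x \<in> C" using C(2) v by (auto simp: vertex_cover_def)
    then show "{v, x} \<subseteq> set ks" using v C(1) by auto
  qed
  have pg: "page ks d {src (js ! e), tgt (js ! e)} = d (length ks + e)" if "e < length js" for e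
    using page_nth that unfolding js_def by blast
  have inj: "e = f" if "e < length js" "f < length js"
    "{src (js ! e), tgt (js ! e)} = {src (js ! f), tgt (js ! f)}" for e f
    using kernel_edges_inj that unfolding js_def by blast
  show ?thesis
  proof
    assume i: "inj_on (\<lambda>x. page ks d {v, x}) (nbr E v)"
    show "\<forall>e<length js. \<forall>f<e. \<not> (d (length ks + e) = d (length ks + f) \<and>
       v \<in> {src (js ! e), tgt (js ! e)} \<and> v \<in> {src (js ! f), tgt (js ! f)})"
    proof (intro allI impI notI, elim conjE)
      fix e f assume ef: "e < length js" "f < e" "d (length ks + e) = d (length ks + f)"
        "v \<in> {src (js ! e), tgt (js ! e)}" "v \<in> {src (js ! f), tgt (js ! f)}"
      have f: "f < length js" using ef by simp
      obtain x where x: "{src (js ! e), tgt (js ! e)} = {v, x}" using ef(4) by auto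
      obtain y where y: "{src (js ! f), tgt (js ! f)} = {v, y}" using ef(5) by auto
      have "{v, x} \<in> E" "{v, y} \<in> E"
        using kernel_edges_in[of e "set ks"] kernel_edges_in[of f "set ks"] ef(1) f x y
        unfolding js_def by auto
      then have "x \<in> nbr E v" "y \<in> nbr E v" by (auto simp: nbr_def insert_commute)
      moreover have "page ks d {v, x} = page ks d {v, y}"
        using pg[OF ef(1)] pg[OF f] ef(3) x y by simp
      ultimately have "x = y" using i by (auto simp: inj_on_def)
      then show False using inj[OF ef(1) f] x y ef(2) by simp
    qed
  next
    assume a: "\<forall>e<length js. \<forall>f<e. \<not> (d (length ks + e) = d (length ks + f) \<and>
       v \<in> {src (js ! e), tgt (js ! e)} \<and> v \<in> {src (js ! f), tgt (js ! f)})"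
    show "inj_on (\<lambda>x. page ks d {v, x}) (nbr E v)"
    proof (rule inj_onI)
      fix x y assume x: "x \<in> nbr E v" and y: "y \<in> nbr E v" and eq: "page ks d {v, x} = page ks d {v, y}"
      obtain e where e: "e < length js" "{v, x} = {src (js ! e), tgt (js ! e)}" using nb[OF x] by blast
      obtain f where f: "f < length js" "{v, y} = {src (js ! f), tgt (js ! f)}" using nb[OF y] by blast
      have d: "d (length ks + e) = d (length ks + f)" using eq e f pg by simp
      have v: "v \<in> {src (js ! e), tgt (js ! e)}" "v \<in> {src (js ! f), tgt (js ! f)}"
        using e(2) f(2) by blast+
      have "\<not> f < e" using a e(1) d v by blast
      moreover have "\<not> e < f" using a f(1) d[symmetric] v by blast
      ultimately have "e = f" by simp
      then have "{v, x} = {v, y}" using e(2) f(2) by simp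
      then show "x = y" by (auto simp: doubleton_eq_iff)
    qed
  qed
qed

text \<open>The class of an omitted vertex has at least \<open>h\<close> members, more than twice
  the number of page patterns on its neighbourhood. The argument applies to whichever kernel
  embedding the search has returned.\<close>

lemma representative_exists:
  assumes C: "vertex_cover {..<n} E C"
    and cl: "kernel_classes C \<mu> h ks" and h: "\<And>U. U \<subseteq> C \<Longrightarrow> 2 * k ^ card U < h"
    and \<mu>: "\<And>u v. u \<notin> C \<Longrightarrow> v \<notin> C \<Longrightarrow> \<mu> u = \<mu> v \<Longrightarrow> nbr E u = nbr E v"
    and nc: "noncrossing {S \<in> E. S \<subseteq> set ks} pos \<sigma>" and inj: "inj_on pos (set ks)"
    and \<sigma>: "\<And>S. S \<in> E \<Longrightarrow> S \<subseteq> set ks \<Longrightarrow> \<sigma> S < k"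
    and v: "v < n" "v \<notin> set ks"
  shows "\<exists>w\<in>set ks - C. \<mu> w = \<mu> v \<and> inj_on (\<lambda>x. \<sigma> {w, x}) (nbr E w)"
proof -
  let ?X = "{w \<in> set ks - C. \<mu> w = \<mu> v}" and ?U = "nbr E v"
  have CK: "C \<subseteq> set ks" using cl by (simp add: kernel_classes_def)
  have vC: "v \<notin> C" using CK v by auto
  have U: "?U \<subseteq> C" using C vC by (auto simp: nbr_def vertex_cover_def)
  have nb: "nbr E w = ?U" if "w \<in> ?X" for w using \<mu> vC that by blast
  have edge: "{w, x} \<in> {S \<in> E. S \<subseteq> set ks}" if "w \<in> ?X" "x \<in> ?U" for w x
  proof -
    have "x \<in> nbr E w" using nb[OF that(1)] that(2) by simp
    then show ?thesis using that U CK by (auto simp: nbr_def insert_commute)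
  qed
  have "\<exists>w\<in>?X. inj_on (\<lambda>x. \<sigma> {w, x}) ?U"
  proof (rule exists_vertex_with_distinct_pages[OF nc inj])
    show "2 * k ^ card ?U < card ?X"
      using h[OF U] cl v by (fastforce simp: kernel_classes_def)
    show "\<sigma> {w, x} < k" if "w \<in> ?X" "x \<in> ?U" for w x
      using edge[OF that] \<sigma> by simp
  qed (use U CK edge in auto)
  then obtain w where "w \<in> ?X" "inj_on (\<lambda>x. \<sigma> {w, x}) ?U" by blast
  then show ?thesis using nb by auto
qed

text \<open>Every vertex is sent to its representative by \<open>\<rho>\<close>. An edge inherits
  the page of its image in the kernel, and sorting by the position of the image gathers all copies
  of a kernel vertex at the place of that vertex.\<close>

lemma runs_output:
  assumes g: "graph_state s" and k: "kernel_state ks s" and ke: "kernel_edge_state (set ks) s"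
    and C: "vertex_cover {..<n} E C" "\<And>v. snd s 4 v = 0 \<longleftrightarrow> v \<notin> C"
    and cl: "kernel_classes C (snd s 6) h ks" and h: "\<And>U. U \<subseteq> C \<Longrightarrow> 2 * k ^ card U < h"
    and \<mu>: "\<And>u v. u \<notin> C \<Longrightarrow> v \<notin> C \<Longrightarrow> snd s 6 u = snd s 6 v \<Longrightarrow> nbr E u = nbr E v"
    and L: "L = length ks + length (kernel_edges (set ks))"
    and valid: "valid_code k ks (snd s 9) (snd s 12)" "\<And>i. i < L \<Longrightarrow> snd s 12 i < length ks"
    and z: "\<And>v. snd s 13 v = 0" "\<And>p. snd s 20 p = 0" "fst s 16 = 0" "fst s 17 = 0"
  shows "\<exists>t s'. exec output_prog s t s' \<and> t \<le> 200 * (n + m + 1) + 200 * (L + 1) ^ 2 \<and>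
    fst s' 0 = 1 \<and> outputs_book_embedding k n E es s'"
proof -
  let ?js = "kernel_edges (set ks)" and ?N = "length ks" and ?d = "snd s 12"
  let ?M = "length ?js" and ?pos = "\<lambda>v. snd s 12 (snd s 9 v)" and ?\<sigma> = "page ks (snd s 12)"
  \<comment> \<open>Input, kernel and code stay intact until the answer flag is written at the very
    end; before that only scratch memory and the output arrays change.\<close>
  define keep where "keep s' \<longleftrightarrow> (\<forall>x\<le>11. fst s' x = fst s x) \<and>
    (\<forall>a. a \<in> {0, 1, 4, 5, 6, 7, 8, 9, 10, 11, 12} \<longrightarrow> snd s' a = snd s a)" for s' :: state
  have keep0: "keep s" by (simp add: keep_def)
  have keep: "keep s''" if "keep s'" "unchanged P s' s''" "regs P \<subseteq> {12, 13, 16, 17}"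
    "arrs P \<subseteq> {2, 3, 13, 14, 15, 16, 17, 18, 20, 21}" for P s' s''
  proof -
    have "x \<notin> regs P" if "x \<le> 11" for x using that \<open>regs P \<subseteq> _\<close> by fastforce
    moreover have "a \<notin> arrs P" if "a \<in> {0, 1, 4, 5, 6, 7, 8, 9, 10, 11, 12}" for a
      using that \<open>arrs P \<subseteq> _\<close> by fastforce
    ultimately show ?thesis using that(1,2) unfolding keep_def unchanged_def by metis
  qed
  have keepD: "graph_state s'" "kernel_state ks s'" "kernel_edge_state (set ks) s'" "snd s' 4 = snd s 4"
    "snd s' 6 = snd s 6" "snd s' 9 = snd s 9" "snd s' 10 = snd s 10" "snd s' 12 = ?d" "fst s' 0 = n" "fst s' 2 = m"
    "fst s' 6 = ?N" "snd s' 0 = snd s 0" "snd s' 1 = snd s 1"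
    if "keep s'" for s'
    using that g k ke by (simp_all add: keep_def graph_state_def kernel_state_def kernel_edge_state_def)
  have CK: "C \<subseteq> set ks" using cl by (simp add: kernel_classes_def)
  note sound = valid_code_sound[OF k valid(1)]

  obtain t1 s1 where e1: "exec (For 12 7 (For 13 12 clash_step)) s t1 s1" "t1 \<le> 120 * (?M + 1) ^ 2"
    and q1: "\<forall>v. snd s1 13 v = 0 \<longleftrightarrow> (\<forall>e<?M. \<forall>f<e. \<not> (?d (?N + e) = ?d (?N + f) \<and>
       v \<in> {src (?js ! e), tgt (?js ! e)} \<and> v \<in> {src (?js ! f), tgt (?js ! f)}))"
    and u1: "unchanged (For 12 7 (For 13 12 clash_step)) s s1"
    by (rule runsE[OF runs_clash[OF g ke keepD(11)[OF keep0] z(1)]]) blast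
  have k1: "keep s1" by (rule keep[OF keep0 u1]) (auto simp: clash_step_def Let_def)
  have z1: "snd s1 20 = snd s 20" "fst s1 16 = 0" "fst s1 17 = 0"
    using u1 z by (auto simp: unchanged_def clash_step_def Let_def)
  have clash: "snd s1 13 v = 0 \<longleftrightarrow> inj_on (\<lambda>x. ?\<sigma> {v, x}) (nbr E v)" if "v \<in> set ks - C" for v
    unfolding distinct_pages_iff[OF CK C(1) that] using q1 by blast

  have c1: "snd s1 4 v = 0 \<longleftrightarrow> v \<notin> C" for v using C(2) keepD(4)[OF k1] by simp
  obtain t2 s2 where e2: "exec (For 12 6 representative_step) s1 t2 s2" "t2 \<le> 40 * (?N + 1)"
    and q2: "\<forall>v\<in>set ks - C. snd s1 13 v = 0 \<longrightarrow>
      (let z = snd s2 14 (snd s1 6 v) in z \<in> set ks - C \<and> snd s1 13 z = 0 \<and> snd s1 6 z = snd s1 6 v)"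
    and u2: "unchanged (For 12 6 representative_step) s1 s2"
    by (rule runsE[OF runs_representative[OF keepD(2)[OF k1] c1]]) blast
  have k2: "keep s2" by (rule keep[OF k1 u2]) (auto simp: representative_step_def)
  have z2: "snd s2 20 = snd s 20" "fst s2 16 = 0" "fst s2 17 = 0"
    using u2 z1 by (auto simp: unchanged_def representative_step_def)

  obtain t3 s3 where e3: "exec (For 12 0 assign_step) s2 t3 s3" "t3 \<le> 30 * (n + 1)"
    and q3: "\<forall>v<n. snd s3 15 v = (if snd s2 10 v = 1 then v else snd s2 14 (snd s2 6 v))"
    and u3: "unchanged (For 12 0 assign_step) s2 s3"
    by (rule runsE[OF runs_assign[OF keepD(9)[OF k2]]]) blast
  have k3: "keep s3" by (rule keep[OF k2 u3]) (auto simp: assign_step_def)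
  have z3: "snd s3 20 = snd s 20" "fst s3 16 = 0" "fst s3 17 = 0"
    using u3 z2 by (auto simp: unchanged_def assign_step_def)
  define \<rho> where "\<rho> = snd s3 15"
  have \<rho>K: "\<rho> v = v" if "v \<in> set ks" for v
    using q3 that k keepD(7)[OF k2] by (auto simp: \<rho>_def kernel_state_def)
  have \<rho>new: "\<rho> v \<in> set ks - C \<and> nbr E (\<rho> v) = nbr E v \<and> inj_on (\<lambda>x. ?\<sigma> {\<rho> v, x}) (nbr E v)"
    if v: "v < n" "v \<notin> set ks" for v
  proof -
    have eq: "\<rho> v = snd s2 14 (snd s 6 v)"
      using q3 v k keepD(7)[OF k2] keepD(5)[OF k2] by (auto simp: \<rho>_def kernel_state_def)
    \<comment> \<open>By pigeonhole the class of \<open>v\<close> has a fit vertex, and this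
      guarantees that the entry read from array 14 has been filled properly.\<close>
    obtain w where w: "w \<in> set ks - C" "snd s 6 w = snd s 6 v" "inj_on (\<lambda>x. ?\<sigma> {w, x}) (nbr E w)"
      using representative_exists[OF C(1) cl h \<mu> sound(2,1,3) v] by blast
    have "snd s1 13 w = 0" using clash[OF w(1)] w(3) by simp
    then have r: "\<rho> v \<in> set ks - C" "snd s1 13 (\<rho> v) = 0" "snd s 6 (\<rho> v) = snd s 6 v"
      using q2[rule_format, OF w(1)] w(2) keepD(5)[OF k1] eq by (auto simp: Let_def)
    have nb: "nbr E (\<rho> v) = nbr E v" using \<mu>[of "\<rho> v" v] r v CK by auto
    have "inj_on (\<lambda>x. ?\<sigma> {\<rho> v, x}) (nbr E (\<rho> v))" using clash[OF r(1)] r(2) by blast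
    then show ?thesis using r nb by simp
  qed
  have \<rho>in: "\<rho> v \<in> set ks" if "v < n" for v
    using \<rho>K[of v] \<rho>new[of v] that by (cases "v \<in> set ks") auto

  obtain t4 s4 where e4: "exec (For 12 0 row_step) s3 t4 s4" "t4 \<le> 20 * (n + 1)"
    and q4: "\<forall>v<n. snd s4 17 v = v * n" and u4: "unchanged (For 12 0 row_step) s3 s4"
    by (rule runsE[OF runs_row[OF keepD(9)[OF k3] z3(2)]]) blast
  have k4: "keep s4" by (rule keep[OF k3 u4]) (auto simp: row_step_def)
  have z4: "snd s4 20 = snd s 20" "fst s4 17 = 0" "snd s4 15 = \<rho>"
    using u4 z3 by (auto simp: unchanged_def row_step_def \<rho>_def)

  have row: "snd s4 17 v = v * n" if "v < n" for v using q4 that by simp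
  obtain t5 s5 where e5: "exec (For 12 7 table_step) s4 t5 s5" "t5 \<le> 50 * (?M + 1)"
    and q5: "\<forall>e<?M. \<forall>u v. {u, v} = {src (?js ! e), tgt (?js ! e)} \<longrightarrow>
      snd s5 18 (u * n + v) = snd s4 12 (?N + e)"
    and u5: "unchanged (For 12 7 table_step) s4 s5"
    by (rule runsE[OF runs_table[OF keepD(1,3,11)[OF k4] row]]) blast+
  have k5: "keep s5" by (rule keep[OF k4 u5]) (auto simp: table_step_def Let_def)
  have z5: "snd s5 20 = snd s 20" "fst s5 17 = 0" "snd s5 15 = \<rho>" "snd s5 17 = snd s4 17"
    using u5 z4 by (auto simp: unchanged_def table_step_def Let_def)
  have table: "snd s5 18 (u * n + v) = ?\<sigma> {u, v}" if uv: "{u, v} \<in> {S \<in> E. S \<subseteq> set ks}" for u v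
  proof -
    obtain e where e: "e < ?M" "{u, v} = {src (?js ! e), tgt (?js ! e)}"
      using kernel_edges_ex[of "{u, v}" "set ks"] uv by auto
    have "snd s5 18 (u * n + v) = ?d (?N + e)" using q5 e keepD(8)[OF k4] by simp
    also have "\<dots> = ?\<sigma> {u, v}" using page_nth[OF e(1)] e(2) by simp
    finally show ?thesis .
  qed

  obtain t6 s6 where e6: "exec (For 12 2 page_output_step) s5 t6 s6" "t6 \<le> 30 * (m + 1)"
    and q6: "\<forall>j<m. snd s6 3 j = 1 + snd s5 18 (snd s5 17 (snd s5 15 (snd s5 0 j)) + snd s5 15 (snd s5 1 j))"
    and u6: "unchanged (For 12 2 page_output_step) s5 s6"
    by (rule runsE[OF runs_page_output[OF keepD(10)[OF k5]]]) blast
  have k6: "keep s6" by (rule keep[OF k5 u6]) (auto simp: page_output_step_def)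
  have z6: "snd s6 20 = snd s 20" "fst s6 17 = 0" "snd s6 15 = \<rho>"
    using u6 z5 by (auto simp: unchanged_def page_output_step_def)

  define \<kappa> where "\<kappa> v = ?pos (\<rho> v)" for v
  have \<kappa>6: "snd s6 12 (snd s6 9 (snd s6 15 v)) = \<kappa> v" for v
    using keepD(8,6)[OF k6] z6 by (simp add: \<kappa>_def)
  have \<kappa>N: "\<kappa> v < ?N" if "v < n" for v
    unfolding \<kappa>_def using valid(2) kernel_index_less(1)[OF k \<rho>in[OF that]] L by simp
  have cnt6: "snd s6 20 p = 0" for p using z6 z by simp
  obtain t7 s7 where e7: "exec (For 12 0 key_step) s6 t7 s7" "t7 \<le> 30 * (n + 1)"
    and q7: "(\<forall>v<n. snd s7 16 v = \<kappa> v) \<and> (\<forall>p. snd s7 20 p = card {w. w < n \<and> \<kappa> w = p})"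
    and u7: "unchanged (For 12 0 key_step) s6 s7"
    by (rule runsE[OF runs_key[OF keepD(9)[OF k6] cnt6 \<kappa>6]]) blast
  have k7: "keep s7" by (rule keep[OF k6 u7]) (auto simp: key_step_def)
  have z7: "fst s7 17 = 0" "snd s7 3 = snd s6 3"
    using u7 z6 by (auto simp: unchanged_def key_step_def)

  have cnt7: "snd s7 20 p = card {w. w < n \<and> \<kappa> w = p}" for p using q7 by simp
  obtain t8 s8 where e8: "exec (For 12 6 offset_step) s7 t8 s8" "t8 \<le> 30 * (?N + 1)"
    and q8: "\<forall>p<?N. snd s8 21 p = card {w. w < n \<and> \<kappa> w < p}"
    and u8: "unchanged (For 12 6 offset_step) s7 s8"
    by (rule runsE[OF runs_offset[OF keepD(11)[OF k7] z7(1) cnt7]]) blast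
  have k8: "keep s8" by (rule keep[OF k7 u8]) (auto simp: offset_step_def)
  have z8: "snd s8 3 = snd s6 3" "snd s8 16 = snd s7 16"
    using u8 z7 by (auto simp: unchanged_def offset_step_def)

  have key8: "snd s8 16 v = \<kappa> v \<and> \<kappa> v < ?N" if "v < n" for v
    using q7 z8 \<kappa>N that by simp
  have off8: "snd s8 21 p = card {w. w < n \<and> \<kappa> w < p}" if "p < ?N" for p using q8 that by simp
  obtain t9 s9 where e9: "exec (For 12 0 place_step) s8 t9 s9" "t9 \<le> 30 * (n + 1)"
    and q9: "\<forall>v<n. snd s9 2 (rank n \<kappa> v) = v"
    and u9: "unchanged (For 12 0 place_step) s8 s9"
    by (rule runsE[OF runs_place[OF keepD(9)[OF k8] key8 off8]]) blast+
  have z9: "snd s9 3 = snd s6 3" using u9 z8 by (auto simp: unchanged_def place_step_def)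

  let ?s = "set_reg 0 1 s9"
  have e10: "exec (Assign 0 (Const 1)) s9 2 ?s" using exec.Assign[of 0 "Const 1" s9] by (simp add: numeral_2_eq_2)
  have "exec output_prog s (t1 + (t2 + (t3 + (t4 + (t5 + (t6 + (t7 + (t8 + (t9 + 2))))))))) ?s"
    unfolding output_prog_def
    by (intro exec.Seq[OF e1(1)] exec.Seq[OF e2(1)] exec.Seq[OF e3(1)] exec.Seq[OF e4(1)]
        exec.Seq[OF e5(1)] exec.Seq[OF e6(1)] exec.Seq[OF e7(1)] exec.Seq[OF e8(1)]
        exec.Seq[OF e9(1)] e10)
  moreover have "t1 + (t2 + (t3 + (t4 + (t5 + (t6 + (t7 + (t8 + (t9 + 2)))))))) \<le>
    200 * (n + m + 1) + 200 * (L + 1) ^ 2"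
  proof -
    define q where "q = (L + 1) ^ 2"
    have "(?M + 1) ^ 2 \<le> q" unfolding q_def using L by (intro power_mono) auto
    then have "t1 \<le> 120 * q" using e1(2) by (meson mult_le_mono2 order_trans)
    moreover have "?M + 1 + ?N \<le> q" unfolding q_def using L by (simp add: power2_eq_square)
    then have "t2 + t5 + t8 \<le> 70 * q + 50" using e2(2) e5(2) e8(2) by simp
    moreover have "t3 + t4 + t6 + t7 + t9 \<le> 110 * n + 30 * m + 140"
      using e3(2) e4(2) e6(2) e7(2) e9(2) by simp
    ultimately show ?thesis unfolding q_def[symmetric] by simp
  qed
  moreover have "outputs_book_embedding k n E es ?s"
  proof -
    let ?\<sigma>' = "\<lambda>e. 1 + ?\<sigma> (\<rho> ` e)"
    have edge: "{\<rho> u, \<rho> v} \<in> {S \<in> E. S \<subseteq> set ks}" if "{u, v} \<in> E" for u v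
      by (rule representative_edge[OF simple C(1) CK _ \<rho>K _ that]) (use \<rho>in \<rho>new in auto)
    have "noncrossing E (rank n \<kappa>) (\<lambda>e. ?\<sigma> (\<rho> ` e))"
    proof (rule noncrossing_extend[OF simple C(1) CK sound(2,1) _ \<rho>K])
      \<comment> \<open>Being sorted by key is exactly the weak monotonicity that the duplication
        argument asks for.\<close>
      show "?pos (\<rho> u) \<le> ?pos (\<rho> v)" if "u \<in> {..<n}" "v \<in> {..<n}" "rank n \<kappa> u < rank n \<kappa> v" for u v
        using rank_mono[of u n v \<kappa>] that by (simp add: \<kappa>_def)
    qed (use \<rho>in \<rho>new in auto)
    then have "noncrossing E (rank n \<kappa>) ?\<sigma>'" by (simp add: noncrossing_def)
    moreover have "?\<sigma>' ` E \<subseteq> {1..k}"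
    proof
      fix p assume "p \<in> ?\<sigma>' ` E"
      then obtain e where e: "e \<in> E" "p = ?\<sigma>' e" by blast
      then obtain j where j: "j < m" "e = {src j, tgt j}" using edge_ex by blast
      have "?\<sigma> {\<rho> (src j), \<rho> (tgt j)} < k" using sound(3) edge[OF edge_in[OF j(1)]] by simp
      then show "p \<in> {1..k}" using e j by simp
    qed
    ultimately have be: "book_embedding k {..<n} E (list_order (map (snd ?s 2) [0..<n])) ?\<sigma>'"
      using simple q9 rank_inj rank_bound
      by (intro book_embedding_list_order[where rank = "rank n \<kappa>"]) auto
    have pg: "?\<sigma>' {fst (es ! j), snd (es ! j)} = snd ?s 3 j" if j: "j < m" for j
    proof -
      have "snd s6 3 j = 1 + snd s5 18 (\<rho> (src j) * n + \<rho> (tgt j))"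
      proof -
        have "\<rho> (src j) < n" using \<rho>in[OF edge_lt(1)[OF j]] k by (auto simp: kernel_state_def)
        moreover have "snd s5 0 j = src j" "snd s5 1 j = tgt j"
          using keepD(1)[OF k5] j by (auto simp: graph_state_def)
        ultimately show ?thesis using q6 j z5 row by simp
      qed
      also have "\<dots> = 1 + ?\<sigma> {\<rho> (src j), \<rho> (tgt j)}" using table[OF edge[OF edge_in[OF j]]] by simp
      finally show ?thesis using z9 by (simp add: src_def tgt_def)
    qed
    show ?thesis
      unfolding outputs_book_embedding_def
      by (intro exI[of _ ?\<sigma>'] conjI allI impI) (erule pg, rule be)
  qed
  moreover have "fst ?s 0 = 1" by simp
  ultimately show ?thesis by blast
qed

end

section \<open>The algorithm\<close>

text \<open>Register 1 is lowered to the size \<open>c\<close> of the cover, since further pages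
  never help, and register 5 becomes the class bound \<open>2 c^c + 1\<close>.\<close>

definition prepare_prog :: com where
  "prepare_prog = cover_prog;; Cond (Less (Var 3) (Var 1)) (Assign 1 (Var 3)) Skip;;
     For 12 2 mask_step;;
     power_prog 5 3 3;; Assign 5 (Add (Add (Var 5) (Var 5)) (Const 1));;
     For 12 0 kernel_step;; For 12 2 kernel_edge_step;;
     Assign 8 (Add (Var 6) (Var 7));; power_prog 9 6 8"

definition book_prog :: com where
  "book_prog = prepare_prog;; For 12 9 search_step;;
     Cond (Equal (Var 10) (Const 0)) (Assign 0 (Const 0)) output_prog"

lemma regs_cover_prog [simp]: "regs cover_prog = {3, 4, 12}"
  and arrs_cover_prog [simp]: "arrs cover_prog = {4, 5}"
  by (auto simp: cover_prog_def cover_step_def)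

lemma regs_mask_step [simp]: "regs mask_step = {}"
  and arrs_mask_step [simp]: "arrs mask_step = {6}"
  by (auto simp: mask_step_def)

lemma regs_kernel_step [simp]: "regs kernel_step = {6}"
  and arrs_kernel_step [simp]: "arrs kernel_step = {7, 8, 9, 10}"
  by (auto simp: kernel_step_def)

lemma regs_kernel_edge_step [simp]: "regs kernel_edge_step = {7}"
  and arrs_kernel_edge_step [simp]: "arrs kernel_edge_step = {11}"
  by (auto simp: kernel_edge_step_def)

lemma regs_search_step [simp]: "regs search_step = {10, 11, 13, 14, 15}"
  and arrs_search_step [simp]: "arrs search_step = {12}"
  by (auto simp: search_step_def decode_prog_def digit_step_def check_prog_def distinct_step_def
      page_step_def crossing_step_def)

context graph_input
begin

lemma exec_prepare:
  fixes k :: nat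
  defines "s \<equiv> input_state n k es"
  shows "\<exists>t s' xs ks. let c = length xs; N = length ks; L = N + length (kernel_edges (set ks)) in
    exec prepare_prog s t s' \<and>
    t \<le> 300 * (n + m + 1) + 60 * (c + 1) ^ 2 + 60 * ((N + 1) * (L + 1)) \<and>
    graph_state s' \<and> cover_state xs s' \<and> vertex_cover {..<n} E (set xs) \<and>
    c \<le> 2 * vertex_cover_number {..<n} E \<and> fst s' 1 = min k c \<and>
    (\<forall>v. snd s' 6 v = sum (snd s' 5) (nbr E v)) \<and>
    kernel_state ks s' \<and> kernel_classes (set xs) (snd s' 6) (2 * c ^ c + 1) ks \<and>
    kernel_edge_state (set ks) s' \<and> fst s' 8 = L \<and> fst s' 9 = N ^ L \<and>
    fst s' 10 = 0 \<and> fst s' 16 = 0 \<and> fst s' 17 = 0 \<and> (\<forall>v. snd s' 13 v = 0) \<and> (\<forall>v. snd s' 20 v = 0)"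
proof -
  have g: "graph_state s"
    by (simp add: s_def input_state_def graph_state_def src_def tgt_def)
  have z: "\<And>x. x \<notin> {0, 1, 2} \<Longrightarrow> fst s x = 0" "\<And>a v. a \<notin> {0, 1} \<Longrightarrow> snd s a v = 0" "fst s 1 = k"
    by (auto simp: s_def input_state_def)

  obtain t1 s1 where e1: "exec cover_prog s t1 s1" "t1 \<le> 100 * (m + 1)"
    and q1: "\<exists>xs. cover_state xs s1 \<and> vertex_cover {..<n} E (set xs) \<and>
      length xs \<le> 2 * vertex_cover_number {..<n} E"
    and u1: "unchanged cover_prog s s1"
    by (rule runsE[OF runs_cover_prog[OF g]]) (auto simp: z)
  from q1 obtain xs where c1: "cover_state xs s1" and vc: "vertex_cover {..<n} E (set xs)"
    and \<tau>: "length xs \<le> 2 * vertex_cover_number {..<n} E" by blast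
  let ?c = "length xs"
  have g1: "graph_state s1" by (rule graph_state_unchanged[OF g u1]) auto
  have z1: "\<And>x. x \<notin> {0, 1, 2, 3, 4, 12} \<Longrightarrow> fst s1 x = 0" "\<And>a v. a \<notin> {0, 1, 4, 5} \<Longrightarrow> snd s1 a v = 0"
    "fst s1 1 = k"
    using u1 z by (auto simp: unchanged_def)

  define s2 where "s2 = set_reg 1 (min k ?c) s1"
  let ?P2 = "Cond (Less (Var 3) (Var 1)) (Assign 1 (Var 3)) Skip"
  have "runs ?P2 s1 10 (\<lambda>s'. s' = s2)"
    by (rule runs_straight) (use c1 z1 in \<open>auto simp: s2_def cover_state_def set_reg_def min_def prod_eq_iff fun_eq_iff\<close>)
  then obtain t2 where e2: "exec ?P2 s1 t2 s2" "t2 \<le> 10"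
    by (rule runsE) auto
  have g2: "graph_state s2" using g1 by (simp add: s2_def graph_state_def)
  have c2: "cover_state xs s2" using c1 by (simp add: s2_def cover_state_def)
  have z2: "\<And>x. x \<notin> {0, 1, 2, 3, 4, 12} \<Longrightarrow> fst s2 x = 0" "\<And>a v. a \<notin> {0, 1, 4, 5} \<Longrightarrow> snd s2 a v = 0"
    "fst s2 1 = min k ?c"
    using z1 by (auto simp: s2_def)

  obtain t3 s3 where e3: "exec (For 12 2 mask_step) s2 t3 s3" "t3 \<le> 40 * (m + 1)"
    and q3: "\<forall>v. snd s3 6 v = sum (snd s2 5) (nbr E v)" and u3: "unchanged (For 12 2 mask_step) s2 s3"
    by (rule runsE[OF runs_mask[OF g2]]) (auto simp: z2)
  have g3: "graph_state s3" by (rule graph_state_unchanged[OF g2 u3]) auto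
  have c3: "cover_state xs s3" using c2 u3 by (simp add: unchanged_def cover_state_def)
  have z3: "\<And>x. x \<notin> {0, 1, 2, 3, 4, 12} \<Longrightarrow> fst s3 x = 0" "\<And>a v. a \<notin> {0, 1, 4, 5, 6} \<Longrightarrow> snd s3 a v = 0"
    "fst s3 1 = min k ?c" "snd s3 5 = snd s2 5"
    using u3 z2 by (auto simp: unchanged_def)

  have c3': "fst s3 3 = ?c" using c3 by (simp add: cover_state_def)
  obtain t4 s4 where e4: "exec (power_prog 5 3 3) s3 t4 s4" "t4 \<le> 30 * ((?c + 1) * (?c + 1))"
    and q4: "fst s4 5 = ?c ^ ?c" and u4: "unchanged (power_prog 5 3 3) s3 s4"
    by (rule runsE[OF runs_power_prog[OF c3' c3', of 5]]) auto

  define s5 where "s5 = set_reg 5 (2 * ?c ^ ?c + 1) s4"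
  have e5: "exec (Assign 5 (Add (Add (Var 5) (Var 5)) (Const 1))) s4 6 s5"
  proof -
    have "1 + cost (Add (Add (Var 5) (Var 5)) (Const 1)) = 6"
      "set_reg 5 (eval (Add (Add (Var 5) (Var 5)) (Const 1)) s4) s4 = s5"
      using q4 by (simp_all add: s5_def mult_2)
    then show ?thesis using exec.Assign by metis
  qed
  have f5: "snd s5 = snd s3" "\<And>x. x \<notin> {5, 12, 13, 14} \<Longrightarrow> fst s5 x = fst s3 x"
    using u4 by (auto simp: s5_def unchanged_def fun_eq_iff)
  have h5: "fst s5 5 = 2 * ?c ^ ?c + 1" by (simp add: s5_def)
  have g5: "graph_state s5" using g3 by (simp add: graph_state_def f5)
  have c5: "cover_state xs s5" using c3 by (simp add: cover_state_def f5)
  have z5: "\<And>x. x \<notin> {0, 1, 2, 3, 4, 5, 12, 13, 14} \<Longrightarrow> fst s5 x = 0"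
    "\<And>a v. a \<notin> {0, 1, 4, 5, 6} \<Longrightarrow> snd s5 a v = 0" "fst s5 1 = min k ?c"
    using z3 by (auto simp: f5)

  obtain t6 s6 where e6: "exec (For 12 0 kernel_step) s5 t6 s6" "t6 \<le> 60 * (n + 1)"
    and q6: "\<exists>ks. kernel_state ks s6 \<and> kernel_classes (set xs) (snd s5 6) (fst s5 5) ks"
    and u6: "unchanged (For 12 0 kernel_step) s5 s6"
    by (rule runsE[OF runs_kernel[OF g5 c5]]) (auto simp: z5)
  from q6 obtain ks where k6: "kernel_state ks s6" and cl: "kernel_classes (set xs) (snd s5 6) (fst s5 5) ks"
    by blast
  let ?N = "length ks" and ?js = "kernel_edges (set ks)"
  let ?L = "?N + length ?js"
  have g6: "graph_state s6" by (rule graph_state_unchanged[OF g5 u6]) auto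
  have c6: "cover_state xs s6" using c5 u6 by (simp add: unchanged_def cover_state_def)
  have z6: "\<And>x. x \<notin> {0, 1, 2, 3, 4, 5, 6, 12, 13, 14} \<Longrightarrow> fst s6 x = 0"
    "\<And>a v. a \<notin> {0, 1, 4, 5, 6, 7, 8, 9, 10} \<Longrightarrow> snd s6 a v = 0" "fst s6 1 = min k ?c"
    "snd s6 6 = snd s5 6" "snd s6 5 = snd s5 5"
    using z5 u6 by (auto simp: unchanged_def)

  have z6': "fst s6 7 = 0" using z6(1) by simp
  obtain t7 s7 where e7: "exec (For 12 2 kernel_edge_step) s6 t7 s7" "t7 \<le> 40 * (m + 1)"
    and q7: "kernel_edge_state (set ks) s7" and u7: "unchanged (For 12 2 kernel_edge_step) s6 s7"
    by (rule runsE[OF runs_kernel_edges[OF g6 k6 z6']]) blast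
  have g7: "graph_state s7" by (rule graph_state_unchanged[OF g6 u7]) auto
  have c7: "cover_state xs s7" using c6 u7 by (simp add: unchanged_def cover_state_def)
  have k7: "kernel_state ks s7" using k6 u7 by (simp add: unchanged_def kernel_state_def)
  have z7: "\<And>x. x \<notin> {0, 1, 2, 3, 4, 5, 6, 7, 12, 13, 14} \<Longrightarrow> fst s7 x = 0"
    "\<And>a v. a \<notin> {0, 1, 4, 5, 6, 7, 8, 9, 10, 11} \<Longrightarrow> snd s7 a v = 0" "fst s7 1 = min k ?c"
    "snd s7 6 = snd s5 6" "snd s7 5 = snd s5 5"
    using z6 u7 by (auto simp: unchanged_def)

  define s8 where "s8 = set_reg 8 ?L s7"
  have e8: "exec (Assign 8 (Add (Var 6) (Var 7))) s7 4 s8"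
  proof -
    have "1 + cost (Add (Var 6) (Var 7)) = 4" "set_reg 8 (eval (Add (Var 6) (Var 7)) s7) s7 = s8"
      using k7 q7 by (simp_all add: s8_def kernel_state_def kernel_edge_state_def)
    then show ?thesis using exec.Assign by metis
  qed
  have r8: "fst s8 6 = ?N" "fst s8 8 = ?L" using k7 by (simp_all add: s8_def kernel_state_def)
  obtain t9 s9 where e9: "exec (power_prog 9 6 8) s8 t9 s9" "t9 \<le> 30 * ((?N + 1) * (?L + 1))"
    and q9: "fst s9 9 = ?N ^ ?L" and u9: "unchanged (power_prog 9 6 8) s8 s9"
    by (rule runsE[OF runs_power_prog[OF r8, of 9]]) auto
  have f9: "snd s9 = snd s7" "\<And>x. x \<notin> {8, 9, 12, 13, 14} \<Longrightarrow> fst s9 x = fst s7 x" "fst s9 8 = ?L"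
    using u9 by (auto simp: s8_def unchanged_def fun_eq_iff)

  have "exec prepare_prog s (t1 + (t2 + (t3 + (t4 + (6 + (t6 + (t7 + (4 + t9)))))))) s9"
    unfolding prepare_prog_def
    by (intro exec.Seq[OF e1(1)] exec.Seq[OF e2(1)] exec.Seq[OF e3(1)] exec.Seq[OF e4(1)]
        exec.Seq[OF e5] exec.Seq[OF e6(1)] exec.Seq[OF e7(1)] exec.Seq[OF e8] e9(1))
  moreover have "t1 + (t2 + (t3 + (t4 + (6 + (t6 + (t7 + (4 + t9))))))) \<le>
    300 * (n + m + 1) + 60 * (?c + 1) ^ 2 + 60 * ((?N + 1) * (?L + 1))"
  proof -
    have "t1 + t2 + t3 + 6 + t6 + t7 + 4 \<le> 300 * (n + m + 1)"
      using e1(2) e2(2) e3(2) e6(2) e7(2) by simp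
    moreover have "t4 \<le> 60 * (?c + 1) ^ 2"
      using order_trans[OF e4(2) mult_le_mono1[of 30 60]] by (simp only: power2_eq_square)
    moreover have "t9 \<le> 60 * ((?N + 1) * (?L + 1))"
      using order_trans[OF e9(2) mult_le_mono1[of 30 60]] by simp
    ultimately show ?thesis by linarith
  qed
  moreover have "graph_state s9" "cover_state xs s9" "kernel_state ks s9" "kernel_edge_state (set ks) s9"
    using g7 c7 k7 q7 by (simp_all add: f9 graph_state_def cover_state_def kernel_state_def kernel_edge_state_def)
  moreover have "fst s9 1 = min k ?c" "fst s9 10 = 0" "fst s9 16 = 0" "fst s9 17 = 0"
    "\<forall>v. snd s9 13 v = 0" "\<forall>v. snd s9 20 v = 0"
    using z7 by (simp_all add: f9)
  moreover have "\<forall>v. snd s9 6 v = sum (snd s9 5) (nbr E v)"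
    using q3 z3 z7 f5 by (simp add: f9)
  moreover have "kernel_classes (set xs) (snd s9 6) (2 * ?c ^ ?c + 1) ks"
    using cl h5 z7 by (simp add: f9)
  ultimately show ?thesis
    unfolding Let_def using vc \<tau> q9 f9(3) by blast
qed

text \<open>The sizes of the cover, the kernel and the codes are exposed only through inequalities,
  so that the passage to a bound in terms of \<tau> is pure arithmetic.\<close>

lemma exec_book_prog:
  fixes k :: nat
  shows "\<exists>t s c N L. exec book_prog (input_state n k es) t s \<and>
    t \<le> 600 * (n + m + 1) + 2000 * (N ^ L + L + 1) ^ 3 \<and>
    c \<le> 2 * vertex_cover_number {..<n} E \<and> m \<le> c * n \<and> N \<le> c + 2 ^ c * (2 * c ^ c + 1) \<and>
    L \<le> N + N * N \<and>
    fst s 0 = (if book_thickness {..<n} E \<le> k then 1 else 0) \<and>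
    (book_thickness {..<n} E \<le> k \<longrightarrow> outputs_book_embedding k n E es s)"
proof -
  obtain t1 s1 xs ks where
    e1: "exec prepare_prog (input_state n k es) t1 s1"
    and t1: "t1 \<le> 300 * (n + m + 1) + 60 * (length xs + 1) ^ 2 +
      60 * ((length ks + 1) * (length ks + length (kernel_edges (set ks)) + 1))"
    and g1: "graph_state s1" and c1: "cover_state xs s1" and vc: "vertex_cover {..<n} E (set xs)"
    and \<tau>: "length xs \<le> 2 * vertex_cover_number {..<n} E" and r1: "fst s1 1 = min k (length xs)"
    and \<mu>: "\<forall>v. snd s1 6 v = sum (snd s1 5) (nbr E v)"
    and k1: "kernel_state ks s1"
    and cl: "kernel_classes (set xs) (snd s1 6) (2 * length xs ^ length xs + 1) ks"
    and ke: "kernel_edge_state (set ks) s1"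
    and r8: "fst s1 8 = length ks + length (kernel_edges (set ks))"
    and r9: "fst s1 9 = length ks ^ (length ks + length (kernel_edges (set ks)))"
    and z1: "fst s1 10 = 0" "fst s1 16 = 0" "fst s1 17 = 0" "\<forall>v. snd s1 13 v = 0" "\<forall>v. snd s1 20 v = 0"
    using exec_prepare[of k] unfolding Let_def by blast
  define c N L where "c = length xs" and "N = length ks" and "L = N + length (kernel_edges (set ks))"
  let ?k = "min k c"
  have card: "card (set xs) = c" "card (set ks) = N"
    using c1 k1 by (auto simp: cover_state_def kernel_state_def distinct_card c_def N_def)
  have "set xs \<subseteq> set ks" using cl by (simp add: kernel_classes_def)
  then have cN: "c \<le> N" using card_mono[of "set ks" "set xs"] card by simp
  have NL: "N \<le> L" by (simp add: L_def)
  have bt: "book_thickness {..<n} E \<le> k \<longleftrightarrow> (\<exists>r \<sigma>. book_embedding ?k {..<n} E r \<sigma>)"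
    using book_thickness_le_iff[OF simple vc, of k] card by simp

  obtain t2 s2 where e2: "exec (For 12 9 search_step) s1 t2 s2" "t2 \<le> 1000 * (N ^ L + L + 1) ^ 3"
    and q2: "fst s2 10 = 1 \<and> (\<forall>i<L. snd s2 12 i < N) \<and> valid_code ?k ks (snd s1 9) (snd s2 12) \<or>
      fst s2 10 = 0 \<and> (\<forall>d. (\<forall>i<L. d i < N) \<longrightarrow> \<not> valid_code ?k ks (snd s1 9) d)"
    and u2: "unchanged (For 12 9 search_step) s1 s2"
    using runsE[OF runs_search[OF g1 k1 ke r8 r9 z1(1) r1 refl refl]]
    unfolding c_def N_def L_def by blast
  have f2: "\<And>x. x \<notin> {10, 11, 12, 13, 14, 15} \<Longrightarrow> fst s2 x = fst s1 x" "\<And>a. a \<noteq> 12 \<Longrightarrow> snd s2 a = snd s1 a"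
    using u2 by (auto simp: unchanged_def)
  let ?P3 = "Cond (Equal (Var 10) (Const 0)) (Assign 0 (Const 0)) output_prog"
  have "\<exists>t3 s3. exec ?P3 s2 t3 s3 \<and> t3 \<le> 10 + 200 * (n + m + 1) + 200 * (L + 1) ^ 2 \<and>
    fst s3 0 = (if book_thickness {..<n} E \<le> k then 1 else 0) \<and>
    (book_thickness {..<n} E \<le> k \<longrightarrow> outputs_book_embedding k n E es s3)"
  proof (cases "fst s2 10 = 0")
    case True
    then have no: "\<And>d. (\<forall>i<L. d i < N) \<Longrightarrow> \<not> valid_code ?k ks (snd s1 9) d" using q2 by auto
    have "\<not> book_thickness {..<n} E \<le> k"
    proof
      assume "book_thickness {..<n} E \<le> k"
      then obtain r \<sigma> where "book_embedding ?k {..<n} E r \<sigma>" using bt by blast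
      moreover have "?k \<le> length ks" using cN by (simp add: N_def)
      ultimately obtain d where "\<forall>i<L. d i < N" "valid_code ?k ks (snd s1 9) d"
        using valid_code_complete[OF k1] unfolding L_def N_def by blast
      then show False using no by blast
    qed
    moreover have "exec ?P3 s2 (1 + bcost (Equal (Var 10) (Const 0)) + (1 + cost (Const 0)))
      (set_reg 0 (eval (Const 0) s2) s2)"
      using True by (intro exec.CondTrue exec.Assign) simp
    ultimately show ?thesis by (intro exI conjI) (assumption | simp)+
  next
    case False
    with q2 have valid: "valid_code ?k ks (snd s1 9) (snd s2 12)" "\<And>i. i < L \<Longrightarrow> snd s2 12 i < N" by auto
    have g2: "graph_state s2" and k2: "kernel_state ks s2" and ke2: "kernel_edge_state (set ks) s2"
      using g1 k1 ke by (simp_all add: graph_state_def kernel_state_def kernel_edge_state_def f2)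
    have C: "snd s2 4 v = 0 \<longleftrightarrow> v \<notin> set xs" for v
      using c1 by (simp add: cover_state_def f2)
    have nb: "nbr E u \<subseteq> set xs" if "u \<notin> set xs" for u
      using vc that by (auto simp: nbr_def vertex_cover_def)
    have \<mu>2: "nbr E u = nbr E v" if "u \<notin> set xs" "v \<notin> set xs" "snd s2 6 u = snd s2 6 v" for u v
      using mask_inj[OF c1 nb[OF that(1)] nb[OF that(2)]] \<mu> that(3) by (simp add: f2)
    have h: "2 * ?k ^ card U < 2 * c ^ c + 1" if "U \<subseteq> set xs" for U
    proof -
      have U: "card U \<le> c" using card_mono[OF _ that] card by simp
      have "?k ^ card U \<le> c ^ card U" by (intro power_mono) auto
      also have "\<dots> \<le> c ^ c"
      \<comment> \<open>Monotonicity in the exponent needs a base of at least 1. For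
        \<open>c = 0\<close> the set \<open>U\<close> is empty and both sides are
        \<open>0 ^ 0 = 1\<close>.\<close>
      proof (cases "c = 0")
        case False
        then show ?thesis using U by (intro power_increasing) auto
      qed (use U in simp)
      finally show ?thesis by simp
    qed
    have "\<exists>t s'. exec output_prog s2 t s' \<and> t \<le> 200 * (n + m + 1) + 200 * (L + 1) ^ 2 \<and>
      fst s' 0 = 1 \<and> outputs_book_embedding ?k n E es s'"
    proof (rule runs_output[OF g2 k2 ke2 vc C _ h \<mu>2])
      show "kernel_classes (set xs) (snd s2 6) (2 * c ^ c + 1) ks" using cl by (simp add: f2 c_def)
      show "L = length ks + length (kernel_edges (set ks))" by (simp add: L_def N_def)
      show "valid_code ?k ks (snd s2 9) (snd s2 12)" using valid(1) by (simp add: f2)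
      show "snd s2 12 i < length ks" if "i < L" for i using valid(2)[OF that] by (simp add: N_def)
    qed (use z1 in \<open>auto simp: f2\<close>)
    then obtain t s' where e: "exec output_prog s2 t s'" "t \<le> 200 * (n + m + 1) + 200 * (L + 1) ^ 2"
      "fst s' 0 = 1" "outputs_book_embedding ?k n E es s'" by blast
    obtain \<sigma> where \<sigma>: "\<And>j. j < m \<Longrightarrow> \<sigma> {fst (es ! j), snd (es ! j)} = snd s' 3 j"
      "book_embedding ?k {..<n} E (list_order (map (snd s' 2) [0..<n])) \<sigma>"
      using e(4) unfolding outputs_book_embedding_def by blast
    then have "book_thickness {..<n} E \<le> k" using bt by blast
    moreover have "outputs_book_embedding k n E es s'"
      unfolding outputs_book_embedding_def
      by (intro exI[of _ \<sigma>] conjI allI impI) (use \<sigma> book_embedding_mono[OF \<sigma>(2), of k] in auto)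
    moreover have "exec ?P3 s2 (1 + bcost (Equal (Var 10) (Const 0)) + t) s'"
      using False e(1) by (intro exec.CondFalse) simp
    moreover have "1 + bcost (Equal (Var 10) (Const 0)) + t \<le> 10 + 200 * (n + m + 1) + 200 * (L + 1) ^ 2"
      using e(2) by simp
    ultimately show ?thesis using e(3) by (metis (no_types, lifting))
  qed
  then obtain t3 s3 where e3: "exec ?P3 s2 t3 s3" "t3 \<le> 10 + 200 * (n + m + 1) + 200 * (L + 1) ^ 2"
    and res: "fst s3 0 = (if book_thickness {..<n} E \<le> k then 1 else 0)"
      "book_thickness {..<n} E \<le> k \<longrightarrow> outputs_book_embedding k n E es s3" by blast
  have "exec book_prog (input_state n k es) (t1 + (t2 + t3)) s3"
    unfolding book_prog_def by (intro exec.Seq[OF e1] exec.Seq[OF e2(1)] e3(1))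
  moreover have "t1 + (t2 + t3) \<le> 600 * (n + m + 1) + 2000 * (N ^ L + L + 1) ^ 3"
  proof -
    \<comment> \<open>\<open>S\<close> dominates \<open>c\<close>, \<open>N\<close> and
      \<open>L\<close>, so the quadratic terms are all below \<open>S ^ 3\<close>.\<close>
    define S where "S = N ^ L + L + 1"
    have S: "1 \<le> S" "L + 1 \<le> S" "c + 1 \<le> S" "N + 1 \<le> S" using cN NL by (auto simp: S_def)
    have sq: "x * y \<le> S ^ 3" if "x \<le> S" "y \<le> S" for x y
    proof -
      have "x * y \<le> S * S" using that by (rule mult_le_mono)
      also have "\<dots> \<le> S ^ 3" using S(1) by (simp add: power3_eq_cube)
      finally show ?thesis .
    qed
    have p: "(c + 1) ^ 2 \<le> S ^ 3" "(L + 1) ^ 2 \<le> S ^ 3" "(N + 1) * (L + 1) \<le> S ^ 3"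
      unfolding power2_eq_square using S by (auto intro!: sq simp del: mult_Suc mult_Suc_right)
    have "t1 \<le> 300 * (n + m + 1) + 60 * (c + 1) ^ 2 + 60 * ((N + 1) * (L + 1))"
      using t1 by (simp add: c_def N_def L_def)
    also have "\<dots> \<le> 300 * (n + m + 1) + 60 * S ^ 3 + 60 * S ^ 3"
      by (intro add_mono mult_le_mono2 order_refl p)
    finally have "t1 \<le> 300 * (n + m + 1) + 120 * S ^ 3" by simp
    moreover have "t3 \<le> 10 + 200 * (n + m + 1) + 200 * S ^ 3"
      by (rule order_trans[OF e3(2)]) (intro add_mono mult_le_mono2 order_refl p)
    moreover have "t2 \<le> 1000 * S ^ 3" using e2(2) by (simp add: S_def)
    ultimately have "t1 + (t2 + t3) \<le> 600 * (n + m + 1) + 2000 * S ^ 3" by simp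
    then show ?thesis by (simp add: S_def)
  qed
  moreover have "m \<le> c * n" using edges_le[OF vc] card by simp
  moreover have "N \<le> c + 2 ^ c * (2 * c ^ c + 1)"
    using card_kernel_le[OF c1 vc _ cl] \<mu> card by (simp add: c_def)
  moreover have "L \<le> N + N * N"
    using card_kernel_edges_le[of ks] card by (simp add: L_def)
  moreover have "c \<le> 2 * vertex_cover_number {..<n} E" using \<tau> by (simp add: c_def)
  ultimately show ?thesis using res by blast
qed

end

text \<open>For \<tau> \<ge> 2, constants are absorbed into powers of \<tau> through 2 \<le> \<tau>
  and 4 \<le> \<tau>^2. The exponents grow as follows: \<open>4 * \<tau>\<close> for
  \<open>c ^ c\<close>, \<open>5 * \<tau>\<close> for the class bound, \<open>8 * \<tau>\<close> for
  \<open>N\<close>, \<open>17 * \<tau>\<close> for \<open>L\<close>. In the upper level of the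
  tower, \<open>21 * \<tau>\<close> suffices for \<open>N ^ L\<close> and \<open>25 * \<tau>\<close>
  for the cube.\<close>

lemma search_cost_le:
  fixes \<tau> c N L :: nat
  assumes \<tau>: "2 \<le> \<tau>" and c: "c \<le> 2 * \<tau>" and N: "N \<le> c + 2 ^ c * (2 * c ^ c + 1)"
    and L: "L \<le> N + N * N"
  shows "(N ^ L + L + 1) ^ 3 \<le> \<tau> ^ (\<tau> ^ (25 * \<tau>))"
proof -
  have inc: "\<tau> ^ a \<le> \<tau> ^ b" if "a \<le> b" for a b using that \<tau> by (intro power_increasing) auto
  have ge1: "1 \<le> \<tau> ^ a" for a using \<tau> by simp
  have two: "2 * x \<le> \<tau> * x" for x using \<tau> by simp
  have four: "x * 4 \<le> \<tau> ^ 2 * x" for x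
    using mult_le_mono[OF \<tau> \<tau>] by (simp add: power2_eq_square)
  have c2: "c \<le> \<tau> ^ 2" using order_trans[OF c two[of \<tau>]] by (simp only: power2_eq_square)
  have "c ^ c \<le> (\<tau> ^ 2) ^ c" using c2 by (intro power_mono) auto
  also have "\<dots> \<le> (\<tau> ^ 2) ^ (2 * \<tau>)" using c \<tau> by (intro power_increasing) auto
  also have "\<dots> = \<tau> ^ (4 * \<tau>)" by (simp flip: power_mult)
  finally have cc: "c ^ c \<le> \<tau> ^ (4 * \<tau>)" .
  have "2 ^ c \<le> \<tau> ^ c" using \<tau> by (intro power_mono) auto
  also have "\<dots> \<le> \<tau> ^ (2 * \<tau>)" using c by (rule inc)
  finally have tc: "2 ^ c \<le> \<tau> ^ (2 * \<tau>)" .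
  have "2 * c ^ c + 1 \<le> \<tau> ^ (4 * \<tau>) * 4" using cc ge1[of "4 * \<tau>"] by linarith
  also have "\<dots> \<le> \<tau> ^ 2 * \<tau> ^ (4 * \<tau>)" by (rule four)
  also have "\<dots> \<le> \<tau> ^ (5 * \<tau>)" unfolding power_add[symmetric] using \<tau> by (intro inc) simp
  finally have h: "2 * c ^ c + 1 \<le> \<tau> ^ (5 * \<tau>)" .
  have "N \<le> \<tau> ^ 2 + \<tau> ^ (2 * \<tau>) * \<tau> ^ (5 * \<tau>)"
    using N c2 mult_le_mono[OF tc h] by linarith
  also have "\<tau> ^ (2 * \<tau>) * \<tau> ^ (5 * \<tau>) = \<tau> ^ (7 * \<tau>)" by (simp flip: power_add)
  also have "\<tau> ^ 2 + \<tau> ^ (7 * \<tau>) \<le> 2 * \<tau> ^ (7 * \<tau>)" using inc[of 2 "7 * \<tau>"] \<tau> by simp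
  also have "\<dots> \<le> \<tau> * \<tau> ^ (7 * \<tau>)" by (rule two)
  also have "\<dots> \<le> \<tau> ^ (8 * \<tau>)" unfolding power_Suc[symmetric] using \<tau> by (intro inc) simp
  finally have N8: "N \<le> \<tau> ^ (8 * \<tau>)" .
  have "L \<le> \<tau> ^ (8 * \<tau>) + \<tau> ^ (8 * \<tau>) * \<tau> ^ (8 * \<tau>)"
    using L N8 mult_le_mono[OF N8 N8] by linarith
  also have "\<dots> = \<tau> ^ (8 * \<tau>) + \<tau> ^ (16 * \<tau>)" by (simp flip: power_add)
  also have "\<dots> \<le> 2 * \<tau> ^ (16 * \<tau>)" using inc[of "8 * \<tau>" "16 * \<tau>"] by simp
  also have "\<dots> \<le> \<tau> * \<tau> ^ (16 * \<tau>)" by (rule two)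
  also have "\<dots> \<le> \<tau> ^ (17 * \<tau>)" unfolding power_Suc[symmetric] using \<tau> by (intro inc) simp
  finally have L17: "L \<le> \<tau> ^ (17 * \<tau>)" .
  \<comment> \<open>\<open>x\<close> will bound \<open>8 * \<tau> * L\<close>, the exponent of
    \<open>N ^ L\<close> in base \<tau>: the factor \<open>8 * \<tau>\<close> is at most
    \<open>\<tau> ^ 4\<close>, and 17 + 4 = 21.\<close>
  define x where "x = \<tau> ^ (21 * \<tau>)"
  have x1: "1 \<le> x" unfolding x_def by (rule ge1)
  have pw4: "\<tau> ^ 4 \<le> \<tau> ^ (4 * \<tau>)" using \<tau> by (intro inc) simp
  have sixteen: "16 \<le> \<tau> ^ 4" using power_mono[OF \<tau>, of 4] by simp
  have eight: "8 * \<tau> \<le> \<tau> ^ 4"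
  proof -
    have "8 \<le> \<tau> ^ 3" using power_mono[OF \<tau>, of 3] by simp
    then have "8 * \<tau> \<le> \<tau> ^ 3 * \<tau>" by (rule mult_le_mono1)
    also have "\<dots> = \<tau> ^ 4" by (simp add: power_numeral_reduce)
    finally show ?thesis .
  qed
  have "N ^ L \<le> (\<tau> ^ (8 * \<tau>)) ^ L" using N8 by (intro power_mono) auto
  also have "\<dots> = \<tau> ^ (8 * \<tau> * L)" by (simp flip: power_mult)
  also have "\<dots> \<le> \<tau> ^ x"
  proof (rule inc)
    have "8 * \<tau> * L \<le> \<tau> ^ (4 * \<tau>) * \<tau> ^ (17 * \<tau>)"
      using eight pw4 L17 by (intro mult_le_mono) auto
    also have "\<dots> = x" by (simp add: x_def flip: power_add)
    finally show "8 * \<tau> * L \<le> x" .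
  qed
  finally have Z: "N ^ L \<le> \<tau> ^ x" .
  have "L \<le> x" using L17 inc[of "17 * \<tau>" "21 * \<tau>"] unfolding x_def by simp
  also have "x \<le> \<tau> ^ x"
  proof -
    have "x \<le> 2 ^ x" using less_exp[of x] by simp
    also have "\<dots> \<le> \<tau> ^ x" using \<tau> by (intro power_mono) auto
    finally show ?thesis .
  qed
  finally have "N ^ L + L + 1 \<le> \<tau> ^ x * 4" using Z ge1[of x] by linarith
  also have "\<dots> \<le> \<tau> ^ 2 * \<tau> ^ x" by (rule four)
  also have "\<dots> = \<tau> ^ (2 + x)" by (rule power_add[symmetric])
  finally have "(N ^ L + L + 1) ^ 3 \<le> (\<tau> ^ (2 + x)) ^ 3" by (intro power_mono) auto
  also have "\<dots> = \<tau> ^ ((2 + x) * 3)" by (rule power_mult[symmetric])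
  also have "\<dots> \<le> \<tau> ^ (\<tau> ^ (25 * \<tau>))"
  proof (rule inc)
    \<comment> \<open>The factor 16 is at most \<open>\<tau> ^ 4\<close>, which raises the
      coefficient from 21 to 25.\<close>
    have "(2 + x) * 3 \<le> 16 * x" using x1 by simp
    also have "\<dots> \<le> \<tau> ^ (4 * \<tau>) * x" using sixteen pw4 by (intro mult_le_mono1) simp
    also have "\<dots> = \<tau> ^ (25 * \<tau>)" by (simp add: x_def flip: power_add)
    finally show "(2 + x) * 3 \<le> \<tau> ^ (25 * \<tau>)" .
  qed
  finally show ?thesis .
qed

text \<open>For \<tau> \<le> 1 the tower of powers of \<tau> is at most 1 and absorbs nothing, but
  then \<open>c \<le> 2\<close> and the search has constant cost. The number 38 is
  \<open>2 + 2^2 * (2 * 2^2 + 1)\<close>, the bound on the kernel for \<open>c = 2\<close>.\<close>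

lemma search_cost_small:
  fixes c N L :: nat
  assumes c: "c \<le> 2" and N: "N \<le> c + 2 ^ c * (2 * c ^ c + 1)" and L: "L \<le> N + N * N"
  shows "(N ^ L + L + 1) ^ 3 \<le> (38 ^ (38 + 38 * 38) + (38 + 38 * 38) + 1) ^ 3"
proof -
  \<comment> \<open>Hiding 38 behind a name keeps its huge powers from being evaluated.\<close>
  define b :: nat where "b = 38"
  have "c \<in> {0, 1, 2}" using c by auto
  then have Nb: "N \<le> b" unfolding b_def using N by auto
  have Lb: "L \<le> b + b * b" using L Nb mult_le_mono[OF Nb Nb] by linarith
  have "N ^ L \<le> b ^ (b + b * b)"
  proof -
    have "N ^ L \<le> b ^ L" using Nb by (intro power_mono) auto
    also have "\<dots> \<le> b ^ (b + b * b)" using Lb by (intro power_increasing) (auto simp: b_def)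
    finally show ?thesis .
  qed
  then have "(N ^ L + L + 1) ^ 3 \<le> (b ^ (b + b * b) + (b + b * b) + 1) ^ 3"
    using Lb by (intro power_mono add_mono) auto
  then show ?thesis unfolding b_def .
qed

text \<open>The linear part rests on \<open>m \<le> 2 * \<tau> * n\<close> and
  \<open>\<tau> \<le> 2 ^ \<tau>\<close>; the search is paid for by the tower if \<tau> \<ge> 2 and
  by the constant factor otherwise.\<close>

lemma running_time_le:
  "\<exists>K. \<forall>\<tau> c N L n m :: nat. c \<le> 2 * \<tau> \<longrightarrow> m \<le> c * n \<longrightarrow> N \<le> c + 2 ^ c * (2 * c ^ c + 1) \<longrightarrow> L \<le> N + N * N \<longrightarrow>
    600 * (n + m + 1) + 2000 * (N ^ L + L + 1) ^ 3 \<le> K * max 1 (\<tau> ^ (\<tau> ^ (25 * \<tau>)) + 2 ^ \<tau> * n)"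
proof -
  \<comment> \<open>\<open>B\<close> is introduced opaquely, as its value is far too large to be
    computed.\<close>
  obtain B :: nat where B: "B = (38 ^ (38 + 38 * 38) + (38 + 38 * 38) + 1) ^ 3" by blast
  have "600 * (n + m + 1) + 2000 * (N ^ L + L + 1) ^ 3 \<le>
      (2400 + 2000 * (B + 1)) * max 1 (\<tau> ^ (\<tau> ^ (25 * \<tau>)) + 2 ^ \<tau> * n)"
    if c: "c \<le> 2 * \<tau>" and m: "m \<le> c * n" and N: "N \<le> c + 2 ^ c * (2 * c ^ c + 1)" and L: "L \<le> N + N * N"
    for \<tau> c N L n m :: nat
  proof -
    define G where "G = max 1 (\<tau> ^ (\<tau> ^ (25 * \<tau>)) + 2 ^ \<tau> * n)"
    have G: "1 \<le> G" "\<tau> ^ (\<tau> ^ (25 * \<tau>)) \<le> G" "2 ^ \<tau> * n \<le> G" by (auto simp: G_def)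
    have tau: "\<tau> \<le> 2 ^ \<tau>" using less_exp[of \<tau>] by simp
    have "n \<le> 2 ^ \<tau> * n" by simp
    moreover have "m \<le> 2 * (2 ^ \<tau> * n)"
    proof -
      have "m \<le> (2 * \<tau>) * n" using m c by (meson mult_le_mono1 order_trans)
      also have "\<dots> \<le> (2 * 2 ^ \<tau>) * n" using tau by (intro mult_le_mono1) simp
      finally show ?thesis by simp
    qed
    ultimately have lin: "n + m + 1 \<le> 4 * G" using G by linarith
    have "(N ^ L + L + 1) ^ 3 \<le> (B + 1) * G"
    proof (cases "2 \<le> \<tau>")
      case True
      from search_cost_le[OF this c N L] G(2) have "(N ^ L + L + 1) ^ 3 \<le> G" by (rule order_trans)
      then show ?thesis by (rule order_trans) simp
    next
      case False
      then have "c \<le> 2" using c by simp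
      from search_cost_small[OF this N L] have "(N ^ L + L + 1) ^ 3 \<le> B" unfolding B .
      also have "B \<le> (B + 1) * G"
        using mult_le_mono[of B "B + 1" 1 G] G(1) by simp
      finally show ?thesis .
    qed
    then have "600 * (n + m + 1) + 2000 * (N ^ L + L + 1) ^ 3 \<le> 600 * (4 * G) + 2000 * ((B + 1) * G)"
      using lin by (intro add_mono mult_le_mono2)
    also have "\<dots> = (2400 + 2000 * (B + 1)) * G" by (simp add: algebra_simps)
    finally show ?thesis unfolding G_def .
  qed
  then show ?thesis by blast
qed

(* For n > 0 the bracketed quantity is positive, so "max 1" only matters for the
   graph without vertices, where it would be 0 and no program halts in 0 steps. *)
theorem theorem3:
  shows "\<exists>(P :: com) (c :: nat) (d :: nat).
    \<forall>(n :: nat) (E :: nat set set) (es :: (nat \<times> nat) list) (k :: nat) (\<tau> :: nat).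
      simple_graph {..<n} E \<and> edge_list es E \<and> k \<ge> 1 \<and>
      \<tau> = vertex_cover_number {..<n} E \<longrightarrow>
      (\<exists>t s. exec P (input_state n k es) t s \<and>
             t \<le> c * max 1 (\<tau> ^ (\<tau> ^ (d * \<tau>)) + 2 ^ \<tau> * n) \<and>
             fst s 0 = (if book_thickness {..<n} E \<le> k then 1 else 0) \<and>
             (book_thickness {..<n} E \<le> k \<longrightarrow> outputs_book_embedding k n E es s))"
proof -
  obtain K where K: "\<And>\<tau> c N L n m :: nat. c \<le> 2 * \<tau> \<Longrightarrow> m \<le> c * n \<Longrightarrow>
      N \<le> c + 2 ^ c * (2 * c ^ c + 1) \<Longrightarrow> L \<le> N + N * N \<Longrightarrow>
      600 * (n + m + 1) + 2000 * (N ^ L + L + 1) ^ 3 \<le> K * max 1 (\<tau> ^ (\<tau> ^ (25 * \<tau>)) + 2 ^ \<tau> * n)"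
    using running_time_le by blast
  show ?thesis
  proof (rule exI[of _ book_prog], rule exI[of _ K], rule exI[of _ 25], intro allI impI, elim conjE)
    fix n :: nat and E es k \<tau>
    assume "simple_graph {..<n} E" "edge_list es E" and \<tau>: "\<tau> = vertex_cover_number {..<n} E"
    then interpret graph_input n E es by unfold_locales
    obtain t s c N L where e: "exec book_prog (input_state n k es) t s"
      and t: "t \<le> 600 * (n + m + 1) + 2000 * (N ^ L + L + 1) ^ 3"
      and b: "c \<le> 2 * vertex_cover_number {..<n} E" "m \<le> c * n" "N \<le> c + 2 ^ c * (2 * c ^ c + 1)"
        "L \<le> N + N * N"
      and res: "fst s 0 = (if book_thickness {..<n} E \<le> k then 1 else 0)"
        "book_thickness {..<n} E \<le> k \<longrightarrow> outputs_book_embedding k n E es s"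
      using exec_book_prog[of k] by blast
    have "t \<le> K * max 1 (\<tau> ^ (\<tau> ^ (25 * \<tau>)) + 2 ^ \<tau> * n)"
      using order_trans[OF t K[OF _ b(2-4)]] b(1) \<tau> by simp
    with e res show "\<exists>t s. exec book_prog (input_state n k es) t s \<and>
             t \<le> K * max 1 (\<tau> ^ (\<tau> ^ (25 * \<tau>)) + 2 ^ \<tau> * n) \<and>
             fst s 0 = (if book_thickness {..<n} E \<le> k then 1 else 0) \<and>
             (book_thickness {..<n} E \<le> k \<longrightarrow> outputs_book_embedding k n E es s)"
      by blast
  qed
qed

end
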